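(* Let $\mathcal S$ be an irreducible binary finite type constraint with topological order $\hat m=\hat m(\mathcal S)$. Let $C(\mathcal S,\varepsilon)$ be the noisy constrained capacity of $\mathrm{BSC}(\varepsilon)$ with inputs constrained to $\mathcal S$, let $C(\mathcal S)=C(\mathcal S,0)$, and let $X_{\vec p^{\max}}$ be the maximal entropy Markov chain of $\mathcal S$. Then, as $\varepsilon\to0^+$, $$C(\mathcal S,\varepsilon)=C(\mathcal S)+(f(X_{\vec p^{\max}})-1)\,\varepsilon\log(1/\varepsilon)+(g(X_{\vec p^{\max}})-1)\,\varepsilon+O(\varepsilon^2\log^2\varepsilon).$$ In fact, for each $m\ge\hat m(\mathcal S)$, $$h_m(\mathcal S,\varepsilon)-H(\varepsilon)=C(\mathcal S)+(f(X_{\vec p^{\max}})-1)\,\varepsilon\log(1/\varepsilon)+(g(X_{\vec p^{\max}})-1)\,\varepsilon+O(\varepsilon^2\log^2\varepsilon).$$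
   Context: All logarithms are natural, with $0\log 0=0$. $\mathcal X=\{0,1\}$, $\mathcal X^*$ is the set of finite binary words, $\oplus$ is addition mod 2, $\bar a=1\oplus a$. $H(\varepsilon)=\varepsilon\log\frac1\varepsilon+(1-\varepsilon)\log\frac1{1-\varepsilon}$. Constraints: a binary finite type constraint $\mathcal S\subseteq\mathcal X^*$ is the set of all binary words that contain no element of some finite set $\mathcal F$ of forbidden words as a contiguous subword. It is irreducible if for all $u,v\in\mathcal S$ there is $w\in\mathcal S$ with $uwv\in\mathcal S$. Its topological order $\hat m(\mathcal S)$ is the smallest $\hat m$ such that $\mathcal S$ can be described by forbidden words of length $\hat m+1$ (i.e. there is a set of words of length $\hat m+1$ such that a word of length at least $\hat m+1$ is in $\mathcal S$ iff it contains none of them). Processes: for a stationary binary process $X$, $p_X(u)$ is the probability that $X$ takes the value $u$ on a block of consecutive times of the same length, $p_X(v|w)=p_X(wv)/p_X(w)$, and $\mathcal A(X)$ is the set of binary words $u$ with $p_X(u)>0$; for a finite process $X_{-n}^0$, $\mathcal A(X_{-n}^0)$ is the set of words $u$ of length $n+1$ with $P(X_{-n}^0=u)>0$. The entropy rate of a stationary process $W=W_{-\infty}^0$ is $H(W)=\lim_{n\to\infty}\frac1{n+1}H(W_{-n}^0)$, with $H(W_{-n}^0)$ the Shannon entropy. $\mathcal M_m$ is the set of all (stationary) binary irreducible $m$-th order Markov chains. Channel: $\mathrm{BSC}(\varepsilon)$ has output $Z_i(\varepsilon)=X_i\oplus E_i$, where $E=\{E_i\}$ is i.i.d. with $P(E_i=1)=\varepsilon$,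 $P(E_i=0)=1-\varepsilon$, independent of the input $X$; $Z_\varepsilon=\{Z_i(\varepsilon)\}$. The noisy constrained capacity is $$C(\mathcal S,\varepsilon)=\lim_{n\to\infty}\sup_{\mathcal A(X_{-n}^0)\subseteq\mathcal S}\frac1{n+1}\big(H(Z_{-n}^0(\varepsilon))-H(Z_{-n}^0(\varepsilon)|X_{-n}^0)\big),$$ the supremum being over binary input processes $X_{-n}^0$ (not necessarily stationary), and $$h_m(\mathcal S,\varepsilon)=\sup_{X\in\mathcal M_m,\ \mathcal A(X)\subseteq\mathcal S}H(Z_\varepsilon).$$ Maximal entropy chain: for $m\ge\hat m$, among all $m$-th order Markov chains $X$ with $\mathcal A(X)=\mathcal S$ the entropy rate $H(X)$ is maximized by a unique chain; it does not depend on $m\ge\hat m$, is an $\hat m$-th order Markov chain, and is denoted $X_{\vec p^{\max}}$. It is known that $C(\mathcal S)=H(X_{\vec p^{\max}})$. The coefficients: for $X=X_{\vec p^{\max}}$, $f(X)=f_{2\hat m}^0(X_{-2\hat m}^0)$ and $g(X)=g_{3\hat m}^0(X_{-3\hat m}^0)$, where $f_n^0,g_n^0$ are defined as follows. Below $w$ ranges over binary words of length $n$, $v$ over $\{0,1\}$, and $wv$ is the concatenation. For a binary word $u$ of length $\ell$, let $h_\ell^0(u)=\sum_{u'}p_X(u')-\ell\,p_X(u)$, where $u'$ runs over the $\ell$ words obtained from $u$ by flipping exactly one letter. Let $p_Z(w)=P(Z_{-n}^{-1}(\varepsilon)=w)$ and $p_Z(wv)=P(Z_{-n}^{-1}(\varepsilon)=w,Z_0(\varepsilon)=v)$.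 Then $$f_n^0(X_{-n}^0)=\sum_{w\in\mathcal A(X),\,wv\notin\mathcal A(X)}h_{n+1}^0(wv),$$ $$g_n^0(X_{-n}^0)=-\sum_{wv\in\mathcal A(X)}\Big(h_{n+1}^0(wv)\log p_X(v|w)+\frac{h_{n+1}^0(wv)p_X(w)-h_n^0(w)p_X(wv)}{p_X(w)}\Big)$$ $$-\sum_{w\in\mathcal A(X),\,wv\notin\mathcal A(X)}h_{n+1}^0(wv)\log\frac{h_{n+1}^0(wv)}{p_X(w)}-\sum_{p_Z(w)=\Theta(\varepsilon),\,p_Z(wv)=\Theta(\varepsilon)}h_{n+1}^0(wv)\log\frac{h_{n+1}^0(wv)}{h_n^0(w)},$$ where $\Theta(\varepsilon)$ is meant as $\varepsilon\to0^+$ (bounded above and below by positive constants times $\varepsilon$). The error terms $O(\varepsilon^2\log^2\varepsilon)$ are bounded in absolute value by a constant (independent of $\varepsilon$, possibly depending on $\mathcal S$ and $m$) times $\varepsilon^2\log^2\varepsilon$ for all sufficiently small $\varepsilon>0$. *)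

theory Defs
  imports "HOL-Probability.Probability" "HOL-Library.Sublist" "HOL-Library.Landau_Symbols"
begin

section \<open>Binary finite type constraints\<close>

text \<open>A binary word is a \<^typ>\<open>bool list\<close>, the letter 1 being \<^const>\<open>True\<close>.\<close>

definition finite_type_constraint :: "bool list set \<Rightarrow> bool" where
  "finite_type_constraint S \<longleftrightarrow>
     (\<exists>F. finite F \<and> S = {u. \<forall>f\<in>F. \<not> sublist f u})"

definition irreducible_constraint :: "bool list set \<Rightarrow> bool" where
  "irreducible_constraint S \<longleftrightarrow> (\<forall>u\<in>S. \<forall>v\<in>S. \<exists>w\<in>S. u @ w @ v \<in> S)"

definition described_by_order :: "bool list set \<Rightarrow> nat \<Rightarrow> bool" where
  "described_by_order S m \<longleftrightarrow>
     (\<exists>F \<subseteq> {f. length f = m + 1}.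
        \<forall>u. length u \<ge> m + 1 \<longrightarrow> (u \<in> S \<longleftrightarrow> (\<forall>f\<in>F. \<not> sublist f u)))"

definition topological_order :: "bool list set \<Rightarrow> nat" where
  "topological_order S = (LEAST m. described_by_order S m)"


section \<open>Stationary binary processes\<close>

text \<open>A process is represented by its law on two-sided sequences.\<close>

definition path_space :: "(int \<Rightarrow> bool) measure" where
  "path_space = PiM UNIV (\<lambda>_. count_space UNIV)"

definition stationary_process :: "(int \<Rightarrow> bool) measure \<Rightarrow> bool" where
  "stationary_process X \<longleftrightarrow>
     prob_space X \<and> sets X = sets path_space \<and>
     distr X path_space (\<lambda>x i. x (i + 1)) = X"

text \<open>The block of length \<open>length u\<close> is taken to end at time 0; by stationarity its position
  is immaterial.\<close>

definition word_prob :: "(int \<Rightarrow> bool) measure \<Rightarrow> bool list \<Rightarrow> real" where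
  "word_prob X u = \<P>(x in X. map x [1 - int (length u)..0] = u)"

definition cond_word_prob :: "(int \<Rightarrow> bool) measure \<Rightarrow> bool list \<Rightarrow> bool list \<Rightarrow> real" where
  "cond_word_prob X v w = word_prob X (w @ v) / word_prob X w"

definition allowed_words :: "(int \<Rightarrow> bool) measure \<Rightarrow> bool list set" where
  "allowed_words X = {u. word_prob X u > 0}"

text \<open>Entropies are in nats. The reference measure is counting measure on the whole type, which
  for finite-valued variables gives the usual finite sums (see the lemmas below).\<close>

abbreviation shannon_entropy :: "'a measure \<Rightarrow> ('a \<Rightarrow> 'b) \<Rightarrow> real" where
  "shannon_entropy M X \<equiv> prob_space.entropy M (exp 1) (count_space UNIV) X"

abbreviation shannon_cond_entropy :: "'a measure \<Rightarrow> ('a \<Rightarrow> 'b) \<Rightarrow> ('a \<Rightarrow> 'c) \<Rightarrow> real" where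
  "shannon_cond_entropy M X Y \<equiv>
     prob_space.conditional_entropy M (exp 1) (count_space UNIV) (count_space UNIV) X Y"

definition entropy_rate :: "(int \<Rightarrow> bool) measure \<Rightarrow> real" where
  "entropy_rate W = lim (\<lambda>n. shannon_entropy W (\<lambda>x. map x [- int n..0]) / real (n + 1))"

definition markov_order :: "nat \<Rightarrow> (int \<Rightarrow> bool) measure \<Rightarrow> bool" where
  "markov_order m X \<longleftrightarrow> stationary_process X \<and>
     (\<forall>w v. length w \<ge> m \<and> word_prob X w > 0 \<longrightarrow>
        cond_word_prob X [v] w = cond_word_prob X [v] (drop (length w - m) w))"

text \<open>The states of an \<open>m\<close>-th order chain are the allowed words of length \<open>m\<close>, and a word \<open>u\<close> of
  length \<open>m + k\<close> encodes a \<open>k\<close>-step path from its length-\<open>m\<close> prefix to its length-\<open>m\<close> suffix.\<close>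

definition irreducible_markov :: "nat \<Rightarrow> (int \<Rightarrow> bool) measure \<Rightarrow> bool" where
  "irreducible_markov m X \<longleftrightarrow> markov_order m X \<and>
     (\<forall>a\<in>allowed_words X. \<forall>b\<in>allowed_words X. length a = m \<and> length b = m \<longrightarrow>
        (\<exists>u\<in>allowed_words X. prefix a u \<and> suffix b u))"

text \<open>The maximal entropy chain, characterised as the maximiser among chains of order
  \<open>topological_order S\<close>; maximising over any larger order gives the same chain.\<close>

definition max_entropy_chain :: "bool list set \<Rightarrow> (int \<Rightarrow> bool) measure \<Rightarrow> bool" where
  "max_entropy_chain S X \<longleftrightarrow>
     markov_order (topological_order S) X \<and> allowed_words X = S \<and>
     (\<forall>Y. markov_order (topological_order S) Y \<and> allowed_words Y = S \<longrightarrow>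
        entropy_rate Y \<le> entropy_rate X)"


section \<open>The binary symmetric channel\<close>

definition binary_entropy :: "real \<Rightarrow> real" where
  "binary_entropy \<epsilon> = \<epsilon> * ln (1 / \<epsilon>) + (1 - \<epsilon>) * ln (1 / (1 - \<epsilon>))"

text \<open>On \<^typ>\<open>bool\<close>, addition modulo 2 is \<open>\<noteq>\<close>.\<close>

definition bsc_output :: "real \<Rightarrow> (int \<Rightarrow> bool) measure \<Rightarrow> (int \<Rightarrow> bool) measure" where
  "bsc_output \<epsilon> X =
     distr (X \<Otimes>\<^sub>M PiM UNIV (\<lambda>_. measure_pmf (bernoulli_pmf \<epsilon>))) path_space
       (\<lambda>(x, e) i. x i \<noteq> e i)"

definition bsc_block :: "real \<Rightarrow> nat \<Rightarrow> bool list pmf \<Rightarrow> (bool list \<times> bool list) pmf" where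
  "bsc_block \<epsilon> n X = pair_pmf X (replicate_pmf (n + 1) (bernoulli_pmf \<epsilon>))"

definition bsc_information :: "real \<Rightarrow> nat \<Rightarrow> bool list pmf \<Rightarrow> real" where
  "bsc_information \<epsilon> n X =
     shannon_entropy (measure_pmf (bsc_block \<epsilon> n X)) (\<lambda>(x, e). map2 (\<noteq>) x e)
     - shannon_cond_entropy (measure_pmf (bsc_block \<epsilon> n X)) (\<lambda>(x, e). map2 (\<noteq>) x e) fst"

definition constrained_inputs :: "bool list set \<Rightarrow> nat \<Rightarrow> bool list pmf set" where
  "constrained_inputs S n = {X. set_pmf X \<subseteq> S \<and> (\<forall>u\<in>set_pmf X. length u = n + 1)}"

definition noisy_capacity :: "bool list set \<Rightarrow> real \<Rightarrow> real" where
  "noisy_capacity S \<epsilon> =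
     lim (\<lambda>n. SUP X\<in>constrained_inputs S n. bsc_information \<epsilon> n X / real (n + 1))"

definition markov_output_entropy :: "nat \<Rightarrow> bool list set \<Rightarrow> real \<Rightarrow> real" where
  "markov_output_entropy m S \<epsilon> =
     (SUP X\<in>{X. irreducible_markov m X \<and> allowed_words X \<subseteq> S}. entropy_rate (bsc_output \<epsilon> X))"


section \<open>The expansion coefficients\<close>

definition h_coef :: "(int \<Rightarrow> bool) measure \<Rightarrow> bool list \<Rightarrow> real" where
  "h_coef X u = (\<Sum>i<length u. word_prob X (u[i := \<not> u ! i])) - real (length u) * word_prob X u"

definition f_coef :: "nat \<Rightarrow> (int \<Rightarrow> bool) measure \<Rightarrow> real" where
  "f_coef n X =
     (\<Sum>(w, v) \<in> {(w, v). length w = n \<and> w \<in> allowed_words X \<and> w @ [v] \<notin> allowed_words X}.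
        h_coef X (w @ [v]))"

definition g_coef :: "nat \<Rightarrow> (int \<Rightarrow> bool) measure \<Rightarrow> real" where
  "g_coef n X =
     - (\<Sum>(w, v) \<in> {(w, v). length w = n \<and> w @ [v] \<in> allowed_words X}.
          h_coef X (w @ [v]) * ln (cond_word_prob X [v] w)
          + (h_coef X (w @ [v]) * word_prob X w - h_coef X w * word_prob X (w @ [v]))
              / word_prob X w)
     - (\<Sum>(w, v) \<in> {(w, v). length w = n \<and> w \<in> allowed_words X \<and> w @ [v] \<notin> allowed_words X}.
          h_coef X (w @ [v]) * ln (h_coef X (w @ [v]) / word_prob X w))
     - (\<Sum>(w, v) \<in> {(w, v). length w = n \<and>
                      (\<lambda>\<epsilon>. word_prob (bsc_output \<epsilon> X) w) \<in> \<Theta>[at_right 0](\<lambda>\<epsilon>. \<epsilon>) \<and>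
                      (\<lambda>\<epsilon>. word_prob (bsc_output \<epsilon> X) (w @ [v])) \<in> \<Theta>[at_right 0](\<lambda>\<epsilon>. \<epsilon>)}.
          h_coef X (w @ [v]) * ln (h_coef X (w @ [v]) / h_coef X w))"


section \<open>Entropies as finite sums\<close>

lemma distributed_count_space_countable:
  fixes X :: "'a \<Rightarrow> 'b :: countable"
  assumes "prob_space M" and X[measurable]: "X \<in> measurable M (count_space UNIV)"
  shows "distributed M (count_space UNIV) X (\<lambda>a. ennreal (\<P>(x in M. X x = a)))"
proof -
  interpret prob_space M by fact
  have "distr M (count_space UNIV) X
          = density (count_space UNIV) (\<lambda>a. ennreal (\<P>(x in M. X x = a)))"
  proof (rule measure_eqI_countable[where A = UNIV])
    fix a :: 'b
    have "X -` {a} \<inter> space M = {x \<in> space M. X x = a}" by auto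
    then show "emeasure (distr M (count_space UNIV) X) {a}
        = emeasure (density (count_space UNIV) (\<lambda>a. ennreal (\<P>(x in M. X x = a)))) {a}"
      by (simp add: emeasure_distr emeasure_density emeasure_eq_measure
          nn_integral_count_space_indicator[symmetric] nn_integral_count_space_finite)
  qed auto
  then show ?thesis by (simp add: distributed_def)
qed

lemma shannon_entropy_eq_sum:
  fixes X :: "'a \<Rightarrow> 'b :: countable"
  assumes M: "prob_space M" and X[measurable]: "X \<in> measurable M (count_space UNIV)"
    and A: "finite A" "AE x in M. X x \<in> A"
  shows "shannon_entropy M X =
           - (\<Sum>a\<in>A. \<P>(x in M. X x = a) * ln (\<P>(x in M. X x = a)))"
proof -
  interpret information_space M "exp 1"
    using M by (simp add: information_space_def information_space_axioms_def)
  let ?p = "\<lambda>a. \<P>(x in M. X x = a)"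
  have z: "?p a = 0" if "a \<notin> A" for a
    using A(2) that by (subst prob_eq_0) auto
  have sub: "{a. ?p a * ln (?p a) \<noteq> 0} \<subseteq> A"
    using z by auto
  have "entropy (exp 1) (count_space UNIV) X
          = - (\<integral>a. ?p a * log (exp 1) (?p a) \<partial>count_space UNIV)"
    by (rule entropy_distr[OF distributed_count_space_countable[OF M X]]) simp
  also have "(\<integral>a. ?p a * log (exp 1) (?p a) \<partial>count_space UNIV) = (\<integral>a. ?p a * ln (?p a) \<partial>count_space UNIV)"
    by (simp add: log_def)
  also have "\<dots> = (\<Sum>a | a \<in> UNIV \<and> ?p a * ln (?p a) \<noteq> 0. ?p a * ln (?p a))"
    by (rule lebesgue_integral_count_space_finite_support)
       (use sub A(1) in \<open>auto intro: finite_subset\<close>)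
  also have "\<dots> = (\<Sum>a\<in>A. ?p a * ln (?p a))"
    by (rule sum.mono_neutral_left) (use sub A(1) in auto)
  finally show ?thesis .
qed

lemma shannon_cond_entropy_pmf_eq_sum:
  fixes X :: "'a \<Rightarrow> 'b :: countable" and Y :: "'a \<Rightarrow> 'c :: countable"
  assumes fin: "finite (set_pmf J)"
  shows "shannon_cond_entropy (measure_pmf J) X Y =
           - (\<Sum>(x, y) \<in> (\<lambda>j. (X j, Y j)) ` set_pmf J.
                pmf (map_pmf (\<lambda>j. (X j, Y j)) J) (x, y) *
                ln (pmf (map_pmf (\<lambda>j. (X j, Y j)) J) (x, y) / pmf (map_pmf Y J) y))"
proof -
  interpret information_space "measure_pmf J" "exp 1"
    by (simp add: information_space_def information_space_axioms_def measure_pmf.prob_space_axioms)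
  let ?q = "pmf (map_pmf (\<lambda>j. (X j, Y j)) J)" and ?r = "pmf (map_pmf Y J)"
  let ?g = "\<lambda>(x, y). ?q (x, y) * ln (?q (x, y) / ?r y)"
  let ?A = "(\<lambda>j. (X j, Y j)) ` set_pmf J"
  have P: "pmf (map_pmf h J) a = \<P>(x in measure_pmf J. h x = a)" for h :: "'a \<Rightarrow> 'd" and a
    by (simp add: pmf_map vimage_def)
  have dY: "distributed (measure_pmf J) (count_space UNIV) Y (\<lambda>a. ennreal (?r a))"
    using distributed_count_space_countable[OF measure_pmf.prob_space_axioms, of Y J]
    by (simp add: P)
  have pair: "count_space UNIV \<Otimes>\<^sub>M count_space UNIV = (count_space UNIV :: ('b \<times> 'c) measure)"
    by (simp add: pair_measure_countable)
  have dXY: "distributed (measure_pmf J) (count_space UNIV \<Otimes>\<^sub>M count_space UNIV)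
               (\<lambda>j. (X j, Y j)) (\<lambda>a. ennreal (?q a))"
    using distributed_count_space_countable[OF measure_pmf.prob_space_axioms, of "\<lambda>j. (X j, Y j)" J]
    by (simp add: P pair)
  have z: "?q a = 0" if "a \<notin> ?A" for a
    using that by (metis pmf_eq_0_set_pmf set_map_pmf)
  have sub: "{a. ?g a \<noteq> 0} \<subseteq> ?A"
  proof (rule subsetI, rule ccontr)
    fix a assume "a \<in> {a. ?g a \<noteq> 0}" "a \<notin> ?A"
    then show False using z[of a] by (simp add: split_beta)
  qed
  have "shannon_cond_entropy (measure_pmf J) X Y
      = - (\<integral>(x, y). ?q (x, y) * log (exp 1) (?q (x, y) / ?r y)
             \<partial>(count_space UNIV \<Otimes>\<^sub>M count_space UNIV))"
    using conditional_entropy_generic_eq[OF sigma_finite_measure_count_space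
        sigma_finite_measure_count_space dY _ dXY]
    by simp
  also have "(\<integral>(x, y). ?q (x, y) * log (exp 1) (?q (x, y) / ?r y)
             \<partial>(count_space UNIV \<Otimes>\<^sub>M count_space UNIV)) = (\<integral>a. ?g a \<partial>count_space UNIV)"
    by (simp add: log_def pair)
  also have "\<dots> = (\<Sum>a | a \<in> UNIV \<and> ?g a \<noteq> 0. ?g a)"
    by (rule lebesgue_integral_count_space_finite_support)
       (rule finite_subset[of _ ?A], use sub fin in auto)
  also have "\<dots> = (\<Sum>a\<in>?A. ?g a)"
    by (rule sum.mono_neutral_left) (use sub fin in auto)
  finally show ?thesis .
qed

end

theory Submission
  imports Defs "HOL-Real_Asymp.Real_Asymp"
begin

text \<open>
  Write \<open>q\<close> for the word probabilities of the maximal entropy chain, \<open>m\<close> for its order, \<open>n = 3 * m\<close>,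
  and \<open>\<Phi>(p, \<epsilon>)\<close> for the conditional entropy of an output letter given the \<open>n\<close> preceding output
  letters when the input blocks of length \<open>n + 1\<close> have law \<open>p\<close>. The entropy rate of the output of
  the chain, the quantity \<open>h_m\<close> and the capacity all lie, up to \<open>H(\<epsilon>)\<close>, between two quantities
  that agree with \<open>\<Phi>(q, \<epsilon>)\<close> up to \<open>O(\<epsilon>\<^sup>2 ln\<^sup>2 \<epsilon>)\<close>, and \<open>\<Phi>(q, \<epsilon>)\<close> is expanded directly.

  Upper bound: by Gibbs' inequality and compactness the capacity is at most \<open>\<Phi>(p, \<epsilon>) - H(\<epsilon>)\<close> for a
  stationary block law \<open>p\<close> supported on \<open>S\<close>. Here \<open>\<Phi>(p, \<epsilon>)\<close> is a linear functional of \<open>p\<close> minus the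
  relative entropy with respect to the noisy \<open>q\<close>. First-order optimality of \<open>q\<close> bounds the increase
  of the linear part by \<open>O(\<epsilon> ln (1 / \<epsilon>))\<close> times the distance \<open>\<delta>\<close> of \<open>p\<close> from \<open>q\<close>, and the relative
  entropy is at least of order \<open>\<delta>\<^sup>2\<close>, up to \<open>O(\<epsilon>)\<close> in \<open>\<delta>\<close>.

  Lower bound: conditioning moreover on the input state preceding the window bounds the entropy rate
  of the output from below. The loss is a sum of relative entropy terms, whose first-order parts
  cancel because a word of length \<open>3 * m\<close> with one error determines the effect of that error locally.
\<close>

section \<open>Sums over binary words\<close>

text \<open>The relative entropy only measures a distance \<open>\<eta>\<close> of the noisy
  \<open>p\<close> from the transition probabilities of the noisy \<open>q\<close>. That
  \<open>\<eta>\<close> controls \<open>\<delta>\<close> needs irreducibility and is the stability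
  estimate for stationary block laws. The linear gain is then at most a constant times
  \<open>\<epsilon> ln (1 / \<epsilon>) (\<eta> + \<epsilon>)\<close>, and maximising this minus
  \<open>\<eta>^2 / 4\<close> over \<open>\<eta>\<close> produces the order
  \<open>\<epsilon>^2 ln^2 \<epsilon>\<close>; the lower bound loses only
  \<open>\<epsilon>^2 ln (1 / \<epsilon>)\<close>. Optimality of the chain is given only among
  Markov processes with support exactly \<open>S\<close>, so comparing it with a block law requires
  realising mixtures of \<open>p\<close> and \<open>q\<close> as such processes, by Kolmogorov
  extension. A further obstacle is that forbidden words are possible outputs, so that logarithms of
  output probabilities are unbounded as \<open>\<epsilon>\<close> tends to 0. They are tamed by the
  crude lower bound \<open>\<epsilon>^k\<close> for words of length \<open>k\<close> and by
  expansions that distinguish whether a word needs no error, one error or more.\<close>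

definition words :: "nat \<Rightarrow> bool list set" where
  "words n = {u. length u = n}"

lemma in_words [simp]: "u \<in> words n \<longleftrightarrow> length u = n"
  by (simp add: words_def)

lemma finite_words [simp]: "finite (words n)"
  using finite_lists_length_eq[of "UNIV :: bool set" n] by (simp add: words_def)

lemma words_0 [simp]: "words 0 = {[]}"
  by (auto simp: words_def)

lemma words_Suc: "words (Suc n) = (#) True ` words n \<union> (#) False ` words n"
  by (auto simp: words_def length_Suc_conv image_iff)

lemma sum_words_Cons:
  fixes f :: "bool list \<Rightarrow> 'a :: comm_monoid_add"
  shows "(\<Sum>u\<in>words (Suc n). f u) = (\<Sum>w\<in>words n. f (True # w) + f (False # w))"
proof -
  have "(\<Sum>u\<in>words (Suc n). f u) = sum f ((#) True ` words n) + sum f ((#) False ` words n)"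
    unfolding words_Suc by (rule sum.union_disjoint) auto
  then show ?thesis
    by (simp add: sum.reindex sum.distrib)
qed

lemma sum_words_append:
  fixes f :: "bool list \<Rightarrow> 'a :: comm_monoid_add"
  shows "(\<Sum>u\<in>words (i + j). f u) = (\<Sum>x\<in>words i. \<Sum>y\<in>words j. f (x @ y))"
proof (induction i arbitrary: f)
  case (Suc i)
  show ?case
    by (simp add: sum_words_Cons sum.distrib Suc)
qed simp

lemma sum_words_snoc:
  fixes f :: "bool list \<Rightarrow> 'a :: comm_monoid_add"
  shows "(\<Sum>u\<in>words (Suc n). f u) = (\<Sum>w\<in>words n. f (w @ [True]) + f (w @ [False]))"
  using sum_words_append[of f n 1] by (simp add: sum_words_Cons)

definition right_marginal :: "(bool list \<Rightarrow> real) \<Rightarrow> bool list \<Rightarrow> real" where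
  "right_marginal f w = f (w @ [True]) + f (w @ [False])"

definition left_marginal :: "(bool list \<Rightarrow> real) \<Rightarrow> bool list \<Rightarrow> real" where
  "left_marginal f w = f (True # w) + f (False # w)"

text \<open>By \<open>word_law_word_prob\<close> and \<open>stationary_process_of_word_law\<close>
  these are exactly the word probability functions of stationary binary processes. Working with them
  keeps measure theory out of the estimates.\<close>

definition word_law :: "(bool list \<Rightarrow> real) \<Rightarrow> bool" where
  "word_law q \<longleftrightarrow> (\<forall>u. 0 \<le> q u) \<and> q [] = 1 \<and> right_marginal q = q \<and> left_marginal q = q"

lemma word_lawD:
  assumes "word_law q"
  shows "0 \<le> q u" "q [] = 1" "q (w @ [True]) + q (w @ [False]) = q w"
    "q (True # w) + q (False # w) = q w" "right_marginal q = q" "left_marginal q = q"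
  using assms by (auto simp: word_law_def right_marginal_def left_marginal_def fun_eq_iff)

lemma word_law_sum_right:
  assumes "word_law q"
  shows "(\<Sum>y\<in>words j. q (x @ y)) = q x"
proof (induction j arbitrary: x)
  case (Suc j)
  have "(\<Sum>y\<in>words (Suc j). q (x @ y)) = (\<Sum>y\<in>words j. q (x @ y @ [True]) + q (x @ y @ [False]))"
    by (simp add: sum_words_snoc)
  also have "\<dots> = (\<Sum>y\<in>words j. q (x @ y))"
    using word_lawD(3)[OF assms, of "x @ _"] by simp
  finally show ?case using Suc by simp
qed simp

lemma word_law_sum_left:
  assumes "word_law q"
  shows "(\<Sum>x\<in>words j. q (x @ y)) = q y"
proof (induction j arbitrary: y)
  case (Suc j)
  have "(\<Sum>x\<in>words (Suc j). q (x @ y)) = (\<Sum>x\<in>words j. q (x @ y))"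
    using word_lawD(4)[OF assms, of "_ @ y"] by (simp add: sum_words_Cons)
  then show ?case using Suc by simp
qed simp

lemma word_law_sum: "word_law q \<Longrightarrow> (\<Sum>x\<in>words j. q x) = 1"
  using word_law_sum_right[of q "[]" j] word_lawD(2) by simp

lemma word_law_mono:
  assumes "word_law q"
  shows "q (x @ y @ z) \<le> q y"
proof -
  have "q (x @ y @ z) \<le> (\<Sum>z\<in>words (length z). q ((x @ y) @ z))"
    using member_le_sum[of z "words (length z)" "\<lambda>z. q ((x @ y) @ z)"] word_lawD(1)[OF assms] by simp
  also have "\<dots> = q (x @ y)"
    by (rule word_law_sum_right[OF assms])
  also have "\<dots> \<le> (\<Sum>x\<in>words (length x). q (x @ y))"
    using member_le_sum[of x "words (length x)" "\<lambda>x. q (x @ y)"] word_lawD(1)[OF assms] by simp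
  also have "\<dots> = q y"
    by (rule word_law_sum_left[OF assms])
  finally show ?thesis .
qed

lemma word_law_le_1: "word_law q \<Longrightarrow> q u \<le> 1"
  using word_law_mono[of q u "[]" "[]"] word_lawD(2)[of q] by simp

lemma word_law_eq_0:
  assumes "word_law q" "q y = 0"
  shows "q (x @ y @ z) = 0"
  using word_law_mono[OF assms(1), of x y z] word_lawD(1)[OF assms(1), of "x @ y @ z"] assms(2) by simp


section \<open>The channel on words\<close>

text \<open>For words of equal length \<open>l\<close> at Hamming distance \<open>d\<close> this is
  \<open>e ^ d * (1 - e) ^ (l - d)\<close>, the transition probability of the channel. The value 1
  once either word is exhausted lets the sign and size bounds hold for unequal lengths too.\<close>

fun chan :: "real \<Rightarrow> bool list \<Rightarrow> bool list \<Rightarrow> real" where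
  "chan e (a # x) (c # z) = (if a = c then 1 - e else e) * chan e x z"
| "chan e _ _ = 1"

lemma chan_append:
  "length x = length z \<Longrightarrow> chan e (x @ x') (z @ z') = chan e x z * chan e x' z'"
  by (induction x z rule: list_induct2) auto

lemma chan_nonneg: "0 \<le> e \<Longrightarrow> e \<le> 1 \<Longrightarrow> 0 \<le> chan e x z"
  by (induction e x z rule: chan.induct) auto

lemma chan_le_1: "0 \<le> e \<Longrightarrow> e \<le> 1 \<Longrightarrow> chan e x z \<le> 1"
proof (induction e x z rule: chan.induct)
  case (1 e a x c z)
  then show ?case using chan_nonneg[of e x z] by (auto intro: mult_le_one)
qed auto

lemma chan_ge: "0 \<le> e \<Longrightarrow> e \<le> 1 / 2 \<Longrightarrow> e ^ length x \<le> chan e x z"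
proof (induction e x z rule: chan.induct)
  case (1 e a x c z)
  then show ?case by (auto intro: mult_mono)
next
  case ("2_1" e z) then show ?case by simp
next
  case ("2_2" e x)
  then show ?case by (simp add: power_le_one)
qed

lemma sum_chan: "(\<Sum>z\<in>words (length x). chan e x z) = 1"
proof (induction x)
  case (Cons a x)
  then show ?case
    by (cases a) (simp_all add: sum_words_Cons sum.distrib sum_distrib_left[symmetric])
qed simp

lemma chan_0: "length x = length z \<Longrightarrow> chan 0 x z = (if x = z then 1 else 0)"
  by (induction x z rule: list_induct2) auto

lemma chan_self: "chan e x x = (1 - e) ^ length x"
  by (induction x) auto

lemma chan_le_noise: "length x = length z \<Longrightarrow> x \<noteq> z \<Longrightarrow> 0 \<le> e \<Longrightarrow> e \<le> 1 \<Longrightarrow> chan e x z \<le> e"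
proof (induction x z rule: list_induct2)
  case (Cons a x c z)
  show ?case
  proof (cases "a = c")
    case True
    have "(1 - e) * chan e x z \<le> 1 * chan e x z"
      using Cons.prems chan_nonneg by (intro mult_right_mono) auto
    with True Cons show ?thesis by simp
  next
    case False
    then show ?thesis using Cons.prems chan_le_1[of e x z]
      by (simp add: mult_left_le)
  qed
qed simp

text \<open>The noise letters are independent, so the output for a fixed input word has an entropy
  that depends on the length of the word only. This makes the noise term of the information a
  constant.\<close>

lemma sum_chan_ln_chan:
  assumes "0 \<le> e" "e < 1"
  shows "(\<Sum>z\<in>words (length x). chan e x z * ln (chan e x z)) = - real (length x) * binary_entropy e"
proof (induction x)
  case (Cons a x)
  \<comment> \<open>Here \<open>c\<close> stands for the factor \<open>1 - e\<close> or
    \<open>e\<close> contributed by the first letter.\<close>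
  have *: "(\<Sum>z\<in>words (length x). c * chan e x z * ln (c * chan e x z))
      = c * ln c - c * real (length x) * binary_entropy e" if "0 \<le> c" "c = 0 \<or> 0 < e" for c
  proof (cases "c = 0")
    case False
    with that have c: "0 < c" and e: "0 < e" by auto
    have "0 < chan e x z" for z
      using e assms(2) by (induction e x z rule: chan.induct) auto
    then have "c * chan e x z * ln (c * chan e x z)
        = c * ln c * chan e x z + c * (chan e x z * ln (chan e x z))" for z
      using c by (simp add: ln_mult algebra_simps)
    then have "(\<Sum>z\<in>words (length x). c * chan e x z * ln (c * chan e x z))
        = c * ln c * (\<Sum>z\<in>words (length x). chan e x z)
          + c * (\<Sum>z\<in>words (length x). chan e x z * ln (chan e x z))"
      by (simp add: sum.distrib sum_distrib_left)
    then show ?thesis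
      by (simp add: sum_chan Cons)
  qed simp
  have b: "binary_entropy e = - e * ln e - (1 - e) * ln (1 - e)"
    using assms by (cases "e = 0") (auto simp: binary_entropy_def ln_div)
  show ?case
  proof (cases "e = 0")
    case True
    have "(\<Sum>z\<in>words (length (a # x)). chan e (a # x) z * ln (chan e (a # x) z)) = 0"
      by (rule sum.neutral) (auto simp: True chan_0)
    then show ?thesis by (simp add: binary_entropy_def True)
  next
    case False
    have "(\<Sum>z\<in>words (length (a # x)). chan e (a # x) z * ln (chan e (a # x) z))
        = (\<Sum>z\<in>words (length x). (1 - e) * chan e x z * ln ((1 - e) * chan e x z))
          + (\<Sum>z\<in>words (length x). e * chan e x z * ln (e * chan e x z))"
      by (cases a) (simp_all add: sum_words_Cons sum.distrib)
    also have "\<dots> = - real (length (a # x)) * binary_entropy e"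
      using False assms by (subst (1 2) *) (auto simp: b algebra_simps)
    finally show ?thesis .
  qed
qed simp

text \<open>The argument \<open>q\<close> is an arbitrary function, on which the noise acts
  linearly. It is also applied to block laws and, with a fixed past \<open>b\<close>, to the
  unnormalised functions \<open>\<lambda>y. q (b @ y)\<close>.\<close>

definition noisy :: "real \<Rightarrow> (bool list \<Rightarrow> real) \<Rightarrow> bool list \<Rightarrow> real" where
  "noisy e q z = (\<Sum>x\<in>words (length z). q x * chan e x z)"

lemma noisy_0: "noisy 0 q z = q z"
proof -
  have "noisy 0 q z = (\<Sum>x\<in>words (length z). if x = z then q x else 0)"
    unfolding noisy_def by (rule sum.cong) (auto simp: chan_0)
  then show ?thesis by (simp add: sum.delta)
qed

lemma noisy_nonneg: "(\<And>u. 0 \<le> q u) \<Longrightarrow> 0 \<le> e \<Longrightarrow> e \<le> 1 \<Longrightarrow> 0 \<le> noisy e q z"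
  unfolding noisy_def by (intro sum_nonneg mult_nonneg_nonneg chan_nonneg)

lemma noisy_append:
  "noisy e q (z @ z') = (\<Sum>x\<in>words (length z). \<Sum>x'\<in>words (length z').
     q (x @ x') * (chan e x z * chan e x' z'))"
  unfolding noisy_def length_append sum_words_append
  by (intro sum.cong refl) (simp add: chan_append)

text \<open>Each row of the channel sums to 1, so summing out output letters amounts to summing out
  the input letters beneath them.\<close>

lemma sum_noisy_right:
  "(\<Sum>z'\<in>words j. noisy e q (z @ z')) = noisy e (\<lambda>x. \<Sum>x'\<in>words j. q (x @ x')) z"
proof -
  have "(\<Sum>z'\<in>words j. noisy e q (z @ z')) = (\<Sum>z'\<in>words j. \<Sum>x\<in>words (length z). \<Sum>x'\<in>words j.
     q (x @ x') * chan e x z * chan e x' z')"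
    by (simp add: noisy_append mult_ac)
  also have "\<dots> = (\<Sum>x\<in>words (length z). \<Sum>x'\<in>words j. \<Sum>z'\<in>words j.
     q (x @ x') * chan e x z * chan e x' z')"
    by (subst sum.swap) (intro sum.cong refl sum.swap)
  also have "\<dots> = (\<Sum>x\<in>words (length z). \<Sum>x'\<in>words j. q (x @ x') * chan e x z)"
  proof (intro sum.cong refl)
    fix x x' assume "x' \<in> words j"
    then show "(\<Sum>z'\<in>words j. q (x @ x') * chan e x z * chan e x' z') = q (x @ x') * chan e x z"
      using sum_chan[of e x'] by (simp add: sum_distrib_left[symmetric])
  qed
  also have "\<dots> = noisy e (\<lambda>x. \<Sum>x'\<in>words j. q (x @ x')) z"
    by (simp add: noisy_def sum_distrib_right)
  finally show ?thesis .
qed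

lemma sum_noisy_left:
  "(\<Sum>z'\<in>words j. noisy e q (z' @ z)) = noisy e (\<lambda>x. \<Sum>x'\<in>words j. q (x' @ x)) z"
proof -
  have "(\<Sum>z'\<in>words j. noisy e q (z' @ z)) = (\<Sum>z'\<in>words j. \<Sum>x'\<in>words j. \<Sum>x\<in>words (length z).
     q (x' @ x) * chan e x z * chan e x' z')"
    by (simp add: noisy_append mult_ac)
  also have "\<dots> = (\<Sum>x'\<in>words j. \<Sum>x\<in>words (length z). \<Sum>z'\<in>words j.
     q (x' @ x) * chan e x z * chan e x' z')"
    by (subst sum.swap) (intro sum.cong refl sum.swap)
  also have "\<dots> = (\<Sum>x'\<in>words j. \<Sum>x\<in>words (length z). q (x' @ x) * chan e x z)"
  proof (intro sum.cong refl)
    fix x x' assume "x' \<in> words j"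
    then show "(\<Sum>z'\<in>words j. q (x' @ x) * chan e x z * chan e x' z') = q (x' @ x) * chan e x z"
      using sum_chan[of e x'] by (simp add: sum_distrib_left[symmetric])
  qed
  also have "\<dots> = noisy e (\<lambda>x. \<Sum>x'\<in>words j. q (x' @ x)) z"
    by (subst sum.swap) (simp add: noisy_def sum_distrib_right)
  finally show ?thesis .
qed

lemma sum_words_1: "(\<Sum>y\<in>words (Suc 0). f y) = f [True] + f [False]"
  for f :: "bool list \<Rightarrow> 'a :: comm_monoid_add"
  by (simp add: sum_words_Cons)

lemma right_marginal_noisy: "right_marginal (noisy e q) = noisy e (right_marginal q)"
proof
  fix z
  show "right_marginal (noisy e q) z = noisy e (right_marginal q) z"
    using sum_noisy_right[of e q z "Suc 0"] unfolding sum_words_1 by (simp add: right_marginal_def[abs_def])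
qed

lemma left_marginal_noisy: "left_marginal (noisy e q) = noisy e (left_marginal q)"
proof
  fix z
  show "left_marginal (noisy e q) z = noisy e (left_marginal q) z"
    using sum_noisy_left[of e q z "Suc 0"] unfolding sum_words_1 by (simp add: left_marginal_def[abs_def])
qed

lemma sum_noisy: "(\<Sum>z\<in>words j. noisy e q z) = (\<Sum>x\<in>words j. q x)"
  using sum_noisy_right[of e q "[]" j] by (simp add: noisy_def)

lemma word_law_noisy:
  assumes "word_law q" "0 \<le> e" "e \<le> 1"
  shows "word_law (noisy e q)"
  unfolding word_law_def right_marginal_noisy left_marginal_noisy word_lawD(5,6)[OF assms(1)]
  using noisy_nonneg[OF word_lawD(1)[OF assms(1)]] assms by (simp add: noisy_def word_lawD(2))

text \<open>At \<open>e \<le> 1 / 2\<close> every letter of any input contributes a factor of at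
  least \<open>e\<close>. The bound keeps logarithms of output probabilities of order
  \<open>ln (1 / e)\<close>, even for words that the noiseless chain cannot produce.\<close>

lemma noisy_ge:
  assumes "\<And>u. 0 \<le> q u" "(\<Sum>x\<in>words (length z). q x) = 1" "0 \<le> e" "e \<le> 1 / 2"
  shows "e ^ length z \<le> noisy e q z"
proof -
  have "e ^ length z = (\<Sum>x\<in>words (length z). q x * e ^ length z)"
    by (simp add: sum_distrib_right[symmetric] assms)
  also have "\<dots> \<le> noisy e q z"
    unfolding noisy_def using assms chan_ge by (intro sum_mono mult_left_mono) (metis in_words)+
  finally show ?thesis .
qed


section \<open>Entropy inequalities on finite sets\<close>

lemma ln_diff_ge:
  fixes p r :: real
  assumes "0 \<le> p" "0 \<le> r" "0 < p \<Longrightarrow> 0 < r"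
  shows "p - r \<le> p * ln (p / r)"
proof (cases "p = 0")
  case False
  then have p: "0 < p" "0 < r" using assms by auto
  have "ln (r / p) \<le> r / p - 1" using p by (intro ln_le_minus_one) simp
  then have "p * ln (r / p) \<le> r - p" using p by (simp add: field_simps)
  moreover have "ln (p / r) = - ln (r / p)" using p by (simp add: ln_div)
  ultimately show ?thesis by simp
qed (use assms in auto)

text \<open>The comparison weights \<open>r\<close> may have smaller total mass than
  \<open>p\<close>. Products of conditional probabilities, which are 0 after contexts of mass 0, are
  used in this role.\<close>

lemma gibbs:
  fixes p r :: "'a \<Rightarrow> real"
  assumes "\<And>x. x \<in> A \<Longrightarrow> 0 \<le> p x" "\<And>x. x \<in> A \<Longrightarrow> 0 \<le> r x"
    "\<And>x. x \<in> A \<Longrightarrow> 0 < p x \<Longrightarrow> 0 < r x" "sum r A \<le> sum p A"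
  shows "(\<Sum>x\<in>A. p x * ln (r x)) \<le> (\<Sum>x\<in>A. p x * ln (p x))"
proof -
  have "0 \<le> (\<Sum>x\<in>A. p x - r x)" using assms(4) by (simp add: sum_subtractf)
  also have "\<dots> \<le> (\<Sum>x\<in>A. p x * ln (p x / r x))"
    by (intro sum_mono ln_diff_ge) (auto intro: assms)
  also have "\<dots> = (\<Sum>x\<in>A. p x * ln (p x) - p x * ln (r x))"
  proof (intro sum.cong refl)
    fix x assume x: "x \<in> A"
    show "p x * ln (p x / r x) = p x * ln (p x) - p x * ln (r x)"
    proof (cases "p x = 0")
      case False
      then have "0 < p x" "0 < r x" using assms(1)[OF x] assms(3)[OF x] by auto
      then show ?thesis by (simp add: ln_div algebra_simps)
    qed simp
  qed
  finally show ?thesis by (simp add: sum_subtractf)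
qed

text \<open>This is Gibbs' inequality with \<open>c\<close> rescaled to the total mass of
  \<open>a\<close>.\<close>

lemma log_sum:
  fixes a c :: "'a \<Rightarrow> real"
  assumes "\<And>x. x \<in> A \<Longrightarrow> 0 \<le> a x" "\<And>x. x \<in> A \<Longrightarrow> 0 \<le> c x"
    "\<And>x. x \<in> A \<Longrightarrow> 0 < a x \<Longrightarrow> 0 < c x"
  shows "sum a A * ln (sum a A / sum c A) \<le> (\<Sum>x\<in>A. a x * ln (a x / c x))"
proof (cases "sum a A = 0 \<or> infinite A")
  case True
  have "a x * ln (a x / c x) = 0" if "x \<in> A" "finite A" for x
    using True that assms(1) sum_nonneg_eq_0_iff[of A a] by auto
  then show ?thesis using True by (cases "finite A") (auto simp: sum.neutral)
next
  case False
  then have fin: "finite A" and a: "0 < sum a A"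
    using sum_nonneg[of A a] assms(1) by (auto simp: less_le)
  then obtain x where "x \<in> A" "0 < a x"
    using sum_nonpos[of A a] by (metis not_le)
  then have c: "0 < sum c A"
    using assms fin by (intro sum_pos2[of A x]) auto
  define r where "r = sum a A / sum c A"
  have r: "0 < r" using a c by (simp add: r_def)
  have *: "(\<Sum>x\<in>A. a x * ln (c x * r)) \<le> (\<Sum>x\<in>A. a x * ln (a x))"
  proof (rule gibbs)
    show "(\<Sum>x\<in>A. c x * r) \<le> sum a A"
      using c by (simp add: r_def sum_distrib_right[symmetric] sum_divide_distrib[symmetric])
  qed (use assms r in auto)
  have "(\<Sum>x\<in>A. a x * ln (a x / c x)) = (\<Sum>x\<in>A. a x * ln (a x) - a x * ln (c x * r) + a x * ln r)"
  proof (intro sum.cong refl)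
    fix x assume x: "x \<in> A"
    show "a x * ln (a x / c x) = a x * ln (a x) - a x * ln (c x * r) + a x * ln r"
    proof (cases "a x = 0")
      case False
      then have "0 < a x" "0 < c x" using assms(1)[OF x] assms(3)[OF x] by auto
      then show ?thesis using r by (simp add: ln_div ln_mult algebra_simps)
    qed simp
  qed
  also have "\<dots> = (\<Sum>x\<in>A. a x * ln (a x)) - (\<Sum>x\<in>A. a x * ln (c x * r)) + sum a A * ln r"
    by (simp add: sum.distrib sum_subtractf sum_distrib_right)
  finally show ?thesis using * by (simp add: r_def)
qed

text \<open>A Pinsker-type inequality, obtained by passing through the Hellinger distance.\<close>

lemma l1_distance_le_divergence:
  fixes P R :: "'a \<Rightarrow> real"
  assumes "\<And>x. x \<in> A \<Longrightarrow> 0 \<le> P x" "\<And>x. x \<in> A \<Longrightarrow> 0 \<le> R x"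
    "\<And>x. x \<in> A \<Longrightarrow> 0 < P x \<Longrightarrow> 0 < R x" "sum P A = 1" "sum R A = 1"
  shows "(\<Sum>x\<in>A. \<bar>P x - R x\<bar>)\<^sup>2 / 4 \<le> (\<Sum>x\<in>A. P x * ln (P x / R x))"
proof -
  let ?d = "\<lambda>x. sqrt (P x) - sqrt (R x)" and ?s = "\<lambda>x. sqrt (P x) + sqrt (R x)"
  have "(\<Sum>x\<in>A. \<bar>P x - R x\<bar>) = (\<Sum>x\<in>A. \<bar>?d x\<bar> * ?s x)"
  proof (intro sum.cong refl)
    fix x assume x: "x \<in> A"
    have "P x - R x = ?d x * ?s x"
      using assms(1,2)[OF x] by (simp add: algebra_simps)
    then show "\<bar>P x - R x\<bar> = \<bar>?d x\<bar> * ?s x"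
      using assms(1,2)[OF x] by (simp add: abs_mult)
  qed
  also have "(\<dots>)\<^sup>2 \<le> (\<Sum>x\<in>A. \<bar>?d x\<bar>\<^sup>2) * (\<Sum>x\<in>A. (?s x)\<^sup>2)"
    by (rule Cauchy_Schwarz_ineq_sum)
  also have "\<dots> \<le> (\<Sum>x\<in>A. \<bar>?d x\<bar>\<^sup>2) * 4"
  proof (rule mult_left_mono)
    have "(\<Sum>x\<in>A. (?s x)\<^sup>2) \<le> (\<Sum>x\<in>A. 2 * (P x + R x))"
    proof (rule sum_mono)
      fix x assume x: "x \<in> A"
      have "0 \<le> (?d x)\<^sup>2" by simp
      then show "(?s x)\<^sup>2 \<le> 2 * (P x + R x)"
        using assms(1,2)[OF x] by (simp add: power2_sum power2_diff)
    qed
    also have "\<dots> = 4" using assms by (simp add: sum_distrib_left[symmetric] sum.distrib)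
    finally show "(\<Sum>x\<in>A. (?s x)\<^sup>2) \<le> 4" .
  qed (simp add: sum_nonneg)
  finally have 1: "(\<Sum>x\<in>A. \<bar>P x - R x\<bar>)\<^sup>2 / 4 \<le> (\<Sum>x\<in>A. \<bar>?d x\<bar>\<^sup>2)" by simp
  have "(\<Sum>x\<in>A. \<bar>?d x\<bar>\<^sup>2) = (\<Sum>x\<in>A. P x + R x - 2 * sqrt (P x) * sqrt (R x))"
    using assms(1,2) by (intro sum.cong refl) (simp add: power2_diff)
  also have "\<dots> = (\<Sum>x\<in>A. 2 * (P x - sqrt (P x) * sqrt (R x)))"
    using assms(4,5)
    by (simp add: sum.distrib sum_subtractf sum_distrib_left[symmetric] right_diff_distrib mult.assoc)
  also have "\<dots> \<le> (\<Sum>x\<in>A. P x * ln (P x / R x))"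
  proof (intro sum_mono)
    fix x assume x: "x \<in> A"
    show "2 * (P x - sqrt (P x) * sqrt (R x)) \<le> P x * ln (P x / R x)"
    proof (cases "P x = 0")
      case False
      then have p: "0 < P x" "0 < R x" using assms(1)[OF x] assms(3)[OF x] by auto
      \<comment> \<open>Comparing \<open>P x\<close> with the geometric mean of \<open>P x\<close>
        and \<open>R x\<close> halves the logarithm, and the left-hand sides sum to half the squared
        Hellinger distance.\<close>
      have "P x - sqrt (P x) * sqrt (R x) \<le> P x * ln (P x / (sqrt (P x) * sqrt (R x)))"
        using p by (intro ln_diff_ge) auto
      also have "\<dots> = P x * ln (P x / R x) / 2"
        using p by (simp add: ln_div ln_mult ln_sqrt field_simps)
      finally show ?thesis by simp
    qed simp
  qed
  finally show ?thesis using 1 by simp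
qed

section \<open>First-order expansion of the noisy word probabilities\<close>

definition flip_sum :: "(bool list \<Rightarrow> real) \<Rightarrow> bool list \<Rightarrow> real" where
  "flip_sum F u = (\<Sum>i<length u. F (u[i := \<not> u ! i]))"

text \<open>This is the derivative of \<open>noisy e F u\<close> at \<open>e = 0\<close>: a gain
  from every word one flip away, and a loss of \<open>F u\<close> for each letter, which is kept
  with probability \<open>1 - e\<close>. For word probabilities it is \<open>h_coef\<close>.\<close>

definition flip_coeff :: "(bool list \<Rightarrow> real) \<Rightarrow> bool list \<Rightarrow> real" where
  "flip_coeff F u = flip_sum F u - real (length u) * F u"

lemma flip_sum_Nil [simp]: "flip_sum F [] = 0"
  by (simp add: flip_sum_def)

lemma flip_sum_Cons: "flip_sum F (a # u) = F ((\<not> a) # u) + flip_sum (\<lambda>x. F (a # x)) u"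
  by (simp add: flip_sum_def sum.lessThan_Suc_shift del: sum.lessThan_Suc)

lemma flip_sum_append:
  "flip_sum F (x @ y) = flip_sum (\<lambda>x. F (x @ y)) x + flip_sum (\<lambda>y. F (x @ y)) y"
  by (induction x arbitrary: F) (auto simp: flip_sum_Cons)

lemma flip_sum_cong:
  "(\<And>x. length x = length u \<Longrightarrow> F x = G x) \<Longrightarrow> flip_sum F u = flip_sum G u"
  unfolding flip_sum_def by (intro sum.cong) auto

lemma flip_sum_zero:
  "(\<And>x. length x = length u \<Longrightarrow> F x = 0) \<Longrightarrow> flip_sum F u = 0"
  unfolding flip_sum_def by (intro sum.neutral) auto

lemma flip_sum_mult: "flip_sum (\<lambda>x. c * F x) u = c * flip_sum F u"
  by (simp add: flip_sum_def sum_distrib_left)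

lemma flip_sum_mult_right: "flip_sum (\<lambda>x. F x * c) u = flip_sum F u * c"
  by (simp add: flip_sum_def sum_distrib_right)

lemma flip_sum_add: "flip_sum (\<lambda>x. F x + G x) u = flip_sum F u + flip_sum G u"
  by (simp add: flip_sum_def sum.distrib)

lemma flip_sum_nonneg: "(\<And>u. 0 \<le> F u) \<Longrightarrow> 0 \<le> flip_sum F u"
  unfolding flip_sum_def by (intro sum_nonneg)

lemma flip_coeff_Nil: "flip_coeff F [] = 0"
  by (simp add: flip_coeff_def)

lemma flip_coeff_Cons: "flip_coeff F (a # u) = F ((\<not> a) # u) + flip_coeff (\<lambda>x. F (a # x)) u - F (a # u)"
  by (simp add: flip_coeff_def flip_sum_Cons algebra_simps)

lemma flip_coeff_add: "flip_coeff (\<lambda>x. F x + G x) u = flip_coeff F u + flip_coeff G u"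
  by (simp add: flip_coeff_def flip_sum_add algebra_simps)

lemma flip_coeff_nonneg: "(\<And>u. 0 \<le> F u) \<Longrightarrow> F u = 0 \<Longrightarrow> 0 \<le> flip_coeff F u"
  using flip_sum_nonneg[of F u] by (simp add: flip_coeff_def)

text \<open>A one-sided first-order Taylor expansion at 0 with quadratic remainder. It is stable
  under sums and products, and under logarithms when \<open>a\<close> is positive, so expansions can
  be composed by rules instead of being estimated anew.\<close>

definition jet :: "(real \<Rightarrow> real) \<Rightarrow> real \<Rightarrow> real \<Rightarrow> bool" where
  "jet f a b \<longleftrightarrow> (\<lambda>e. f e - a - b * e) \<in> O[at_right 0](\<lambda>e. e\<^sup>2)"

lemma id_bigo_1: "(\<lambda>e::real. e) \<in> O[at_right 0](\<lambda>_. 1)"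
  by real_asymp

lemma sq_bigo_id: "(\<lambda>e::real. e\<^sup>2) \<in> O[at_right 0](\<lambda>e. e)"
  by real_asymp

lemma jet_bigo_id:
  assumes "jet f 0 b"
  shows "f \<in> O[at_right 0](\<lambda>e. e)"
proof -
  have "(\<lambda>e. f e - 0 - b * e) \<in> O[at_right 0](\<lambda>e. e)"
    using assms sq_bigo_id unfolding jet_def by (rule landau_o.big_trans)
  moreover have "(\<lambda>e. b * e) \<in> O[at_right 0](\<lambda>e. e)" by simp
  ultimately have "(\<lambda>e. (f e - 0 - b * e) + b * e) \<in> O[at_right 0](\<lambda>e. e)"
    by (rule sum_in_bigo)
  then show ?thesis by simp
qed

lemma jet_diff_bigo_id:
  assumes "jet f a b"
  shows "(\<lambda>e. f e - a) \<in> O[at_right 0](\<lambda>e. e)"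
  using assms by (intro jet_bigo_id[of _ b]) (simp add: jet_def)

lemma jet_bigo_1:
  assumes "jet f a b"
  shows "f \<in> O[at_right 0](\<lambda>_. 1)"
proof -
  have "(\<lambda>e. f e - a) \<in> O[at_right 0](\<lambda>_. 1)"
    using jet_diff_bigo_id[OF assms] id_bigo_1 by (rule landau_o.big_trans)
  moreover have "(\<lambda>_. a) \<in> O[at_right 0](\<lambda>_::real. 1 :: real)" by simp
  ultimately have "(\<lambda>e. (f e - a) + a) \<in> O[at_right 0](\<lambda>_. 1)"
    by (rule sum_in_bigo)
  then show ?thesis by simp
qed

lemma jet_bigo_sq: "jet f 0 0 \<longleftrightarrow> f \<in> O[at_right 0](\<lambda>e. e\<^sup>2)"
  by (simp add: jet_def)

lemma jet_add:
  assumes "jet f a b" "jet g a' b'"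
  shows "jet (\<lambda>e. f e + g e) (a + a') (b + b')"
proof -
  have "(\<lambda>e. (f e - a - b * e) + (g e - a' - b' * e)) \<in> O[at_right 0](\<lambda>e. e\<^sup>2)"
    by (rule sum_in_bigo(1)[OF assms[unfolded jet_def]])
  then show ?thesis by (simp add: jet_def algebra_simps)
qed

lemma jet_mult:
  assumes "jet f a b" "jet g a' b'"
  shows "jet (\<lambda>e. f e * g e) (a * a') (a * b' + b * a')"
proof -
  have "(\<lambda>e. (f e - a - b * e) * g e) \<in> O[at_right 0](\<lambda>e. e\<^sup>2 * 1)"
    by (rule landau_o.big_mult[OF assms(1)[unfolded jet_def] jet_bigo_1[OF assms(2)]])
  moreover have "(\<lambda>e. a + b * e) \<in> O[at_right 0](\<lambda>_. 1)"
    by (rule jet_bigo_1[of _ a b]) (simp add: jet_def)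
  from landau_o.big_mult[OF this assms(2)[unfolded jet_def]]
  have "(\<lambda>e. (a + b * e) * (g e - a' - b' * e)) \<in> O[at_right 0](\<lambda>e. 1 * e\<^sup>2)"
    by simp
  moreover have "(\<lambda>e. b * b' * e\<^sup>2) \<in> O[at_right 0](\<lambda>e. e\<^sup>2)" by simp
  ultimately have "(\<lambda>e. (f e - a - b * e) * g e + (a + b * e) * (g e - a' - b' * e) + b * b' * e\<^sup>2)
      \<in> O[at_right 0](\<lambda>e. e\<^sup>2)"
    by (intro sum_in_bigo(1)) simp_all
  then show ?thesis by (simp add: jet_def algebra_simps power2_eq_square)
qed

lemma jet_const: "jet (\<lambda>_. a) a 0"
  by (simp add: jet_def)

lemma jet_id: "jet (\<lambda>e. e) 0 1"
  by (simp add: jet_def)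

lemma jet_one_minus: "jet (\<lambda>e. 1 - e) 1 (- 1)"
  by (simp add: jet_def)

lemma noisy_Cons:
  "noisy e F (c # z) = (1 - e) * noisy e (\<lambda>x. F (c # x)) z + e * noisy e (\<lambda>x. F ((\<not> c) # x)) z"
  by (cases c) (simp_all add: noisy_def sum_words_Cons sum.distrib sum_distrib_left mult_ac)

text \<open>Peeling off the first letter writes the noisy weight as a combination with coefficients
  \<open>1 - e\<close> and \<open>e\<close>; the product rule for jets then reproduces the recursion
  of \<open>flip_coeff\<close>.\<close>

lemma jet_noisy: "jet (\<lambda>e. noisy e F z) (F z) (flip_coeff F z)"
proof (induction z arbitrary: F)
  case Nil
  then show ?case by (simp add: noisy_def jet_const flip_coeff_Nil)
next
  case (Cons c z)
  have "jet (\<lambda>e. noisy e F (c # z))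
     (1 * F (c # z) + 0 * F ((\<not> c) # z))
     ((1 * flip_coeff (\<lambda>x. F (c # x)) z + (- 1) * F (c # z)) + (0 * flip_coeff (\<lambda>x. F ((\<not> c) # x)) z + 1 * F ((\<not> c) # z)))"
    unfolding noisy_Cons by (intro jet_add jet_mult jet_one_minus jet_id Cons)
  then show ?case by (simp add: flip_coeff_Cons algebra_simps)
qed


section \<open>Markov word laws\<close>

text \<open>Both hypotheses express the same proportionality factor \<open>d / k\<close>. The factor
  \<open>k\<close> is left uncancelled so that the rule is a polynomial identity, valid also for
  \<open>k = 0\<close>.\<close>

lemma proportional_cross_mult:
  fixes a b :: real
  assumes "a * k = b * d" "a' * k = b' * d"
  shows "a * b' * k = a' * b * k"
  using assms by algebra

lemma proportional_cross_mult':
  fixes a b :: real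
  assumes "a * k = d * b" "a' * k = d * b'"
  shows "a * b' * k = a' * b * k"
  using assms by algebra

text \<open>The Markov property in cross-multiplied form: past \<open>x\<close> and future
  \<open>z\<close> are independent given a middle part of length at least \<open>m\<close>. Words of
  probability 0 thus need no separate convention.\<close>

definition markov_law :: "nat \<Rightarrow> (bool list \<Rightarrow> real) \<Rightarrow> bool" where
  "markov_law m q \<longleftrightarrow> word_law q \<and>
     (\<forall>x y z. m \<le> length y \<longrightarrow> q (x @ y @ z) * q y = q (x @ y) * q (y @ z))"

context
  fixes m :: nat and q :: "bool list \<Rightarrow> real"
  assumes M: "markov_law m q"
begin

lemma markov_law_word_law: "word_law q"
  using M by (simp add: markov_law_def)

lemma markov_law_eq: "m \<le> length y \<Longrightarrow> q (x @ y @ z) * q y = q (x @ y) * q (y @ z)"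
  using M by (simp add: markov_law_def)

lemma markov_zero_mid: "q y = 0 \<Longrightarrow> q (x @ y @ z) = 0"
  by (rule word_law_eq_0[OF markov_law_word_law])

lemma markov_zero_left: "q y = 0 \<Longrightarrow> q (y @ z) = 0"
  using markov_zero_mid[of y "[]"] by simp

lemma markov_zero_right: "q y = 0 \<Longrightarrow> q (x @ y) = 0"
  using markov_zero_mid[of y x "[]"] by simp

text \<open>At \<open>e = 0\<close> the identity is the vanishing derivative of the difference
  between P(b, wv) P(w) and P(b, w) P(wv), where \<open>b\<close> is noiseless and the rest noisy. A
  flip in one half of \<open>w\<close> leaves the other half intact, and since that half has length
  at least \<open>m\<close>, it separates the flip from \<open>v\<close> or from
  \<open>b\<close>.\<close>

lemma flip_coeff_identity_allowed:
  assumes w: "q w \<noteq> 0" and len: "2 * m \<le> length w" and z: "q (b @ w @ [v]) = 0"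
  shows "flip_coeff (\<lambda>x. q (b @ x)) (w @ [v]) * q w
    = q (b @ w) * flip_coeff q (w @ [v]) + flip_coeff (\<lambda>x. q (b @ x)) w * q (w @ [v])"
proof -
  define w1 w2 where "w1 = take m w" and "w2 = drop m w"
  have ws: "w = w1 @ w2" and l1: "m \<le> length w1" and l2: "m \<le> length w2"
    using len by (auto simp: w1_def w2_def)
  have q1: "q w1 \<noteq> 0" and q2: "q w2 \<noteq> 0"
    using w markov_zero_left markov_zero_right unfolding ws by blast+
  have z': "q (b @ w) * q (w @ [v]) = 0"
    using markov_law_eq[of w b "[v]"] len z by simp
  have last: "q (b @ w @ [\<not> v]) * q w = q (b @ w) * q (w @ [\<not> v])"
    using markov_law_eq[of w b "[\<not> v]"] len by simp
  \<comment> \<open>A change in the first half, to \<open>x\<close>, leaves \<open>w2\<close>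
    adjacent to \<open>v\<close>. By \<open>z'\<close> one of the two products on the right
    vanishes, and the Markov property at \<open>w2\<close> gives the other.\<close>
  have c1: "q (b @ x @ w2 @ [v]) * q w = q (b @ w) * q (x @ w2 @ [v]) + q (b @ x @ w2) * q (w @ [v])" for x
  proof (cases "q (w @ [v]) = 0")
    case True
    have "q (w1 @ w2 @ [v]) * q w2 = q (w1 @ w2) * q (w2 @ [v])" using markov_law_eq l2 by blast
    then have "q (w2 @ [v]) = 0" using True w ws by simp
    then have "q (x @ w2 @ [v]) = 0" "q (b @ x @ w2 @ [v]) = 0"
      using markov_zero_right[of "w2 @ [v]" x] markov_zero_right[of "w2 @ [v]" "b @ x"] by auto
    then show ?thesis using True by simp
  next
    case False
    then have bw: "q (b @ w) = 0" using z' by simp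
    have "q ((b @ x) @ w2 @ [v]) * q w2 = q ((b @ x) @ w2) * q (w2 @ [v])"
      using markov_law_eq l2 by blast
    moreover have "q (w1 @ w2 @ [v]) * q w2 = q (w1 @ w2) * q (w2 @ [v])" using markov_law_eq l2 by blast
    ultimately have "q ((b @ x) @ w2 @ [v]) * q (w1 @ w2) * q w2 = q (w1 @ w2 @ [v]) * q ((b @ x) @ w2) * q w2"
      by (rule proportional_cross_mult)
    then have "q (b @ x @ w2 @ [v]) * q w * q w2 = q (b @ x @ w2) * q (w @ [v]) * q w2"
      by (simp add: ws mult_ac)
    then show ?thesis using q2 bw by simp
  qed
  have c2: "q (b @ w1 @ y @ [v]) * q w = q (b @ w) * q (w1 @ y @ [v]) + q (b @ w1 @ y) * q (w @ [v])" for y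
  proof (cases "q (b @ w) = 0")
    case True
    have "q (b @ w1 @ w2) * q w1 = q (b @ w1) * q (w1 @ w2)" using markov_law_eq l1 by blast
    then have "q (b @ w1) = 0" using True w ws by simp
    then have "q (b @ w1 @ y @ [v]) = 0" "q (b @ w1 @ y) = 0"
      using markov_zero_left[of "b @ w1" "y @ [v]"] markov_zero_left[of "b @ w1" y] by auto
    then show ?thesis using True by simp
  next
    case False
    then have wv: "q (w @ [v]) = 0" using z' by simp
    have "q (b @ w1 @ (y @ [v])) * q w1 = q (b @ w1) * q (w1 @ (y @ [v]))" using markov_law_eq l1 by blast
    moreover have "q (b @ w1 @ w2) * q w1 = q (b @ w1) * q (w1 @ w2)" using markov_law_eq l1 by blast
    ultimately have "q (b @ w1 @ (y @ [v])) * q (w1 @ w2) * q w1 = q (b @ w1 @ w2) * q (w1 @ (y @ [v])) * q w1"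
      by (rule proportional_cross_mult')
    then have "q (b @ w1 @ y @ [v]) * q w * q w1 = q (b @ w) * q (w1 @ y @ [v]) * q w1"
      by (simp add: ws mult_ac)
    then show ?thesis using q1 wv by simp
  qed
  have d1: "flip_sum (\<lambda>x. q (b @ x @ w2 @ [v])) w1 * q w
      = q (b @ w) * flip_sum (\<lambda>x. q (x @ w2 @ [v])) w1 + flip_sum (\<lambda>x. q (b @ x @ w2)) w1 * q (w @ [v])"
    unfolding flip_sum_mult[symmetric] flip_sum_mult_right[symmetric] flip_sum_add[symmetric]
    by (rule flip_sum_cong) (rule c1)
  have d2: "flip_sum (\<lambda>y. q (b @ w1 @ y @ [v])) w2 * q w
      = q (b @ w) * flip_sum (\<lambda>y. q (w1 @ y @ [v])) w2 + flip_sum (\<lambda>y. q (b @ w1 @ y)) w2 * q (w @ [v])"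
    unfolding flip_sum_mult[symmetric] flip_sum_mult_right[symmetric] flip_sum_add[symmetric]
    by (rule flip_sum_cong) (rule c2)
  have e1: "flip_coeff (\<lambda>x. q (b @ x)) (w @ [v]) = flip_sum (\<lambda>x. q (b @ x @ w2 @ [v])) w1
      + flip_sum (\<lambda>y. q (b @ w1 @ y @ [v])) w2 + q (b @ w @ [\<not> v])"
    using z by (simp add: flip_coeff_def ws flip_sum_append flip_sum_Cons)
  have e2: "flip_coeff q (w @ [v]) = flip_sum (\<lambda>x. q (x @ w2 @ [v])) w1
      + flip_sum (\<lambda>y. q (w1 @ y @ [v])) w2 + q (w @ [\<not> v]) - real (length w + 1) * q (w @ [v])"
    by (simp add: flip_coeff_def ws flip_sum_append flip_sum_Cons)
  have e3: "flip_coeff (\<lambda>x. q (b @ x)) w = flip_sum (\<lambda>x. q (b @ x @ w2)) w1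
      + flip_sum (\<lambda>y. q (b @ w1 @ y)) w2 - real (length w) * q (b @ w)"
    by (simp add: flip_coeff_def ws flip_sum_append)
  \<comment> \<open>The loss terms of the flip coefficients all carry the product
    \<open>q (b @ w) * q (w @ [v])\<close>, which is 0 by \<open>z'\<close>.\<close>
  have "flip_coeff (\<lambda>x. q (b @ x)) (w @ [v]) * q w
      = q (b @ w) * flip_coeff q (w @ [v]) + flip_coeff (\<lambda>x. q (b @ x)) w * q (w @ [v])
        + real (2 * length w + 1) * (q (b @ w) * q (w @ [v]))"
    using d1 d2 last unfolding e1 e2 e3 by (simp add: algebra_simps)
  then show ?thesis using z' by simp
qed

text \<open>This is where \<open>3 * m\<close> enters: the single flips that repair a forbidden word of length at least
  \<open>3 * m\<close> all avoid its first third or all avoid its last third.\<close>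

lemma flip_coeff_identity_forbidden:
  assumes w: "q w = 0" and len: "3 * m \<le> length w"
  shows "flip_coeff (\<lambda>x. q (b @ x)) (w @ [v]) * flip_coeff q w = flip_coeff (\<lambda>x. q (b @ x)) w * flip_coeff q (w @ [v])"
proof -
  define w1 w2 w3 where "w1 = take m w" and "w2 = take m (drop m w)" and "w3 = drop m (drop m w)"
  have ws: "w = w1 @ w2 @ w3"
    by (simp only: w1_def w2_def w3_def append_take_drop_id)
  have l: "m \<le> length w1" "m \<le> length w2" "m \<le> length w3"
    using len by (auto simp: w1_def w2_def w3_def)
  define w' where "w' = w2 @ w3"
  define w'' where "w'' = w1 @ w2"
  have z: "q (x @ w @ y) = 0" for x y
    by (rule markov_zero_mid[OF w])
  have z0: "q (x @ w) = 0" "q (w @ y) = 0" for x y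
    using z[of x "[]"] z[of "[]" y] by auto
  have h1: "flip_coeff (\<lambda>x. q (b @ x)) (w @ [v]) = flip_sum (\<lambda>x. q (b @ x @ [v])) w"
    using z by (simp add: flip_coeff_def flip_sum_append[of _ w "[v]"] flip_sum_Cons)
  have h2: "flip_coeff q (w @ [v]) = flip_sum (\<lambda>x. q (x @ [v])) w"
    using z0 by (simp add: flip_coeff_def flip_sum_append[of _ w "[v]"] flip_sum_Cons)
  have h3: "flip_coeff (\<lambda>x. q (b @ x)) w = flip_sum (\<lambda>x. q (b @ x)) w" "flip_coeff q w = flip_sum q w"
    using z0 w by (auto simp: flip_coeff_def)
  \<comment> \<open>If both overlapping two-thirds were allowed, the Markov property at their common
    middle \<open>w2\<close> would make \<open>w\<close> allowed.\<close>
  have "q w' = 0 \<or> q w'' = 0"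
  proof (rule ccontr)
    assume "\<not> ?thesis"
    moreover have "q (w1 @ w2 @ w3) * q w2 = q (w1 @ w2) * q (w2 @ w3)"
      using markov_law_eq l by blast
    ultimately show False using w by (simp add: ws w'_def w''_def)
  qed
  then show ?thesis
  proof
    assume z': "q w' = 0"
    have ws': "w = w1 @ w'" by (simp add: ws w'_def)
    have r: "flip_sum (\<lambda>x. q (x @ w')) w1 = 0" "flip_sum (\<lambda>x. q (x @ w' @ [v])) w1 = 0"
      "flip_sum (\<lambda>x. q (b @ x @ w')) w1 = 0" "flip_sum (\<lambda>x. q (b @ x @ w' @ [v])) w1 = 0"
      using markov_zero_right[OF z'] markov_zero_mid[OF z'] markov_zero_right[OF z', of "b @ _"]
        markov_zero_mid[OF z', of "b @ _" "[v]"]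
      by (auto intro!: flip_sum_zero)
    have k: "q (b @ w1 @ y) * q w1 = q (b @ w1) * q (w1 @ y)" for y
      using markov_law_eq l by blast
    have k1: "flip_sum (\<lambda>y. q (b @ w1 @ y)) w' * q w1 = q (b @ w1) * flip_sum (\<lambda>y. q (w1 @ y)) w'"
      unfolding flip_sum_mult[symmetric] flip_sum_mult_right[symmetric]
      by (rule flip_sum_cong) (rule k)
    have k2: "flip_sum (\<lambda>y. q (b @ w1 @ y @ [v])) w' * q w1
        = q (b @ w1) * flip_sum (\<lambda>y. q (w1 @ y @ [v])) w'"
      unfolding flip_sum_mult[symmetric] flip_sum_mult_right[symmetric]
      by (rule flip_sum_cong) (rule k)
    show ?thesis
    proof (cases "q w1 = 0")
      case True
      have "flip_sum (\<lambda>y. q (w1 @ y)) w' = 0" "flip_sum (\<lambda>y. q (w1 @ y @ [v])) w' = 0"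
        using markov_zero_left[OF True] by (auto intro!: flip_sum_zero)
      then show ?thesis
        unfolding h1 h2 h3 unfolding ws' flip_sum_append append_assoc by (simp add: r)
    next
      case False
      have "flip_sum (\<lambda>y. q (b @ w1 @ y @ [v])) w' * flip_sum (\<lambda>y. q (w1 @ y)) w' * q w1
          = flip_sum (\<lambda>y. q (b @ w1 @ y)) w' * flip_sum (\<lambda>y. q (w1 @ y @ [v])) w' * q w1"
        using proportional_cross_mult'[OF k2 k1] by (simp only: mult_ac)
      with False show ?thesis
        unfolding h1 h2 h3 unfolding ws' flip_sum_append append_assoc by (simp add: r)
    qed
  next
    assume z': "q w'' = 0"
    have ws': "w = w'' @ w3" by (simp add: ws w''_def)
    have r: "flip_sum (\<lambda>x. q (w'' @ x)) w3 = 0" "flip_sum (\<lambda>x. q (w'' @ x @ [v])) w3 = 0"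
      "flip_sum (\<lambda>x. q (b @ w'' @ x)) w3 = 0" "flip_sum (\<lambda>x. q (b @ w'' @ x @ [v])) w3 = 0"
      using markov_zero_left[OF z'] markov_zero_mid[OF z']
      by (auto intro!: flip_sum_zero)
    have k: "q (x @ w3 @ [v]) * q w3 = q (x @ w3) * q (w3 @ [v])" for x
      using markov_law_eq l by blast
    have k1: "flip_sum (\<lambda>x. q (b @ x @ w3 @ [v])) w'' * q w3 = flip_sum (\<lambda>x. q (b @ x @ w3)) w'' * q (w3 @ [v])"
      unfolding flip_sum_mult_right[symmetric]
      by (rule flip_sum_cong) (use k[of "b @ _"] in simp)
    have k2: "flip_sum (\<lambda>x. q (x @ w3 @ [v])) w'' * q w3 = flip_sum (\<lambda>x. q (x @ w3)) w'' * q (w3 @ [v])"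
      unfolding flip_sum_mult_right[symmetric]
      by (rule flip_sum_cong) (rule k)
    show ?thesis
    proof (cases "q w3 = 0")
      case True
      have "flip_sum (\<lambda>x. q (x @ w3)) w'' = 0" "flip_sum (\<lambda>x. q (x @ w3 @ [v])) w'' = 0"
        using markov_zero_right[OF True] markov_zero_mid[OF True] by (auto intro!: flip_sum_zero)
      then show ?thesis
        unfolding h1 h2 h3 unfolding ws' flip_sum_append append_assoc by (simp add: r)
    next
      case False
      have "flip_sum (\<lambda>x. q (b @ x @ w3 @ [v])) w'' * flip_sum (\<lambda>x. q (x @ w3)) w'' * q w3
          = flip_sum (\<lambda>x. q (b @ x @ w3)) w'' * flip_sum (\<lambda>x. q (x @ w3 @ [v])) w'' * q w3"
        using proportional_cross_mult[OF k1 k2] by (simp only: mult_ac)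
      with False show ?thesis
        unfolding h1 h2 h3 unfolding ws' flip_sum_append append_assoc by (simp add: r)
    qed
  qed
qed

definition f_sum :: "nat \<Rightarrow> real" where
  "f_sum n = (\<Sum>u\<in>words (Suc n). if q (butlast u) \<noteq> 0 \<and> q u = 0 then flip_coeff q u else 0)"

text \<open>Two forbidden words at the two ends of a word of length at least \<open>2 * m + 2\<close> are disjoint,
  so that no single flip repairs both.\<close>

lemma f_sum_Suc:
  assumes n: "2 * m \<le> n"
  shows "f_sum (Suc n) = f_sum n"
proof -
  let ?I = "\<lambda>u. if q (butlast u) \<noteq> 0 \<and> q u = 0 then flip_coeff q u else 0"
  have "?I (True # u) + ?I (False # u) = ?I u" if u: "length u = Suc n" for u
  proof -
    obtain w v where uw: "u = w @ [v]" using u by (cases u rule: rev_cases) auto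
    then have lw: "length w = n" using u by simp
    \<comment> \<open>The condition that \<open>a # w\<close> is allowed may be weakened to
      \<open>w\<close> being allowed, since the additional words contribute 0. The condition then no
      longer depends on \<open>a\<close>, and the first letter can be summed out.\<close>
    have *: "?I (a # u) = (if q w \<noteq> 0 \<and> q u = 0 then flip_coeff q (a # u) else 0)" for a
    proof -
      have eq: "q (a # w @ [v]) * q w = q (a # w) * q (w @ [v])"
        using markov_law_eq[of w "[a]" "[v]"] lw n by simp
      have "flip_coeff q (a # u) = 0" if z: "q w \<noteq> 0" "q (w @ [v]) = 0" "q (a # w) = 0"
      proof -
        define w1 w2 where "w1 = take m w" and "w2 = drop m w"
        have ws: "w = w1 @ w2" and l1: "m \<le> length w1" and l2: "m \<le> length w2"
          using lw n by (auto simp: w1_def w2_def)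
        have "q (w1 @ w2 @ [v]) * q w2 = q (w1 @ w2) * q (w2 @ [v])" using markov_law_eq l2 by blast
        then have z2: "q (w2 @ [v]) = 0" using z ws by simp
        have "q ([a] @ w1 @ w2) * q w1 = q ([a] @ w1) * q (w1 @ w2)" using markov_law_eq l1 by blast
        then have z1: "q ([a] @ w1) = 0" using z ws by simp
        have "q (a # u) = 0" "q ((\<not> a) # u) = 0" "q (a # w @ [\<not> v]) = 0"
          using markov_zero_right[of "w @ [v]" "[_]"] markov_zero_left[of "a # w"] z by (auto simp: uw)
        moreover have "flip_sum (\<lambda>x. q (a # x @ w2 @ [v])) w1 = 0"
          using markov_zero_right[OF z2, of "a # _"] by (intro flip_sum_zero) simp
        moreover have "flip_sum (\<lambda>x. q (a # w1 @ x @ [v])) w2 = 0"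
          using markov_zero_left[OF z1] by (intro flip_sum_zero) simp
        ultimately show ?thesis
          by (simp add: flip_coeff_def uw ws flip_sum_append flip_sum_Cons)
      qed
      then show ?thesis
        using eq markov_zero_right[of w "[a]"] by (auto simp: uw butlast_append)
    qed
    have "flip_coeff q (True # u) + flip_coeff q (False # u) = flip_coeff (\<lambda>x. q (True # x) + q (False # x)) u"
      by (simp add: flip_coeff_Cons flip_coeff_add)
    also have "(\<lambda>x. q (True # x) + q (False # x)) = q"
      using word_lawD(4)[OF markov_law_word_law] by auto
    finally show ?thesis
      unfolding * by (simp add: uw)
  qed
  then show ?thesis
    unfolding f_sum_def sum_words_Cons[of ?I "Suc n"] by (intro sum.cong) auto
qed

text \<open>The entropy is expanded with windows of length \<open>3 * m\<close>, while the
  coefficient of the leading term is stated with \<open>2 * m\<close>; this lemma bridges the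
  two.\<close>

lemma f_sum_stable: "2 * m \<le> n \<Longrightarrow> f_sum n = f_sum (2 * m)"
  by (induction n rule: dec_induct) (auto simp: f_sum_Suc)

end

section \<open>Word probabilities of processes\<close>

lemma space_path_space [simp]: "space path_space = UNIV"
  by (simp add: path_space_def space_PiM)

lemma measurable_window_path [measurable]:
  "(\<lambda>x. map x L) \<in> measurable path_space (count_space UNIV)"
proof -
  have c: "(\<lambda>x. x i) \<in> measurable path_space (count_space UNIV)" for i
    unfolding path_space_def by (rule measurable_component_singleton) simp
  have "{x \<in> space path_space. map x L = u} \<in> sets path_space" for u
  proof (induction L arbitrary: u)
    case Nil
    then show ?case using sets.top[of path_space] by (cases u) auto
  next
    case (Cons i L)
    show ?case
    proof (cases u)
      case Nil then show ?thesis by simp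
    next
      case (Cons a u')
      have "{x \<in> space path_space. map x (i # L) = u}
          = ((\<lambda>x. x i) -` {a} \<inter> space path_space) \<inter> {x \<in> space path_space. map x L = u'}"
        by (auto simp: Cons)
      also have "\<dots> \<in> sets path_space"
        by (intro sets.Int measurable_sets[OF c] Cons.IH) simp
      finally show ?thesis .
    qed
  qed
  then have "(\<lambda>x. map x L) -` {u} \<inter> space path_space \<in> sets path_space" for u
    by (simp add: vimage_def Int_def conj_commute)
  then show ?thesis
    by (subst measurable_count_space_eq2_countable) auto
qed

definition window_prob :: "(int \<Rightarrow> bool) measure \<Rightarrow> int list \<Rightarrow> bool list \<Rightarrow> real" where
  "window_prob X L u = measure X {x. map x L = u}"

locale path_measure = prob_space X for X :: "(int \<Rightarrow> bool) measure" +
  assumes sets_X [measurable_cong]: "sets X = sets path_space"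
begin

lemma space_X [simp]: "space X = UNIV"
  using sets_eq_imp_space_eq[OF sets_X] by simp

lemma measurable_window [measurable]: "(\<lambda>x. map x L) \<in> measurable X (count_space UNIV)"
  using measurable_window_path measurable_cong_sets[OF sets_X refl] by blast

lemma sets_window [simp]: "{x. map x L = u} \<in> sets X"
  using measurable_sets[OF measurable_window, of "{u}"] by (simp add: vimage_def)

lemma word_prob_eq_window: "word_prob X u = window_prob X [1 - int (length u)..0] u"
  by (simp add: word_prob_def window_prob_def)

lemma window_prob_Cons:
  "window_prob X (i # L) (True # u) + window_prob X (i # L) (False # u) = window_prob X L u"
proof -
  have "{x. map x L = u} = {x. map x (i # L) = True # u} \<union> {x. map x (i # L) = False # u}" by auto
  then show ?thesis unfolding window_prob_def
    by (simp only:) (rule finite_measure_Union[symmetric], auto simp del: list.map)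
qed

lemma window_prob_snoc:
  assumes "length u = length L"
  shows "window_prob X (L @ [i]) (u @ [True]) + window_prob X (L @ [i]) (u @ [False]) = window_prob X L u"
proof -
  have "{x. map x L = u} = {x. map x (L @ [i]) = u @ [True]} \<union> {x. map x (L @ [i]) = u @ [False]}"
    using assms by auto
  then show ?thesis unfolding window_prob_def
    by (simp only:) (rule finite_measure_Union[symmetric], auto simp del: map_append)
qed

lemma measurable_shift: "(\<lambda>x i. x (i + 1)) \<in> measurable X path_space"
proof -
  have "(\<lambda>x i. x (i + 1)) \<in> measurable path_space path_space"
    unfolding path_space_def
    by (rule measurable_PiM_single') (auto simp: measurable_component_singleton space_PiM)
  then show ?thesis using measurable_cong_sets[OF sets_X refl] by blast
qed

lemma window_prob_shift:
  "measure (distr X path_space (\<lambda>x i. x (i + 1))) {x. map x L = u} = window_prob X (map ((+) 1) L) u"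
proof -
  have "measure (distr X path_space (\<lambda>x i. x (i + 1))) {x. map x L = u}
      = measure X ((\<lambda>x i. x (i + 1)) -` {x. map x L = u} \<inter> space X)"
    using sets_window sets_X by (intro measure_distr[OF measurable_shift]) auto
  then show ?thesis
    by (simp add: window_prob_def vimage_def o_def add.commute)
qed

lemma shannon_entropy_window:
  "shannon_entropy X (\<lambda>x. map x [- int n..0])
    = - (\<Sum>u\<in>words (Suc n). word_prob X u * ln (word_prob X u))"
proof -
  have "shannon_entropy X (\<lambda>x. map x [- int n..0]) = - (\<Sum>a\<in>words (Suc n).
      \<P>(x in X. map x [- int n..0] = a) * ln (\<P>(x in X. map x [- int n..0] = a)))"
    by (rule shannon_entropy_eq_sum) (auto intro: prob_space_axioms)
  then show ?thesis
    by (simp add: word_prob_def)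
qed

end

lemma stationary_processD:
  assumes "stationary_process X"
  shows "path_measure X" "window_prob X (map ((+) 1) L) u = window_prob X L u"
proof -
  show P: "path_measure X"
    using assms by (simp add: stationary_process_def path_measure_def path_measure_axioms_def)
  interpret path_measure X by fact
  show "window_prob X (map ((+) 1) L) u = window_prob X L u"
    using assms window_prob_shift[of L u] by (simp add: stationary_process_def window_prob_def)
qed

lemma map_Suc_upto_int: "map ((+) 1) [a..b] = [a + 1..b + 1 :: int]"
  by (rule nth_equalityI) auto

lemma word_law_word_prob:
  assumes "stationary_process X"
  shows "word_law (word_prob X)"
proof -
  interpret path_measure X by (rule stationary_processD[OF assms])
  have r: "word_prob X (w @ [True]) + word_prob X (w @ [False]) = word_prob X w" for w
  proof -
    have "[- int (length w)..0] = [- int (length w)..- 1] @ [0]"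
      using upto_rec2[of "- int (length w)" 0] by simp
    then have "word_prob X (w @ [True]) + word_prob X (w @ [False])
        = window_prob X [- int (length w)..- 1] w"
      unfolding word_prob_eq_window using window_prob_snoc[of w "[- int (length w)..- 1]" 0] by simp
    also have "\<dots> = window_prob X (map ((+) 1) [- int (length w)..- 1]) w"
      using stationary_processD(2)[OF assms] by simp
    also have "\<dots> = word_prob X w"
      by (simp add: map_Suc_upto_int word_prob_eq_window)
    finally show ?thesis .
  qed
  have l: "word_prob X (True # w) + word_prob X (False # w) = word_prob X w" for w
  proof -
    have "[- int (length w)..0] = - int (length w) # [1 - int (length w)..0]"
      using upto_rec1[of "- int (length w)" 0] by simp
    then show ?thesis
      unfolding word_prob_eq_window using window_prob_Cons by simp
  qed
  have "word_prob X [] = 1"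
    using prob_space by (simp add: word_prob_def)
  moreover have "0 \<le> word_prob X u" for u
    by (simp add: word_prob_def)
  ultimately show ?thesis
    using r l by (auto simp: word_law_def right_marginal_def left_marginal_def)
qed

lemma h_coef_eq_flip_coeff: "h_coef X u = flip_coeff (word_prob X) u"
  by (simp add: h_coef_def flip_coeff_def flip_sum_def)

text \<open>The definition of order \<open>m\<close> conditions a single next letter. A longer
  future is reached letter by letter, with a separate case when the past already has probability 0
  and the conditional probabilities say nothing.\<close>

lemma markov_law_word_prob:
  assumes "markov_order m X"
  shows "markov_law m (word_prob X)"
proof -
  let ?q = "word_prob X"
  have W: "word_law ?q"
    using assms word_law_word_prob by (simp add: markov_order_def)
  have c: "?q (w @ [v]) / ?q w = ?q (drop (length w - m) w @ [v]) / ?q (drop (length w - m) w)"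
    if "m \<le> length w" "?q w \<noteq> 0" for w v
    using that assms word_lawD(1)[OF W, of w] by (auto simp: markov_order_def cond_word_prob_def less_le)
  have "?q (x @ y @ z) * ?q y = ?q (x @ y) * ?q (y @ z)" if "m \<le> length y" for x y z
  proof (induction z rule: rev_induct)
    case (snoc v z)
    show ?case
    proof (cases "?q (x @ y @ z) = 0")
      case True
      then have "?q (x @ y @ z @ [v]) = 0"
        using word_law_eq_0[OF W, of "x @ y @ z" "[]" "[v]"] by simp
      moreover have "?q (x @ y) * ?q (y @ z @ [v]) = 0"
        using snoc True word_law_eq_0[OF W, of "y @ z" "[]" "[v]"] by auto
      ultimately show ?thesis by simp
    next
      case False
      then have nz: "?q (y @ z) \<noteq> 0"
        using word_law_eq_0[OF W, of "y @ z" "x" "[]"] by auto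
      have "?q (x @ y @ z @ [v]) / ?q (x @ y @ z) = ?q (y @ z @ [v]) / ?q (y @ z)"
        using c[of "x @ y @ z" v] c[of "y @ z" v] False nz that by (simp add: algebra_simps)
      then have "?q (x @ y @ z @ [v]) * ?q (y @ z) = ?q (y @ z @ [v]) * ?q (x @ y @ z)"
        using False nz by (simp add: field_simps)
      then have "?q (x @ y @ z @ [v]) * ?q y * ?q (y @ z) = ?q (x @ y) * ?q (y @ z @ [v]) * ?q (y @ z)"
        using snoc by algebra
      then show ?thesis using nz by simp
    qed
  qed simp
  then show ?thesis using W by (simp add: markov_law_def)
qed

lemma markov_order_of_law:
  assumes "stationary_process X" "markov_law m (word_prob X)"
  shows "markov_order m X"
proof -
  let ?q = "word_prob X"
  have "?q (w @ [v]) / ?q w = ?q (drop (length w - m) w @ [v]) / ?q (drop (length w - m) w)"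
    if w: "m \<le> length w" "0 < ?q w" for w v
  proof -
    define x y where "x = take (length w - m) w" and "y = drop (length w - m) w"
    have xy: "w = x @ y" and l: "m \<le> length y" using w by (auto simp: x_def y_def)
    have "?q (x @ y @ [v]) * ?q y = ?q (x @ y) * ?q (y @ [v])"
      using markov_law_eq[OF assms(2)] l by blast
    moreover have "?q y \<noteq> 0"
      using markov_zero_right[OF assms(2), of y x] w xy by auto
    ultimately show ?thesis
      using w unfolding y_def[symmetric] unfolding xy by (simp add: field_simps)
  qed
  then show ?thesis using assms(1) by (simp add: markov_order_def cond_word_prob_def)
qed


section \<open>Channel outputs\<close>

lemma pmf_replicate_Cons:
  "pmf (replicate_pmf (Suc n) p) (x # xs) = pmf p x * pmf (replicate_pmf n p) xs"
proof -
  have "replicate_pmf (Suc n) p = map_pmf (\<lambda>(x, xs). x # xs) (pair_pmf p (replicate_pmf n p))"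
    by (simp add: pair_pmf_def map_bind_pmf)
  moreover have "inj (\<lambda>(x :: 'a, xs). x # xs)"
    by (auto simp: inj_on_def)
  ultimately show ?thesis
    using pmf_map_inj'[of "\<lambda>(x, xs). x # xs" "pair_pmf p (replicate_pmf n p)" "(x, xs)"]
    by (simp add: pmf_pair)
qed

lemma pmf_replicate_bernoulli:
  assumes "0 \<le> e" "e \<le> 1"
  shows "length x = length z \<Longrightarrow>
    pmf (replicate_pmf (length x) (bernoulli_pmf e)) (map2 (\<noteq>) x z) = chan e x z"
proof (induction x z rule: list_induct2)
  case (Cons a x c z)
  then show ?case
    using assms by (simp add: pmf_replicate_Cons del: replicate_pmf.simps)
qed simp

lemma measure_iid_window:
  fixes p :: "'a pmf" and L :: "'b list"
  assumes "distinct L" "length c = length L"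
  shows "measure (PiM UNIV (\<lambda>_. measure_pmf p)) {e. map e L = c} = pmf (replicate_pmf (length L) p) c"
proof -
  define f where "f i = the (map_of (zip L c) i)" for i
  have c: "c = map f L"
    using assms by (intro nth_equalityI) (auto simp: f_def map_of_zip_nth)
  have r: "pmf (replicate_pmf (length L) p) (map f L) = prod_list (map (\<lambda>i. pmf p (f i)) L)" for L
    by (induction L) (simp_all add: pmf_replicate_Cons del: replicate_pmf.simps(2))
  have "{e. map e L = c} = prod_emb UNIV (\<lambda>_. measure_pmf p) (set L) (PiE (set L) (\<lambda>i. {f i}))"
    by (auto simp: c prod_emb_def space_PiM PiE_iff extensional_def)
  then have "emeasure (PiM UNIV (\<lambda>_. measure_pmf p)) {e. map e L = c}
      = (\<Prod>i\<in>set L. emeasure (measure_pmf p) {f i})"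
    by (simp only:) (rule emeasure_PiM_emb, auto simp: measure_pmf.prob_space_axioms)
  also have "\<dots> = ennreal (\<Prod>i\<in>set L. pmf p (f i))"
    by (simp add: emeasure_pmf_single prod_ennreal)
  also have "(\<Prod>i\<in>set L. pmf p (f i)) = prod_list (map (\<lambda>i. pmf p (f i)) L)"
    by (rule prod.distinct_set_conv_list[OF assms(1)])
  finally have "emeasure (PiM UNIV (\<lambda>_. measure_pmf p)) {e. map e L = c}
      = ennreal (prod_list (map (\<lambda>i. pmf p (f i)) L))" .
  moreover have "0 \<le> prod_list (map (\<lambda>i. pmf p (f i)) L)"
    by (simp flip: r)
  ultimately have "measure (PiM UNIV (\<lambda>_. measure_pmf p)) {e. map e L = c}
      = prod_list (map (\<lambda>i. pmf p (f i)) L)"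
    by (simp add: measure_def)
  then show ?thesis
    by (simp add: c r)
qed

lemma map_neq_iff:
  "map (\<lambda>i. x i \<noteq> e i) L = z \<longleftrightarrow> length z = length L \<and> map e L = map2 (\<noteq>) (map x L) z"
proof (induction L arbitrary: z)
  case (Cons i L)
  then show ?case by (cases z) auto
qed auto

lemma word_prob_bsc_output:
  assumes X: "path_measure X" and e: "0 \<le> e" "e \<le> 1"
  shows "path_measure (bsc_output e X)" "word_prob (bsc_output e X) = noisy e (word_prob X)"
proof -
  interpret X: path_measure X by fact
  let ?E = "PiM UNIV (\<lambda>_ :: int. measure_pmf (bernoulli_pmf e))"
  interpret E: prob_space ?E
    by (rule prob_space_PiM) (rule measure_pmf.prob_space_axioms)
  interpret XE: pair_prob_space X ?E ..
  have sE: "sets ?E = sets path_space"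
    unfolding path_space_def by (rule sets_PiM_cong) auto
  have spE [simp]: "space ?E = UNIV"
    by (simp add: space_PiM)
  have m1: "(\<lambda>x. x i) \<in> measurable X (count_space UNIV)" for i
    using measurable_compose[OF X.measurable_window[of "[i]"], of hd "count_space UNIV"] by simp
  have m2: "(\<lambda>x. x i) \<in> measurable ?E (count_space UNIV)" for i
    using measurable_compose[OF measurable_window_path[of "[i]"], of hd "count_space UNIV"]
    unfolding measurable_cong_sets[OF sE refl] by simp
  have meas: "(\<lambda>(x, e) i. x i \<noteq> e i) \<in> measurable (X \<Otimes>\<^sub>M ?E) path_space"
    unfolding path_space_def
  proof (rule measurable_PiM_single')
    fix i :: int
    have "(\<lambda>p. fst p i) \<in> measurable (X \<Otimes>\<^sub>M ?E) (count_space UNIV)"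
      "(\<lambda>p. snd p i) \<in> measurable (X \<Otimes>\<^sub>M ?E) (count_space UNIV)"
      using measurable_compose[OF measurable_fst m1] measurable_compose[OF measurable_snd m2] by auto
    then have "(\<lambda>p. fst p i \<noteq> snd p i) \<in> measurable (X \<Otimes>\<^sub>M ?E) (count_space UNIV)"
      by measurable
    then show "(\<lambda>p. (case p of (x, e) \<Rightarrow> \<lambda>i. x i \<noteq> e i) i) \<in> measurable (X \<Otimes>\<^sub>M ?E) (count_space UNIV)"
      by (simp add: case_prod_beta')
  qed (auto simp: space_PiM)
  show PZ: "path_measure (bsc_output e X)"
    unfolding path_measure_def path_measure_axioms_def bsc_output_def
    using XE.prob_space_distr[OF meas] by simp
  show "word_prob (bsc_output e X) = noisy e (word_prob X)"
  proof
    fix z :: "bool list"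
    let ?L = "[1 - int (length z)..0]"
    have lL: "length ?L = length z" by simp
    have wE: "{w. map w ?L = c} \<in> sets ?E" for c :: "bool list"
      using measurable_sets[OF measurable_window_path[of ?L], of "{c}"] sE by (simp add: vimage_def)
    \<comment> \<open>Once the input word \<open>u\<close> is fixed, the output \<open>z\<close>
      determines the noise word as their letterwise sum modulo 2.\<close>
    have ev: "(\<lambda>(x, e) i. x i \<noteq> e i) -` {y. map y ?L = z} \<inter> space (X \<Otimes>\<^sub>M ?E)
        = (\<Union>u\<in>words (length z). {x. map x ?L = u} \<times> {w. map w ?L = map2 (\<noteq>) u z})"
    proof (rule set_eqI)
      fix p :: "(int \<Rightarrow> bool) \<times> (int \<Rightarrow> bool)"
      obtain x w where p: "p = (x, w)" by (cases p)
      show "p \<in> (\<lambda>(x, e) i. x i \<noteq> e i) -` {y. map y ?L = z} \<inter> space (X \<Otimes>\<^sub>M ?E)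
        \<longleftrightarrow> p \<in> (\<Union>u\<in>words (length z). {x. map x ?L = u} \<times> {w. map w ?L = map2 (\<noteq>) u z})"
        using map_neq_iff[of x w ?L z] by (auto simp: p space_pair_measure)
    qed
    have "word_prob (bsc_output e X) z
        = measure (X \<Otimes>\<^sub>M ?E) ((\<lambda>(x, e) i. x i \<noteq> e i) -` {y. map y ?L = z} \<inter> space (X \<Otimes>\<^sub>M ?E))"
    proof -
      have "{y. map y ?L = z} \<in> sets path_space"
        using measurable_sets[OF measurable_window_path[of ?L], of "{z}"] by (simp add: vimage_def)
      from measure_distr[OF meas this] show ?thesis
        by (simp add: path_measure.word_prob_eq_window[OF PZ] window_prob_def) (simp add: bsc_output_def)
    qed
    also have "\<dots> = (\<Sum>u\<in>words (length z). measure (X \<Otimes>\<^sub>M ?E)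
        ({x. map x ?L = u} \<times> {w. map w ?L = map2 (\<noteq>) u z}))"
      unfolding ev using wE
      by (intro XE.finite_measure_finite_Union) (auto simp: disjoint_family_on_def)
    also have "\<dots> = (\<Sum>u\<in>words (length z). word_prob X u * chan e u z)"
    proof (intro sum.cong refl)
      fix u assume u: "u \<in> words (length z)"
      have "emeasure (X \<Otimes>\<^sub>M ?E) ({x. map x ?L = u} \<times> {w. map w ?L = map2 (\<noteq>) u z})
          = emeasure X {x. map x ?L = u} * emeasure ?E {w. map w ?L = map2 (\<noteq>) u z}"
        by (intro E.emeasure_pair_measure_Times wE X.sets_window)
      then have "measure (X \<Otimes>\<^sub>M ?E) ({x. map x ?L = u} \<times> {w. map w ?L = map2 (\<noteq>) u z})
          = measure X {x. map x ?L = u} * measure ?E {w. map w ?L = map2 (\<noteq>) u z}"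
        by (simp add: measure_def enn2real_mult)
      also have "measure ?E {w. map w ?L = map2 (\<noteq>) u z} = chan e u z"
        using measure_iid_window[of ?L "map2 (\<noteq>) u z" "bernoulli_pmf e"] u
          pmf_replicate_bernoulli[OF e, of u z] by simp
      finally show "measure (X \<Otimes>\<^sub>M ?E) ({x. map x ?L = u} \<times> {w. map w ?L = map2 (\<noteq>) u z})
          = word_prob X u * chan e u z"
        using u by (simp add: X.word_prob_eq_window window_prob_def)
    qed
    finally show "word_prob (bsc_output e X) z = noisy e (word_prob X) z"
      by (simp add: noisy_def)
  qed
qed

definition block_entropy :: "(bool list \<Rightarrow> real) \<Rightarrow> nat \<Rightarrow> real" where
  "block_entropy q n = - (\<Sum>u\<in>words n. q u * ln (q u))"

lemma entropy_rate_eq_lim: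
  assumes "path_measure X"
  shows "entropy_rate X = lim (\<lambda>n. block_entropy (word_prob X) (Suc n) / real (Suc n))"
  unfolding entropy_rate_def path_measure.shannon_entropy_window[OF assms] block_entropy_def by simp

text \<open>The entropy of the output given the input is an average of values that are all equal by
  \<open>sum_chan_ln_chan\<close>. Maximising the information is therefore maximising the output
  entropy.\<close>

lemma bsc_information_eq:
  assumes p: "\<forall>u\<in>set_pmf p. length u = n + 1" and e: "0 \<le> e" "e < 1"
  shows "bsc_information e n p
    = block_entropy (noisy e (pmf p)) (Suc n) - real (Suc n) * binary_entropy e"
proof -
  let ?N = "Suc n" and ?b = "bernoulli_pmf e"
  let ?J = "bsc_block e n p" and ?Z = "\<lambda>(x, e). map2 (\<noteq>) x e :: bool list"
  have setJ: "set_pmf ?J \<subseteq> words ?N \<times> words ?N"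
    using p by (auto simp: bsc_block_def set_replicate_pmf)
  then have finJ: "finite (set_pmf ?J)" by (rule finite_subset) simp
  have pz: "pmf p x = 0" if "length x \<noteq> ?N" for x
    using that p by (auto simp: pmf_eq_0_set_pmf)
  have joint: "pmf (map_pmf (\<lambda>j. (?Z j, fst j)) ?J) (z, x) = pmf p x * chan e x z"
    if "length x = ?N" "length z = ?N" for x z
  proof -
    let ?h = "\<lambda>j. (?Z j, fst j)" and ?y = "map2 (\<noteq>) x z"
    \<comment> \<open>Input and output together determine the noise, so the joint law of output and
      input is a relabelling of the product law.\<close>
    have inj: "inj_on ?h (words ?N \<times> words ?N)"
    proof (rule inj_onI)
      fix j j' assume j: "j \<in> words ?N \<times> words ?N" "j' \<in> words ?N \<times> words ?N" and eq: "?h j = ?h j'"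
      obtain a b a' b' where jj: "j = (a, b)" "j' = (a', b')" by (cases j, cases j')
      have "b = b'" using j eq unfolding jj by (auto simp: list_eq_iff_nth_eq)
      then show "j = j'" using eq jj by simp
    qed
    have hy: "?h (x, ?y) = (z, x)"
      using that by (auto simp: list_eq_iff_nth_eq)
    have "pmf (map_pmf ?h ?J) (?h (x, ?y)) = pmf ?J (x, ?y)"
    proof (cases "(x, ?y) \<in> set_pmf ?J")
      case True
      then show ?thesis using inj setJ by (intro pmf_map_inj) (auto intro: inj_on_subset)
    next
      case False
      have "?h (x, ?y) \<notin> ?h ` set_pmf ?J"
      proof
        assume "?h (x, ?y) \<in> ?h ` set_pmf ?J"
        then obtain j where j: "j \<in> set_pmf ?J" "?h (x, ?y) = ?h j" by blast
        have "(x, ?y) = j"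
          by (rule inj_onD[OF inj j(2)]) (use that j(1) setJ in auto)
        with j(1) False show False by simp
      qed
      then have "pmf (map_pmf ?h ?J) (?h (x, ?y)) = 0"
        by (simp only: pmf_eq_0_set_pmf set_map_pmf not_False_eq_True)
      moreover have "pmf ?J (x, ?y) = 0"
        using False by (simp add: pmf_eq_0_set_pmf)
      ultimately show ?thesis by simp
    qed
    also have "\<dots> = pmf p x * chan e x z"
      using pmf_replicate_bernoulli[of e x z] that e
      by (simp add: bsc_block_def pmf_pair del: replicate_pmf.simps)
    finally show ?thesis unfolding hy .
  qed
  have Zout: "\<P>(j in measure_pmf ?J. ?Z j = z) = noisy e (pmf p) z" if z: "length z = ?N" for z
  proof -
    have "\<P>(j in measure_pmf ?J. ?Z j = z) = measure (measure_pmf (map_pmf (\<lambda>j. (?Z j, fst j)) ?J)) ({z} \<times> words ?N)"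
    proof -
      have "\<P>(j in measure_pmf ?J. ?Z j = z) = measure (measure_pmf ?J) ((\<lambda>j. (?Z j, fst j)) -` ({z} \<times> words ?N))"
        by (rule measure_pmf.finite_measure_eq_AE) (use setJ in \<open>auto simp: AE_measure_pmf_iff\<close>)
      then show ?thesis by (simp add: measure_map_pmf)
    qed
    also have "\<dots> = (\<Sum>j\<in>{z} \<times> words ?N. pmf (map_pmf (\<lambda>j. (?Z j, fst j)) ?J) j)"
      by (rule measure_measure_pmf_finite) simp
    also have "\<dots> = (\<Sum>x\<in>words ?N. pmf (map_pmf (\<lambda>j. (?Z j, fst j)) ?J) (z, x))"
    proof -
      have "{z} \<times> words ?N = Pair z ` words ?N" by auto
      then show ?thesis by (simp only:) (subst sum.reindex, auto simp: inj_on_def)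
    qed
    also have "\<dots> = noisy e (pmf p) z"
      unfolding noisy_def using z joint by (intro sum.cong) auto
    finally show ?thesis .
  qed
  have "shannon_entropy (measure_pmf ?J) ?Z
      = - (\<Sum>a\<in>words ?N. \<P>(j in measure_pmf ?J. ?Z j = a) * ln (\<P>(j in measure_pmf ?J. ?Z j = a)))"
    by (rule shannon_entropy_eq_sum)
       (use setJ in \<open>auto simp: AE_measure_pmf_iff measure_pmf.prob_space_axioms\<close>)
  then have H: "shannon_entropy (measure_pmf ?J) ?Z = block_entropy (noisy e (pmf p)) ?N"
    using Zout by (simp add: block_entropy_def)
  have fstJ: "map_pmf fst ?J = p"
    by (simp add: bsc_block_def map_fst_pair_pmf)
  have "shannon_cond_entropy (measure_pmf ?J) ?Z fst
      = - (\<Sum>(z, x) \<in> (\<lambda>j. (?Z j, fst j)) ` set_pmf ?J.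
            pmf (map_pmf (\<lambda>j. (?Z j, fst j)) ?J) (z, x) *
            ln (pmf (map_pmf (\<lambda>j. (?Z j, fst j)) ?J) (z, x) / pmf p x))"
    unfolding shannon_cond_entropy_pmf_eq_sum[OF finJ] fstJ ..
  also have "(\<Sum>(z, x) \<in> (\<lambda>j. (?Z j, fst j)) ` set_pmf ?J.
            pmf (map_pmf (\<lambda>j. (?Z j, fst j)) ?J) (z, x) *
            ln (pmf (map_pmf (\<lambda>j. (?Z j, fst j)) ?J) (z, x) / pmf p x))
      = (\<Sum>(z, x) \<in> words ?N \<times> words ?N. pmf p x * chan e x z * ln (pmf p x * chan e x z / pmf p x))"
  proof (rule sum.mono_neutral_cong_left)
    show "(\<lambda>j. (?Z j, fst j)) ` set_pmf ?J \<subseteq> words ?N \<times> words ?N"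
      using setJ by auto
    show "\<forall>i\<in>words ?N \<times> words ?N - (\<lambda>j. (?Z j, fst j)) ` set_pmf ?J.
       (case i of (z, x) \<Rightarrow> pmf p x * chan e x z * ln (pmf p x * chan e x z / pmf p x)) = 0"
    proof
      fix i assume i: "i \<in> words ?N \<times> words ?N - (\<lambda>j. (?Z j, fst j)) ` set_pmf ?J"
      obtain z x where zx: "i = (z, x)" by (cases i)
      have "pmf (map_pmf (\<lambda>j. (?Z j, fst j)) ?J) (z, x) = 0"
        using i zx by (simp only: pmf_eq_0_set_pmf set_map_pmf) simp
      then have "pmf p x * chan e x z = 0" using joint i zx by simp
      then show "(case i of (z, x) \<Rightarrow> pmf p x * chan e x z * ln (pmf p x * chan e x z / pmf p x)) = 0"
        by (simp add: zx)
    qed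
    fix i assume "i \<in> (\<lambda>j. (?Z j, fst j)) ` set_pmf ?J"
    then have "i \<in> words ?N \<times> words ?N" using setJ by auto
    then show "(case i of (z, x) \<Rightarrow> pmf (map_pmf (\<lambda>j. (?Z j, fst j)) ?J) (z, x) *
            ln (pmf (map_pmf (\<lambda>j. (?Z j, fst j)) ?J) (z, x) / pmf p x))
        = (case i of (z, x) \<Rightarrow> pmf p x * chan e x z * ln (pmf p x * chan e x z / pmf p x))"
      using joint by auto
  qed simp
  also have "\<dots> = (\<Sum>x\<in>words ?N. \<Sum>z\<in>words ?N. pmf p x * (chan e x z * ln (chan e x z)))"
    unfolding sum.cartesian_product[symmetric]
    by (subst sum.swap) (intro sum.cong refl, auto)
  also have "\<dots> = (\<Sum>x\<in>words ?N. pmf p x * (- real ?N * binary_entropy e))"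
  proof (intro sum.cong refl)
    fix x assume "x \<in> words ?N"
    then show "(\<Sum>z\<in>words ?N. pmf p x * (chan e x z * ln (chan e x z))) = pmf p x * (- real ?N * binary_entropy e)"
      using sum_chan_ln_chan[OF e, of x] by (simp add: sum_distrib_left[symmetric])
  qed
  also have "\<dots> = (\<Sum>x\<in>words ?N. pmf p x) * (- real ?N * binary_entropy e)"
    by (simp only: sum_distrib_right)
  also have "(\<Sum>x\<in>words ?N. pmf p x) = 1"
    by (rule sum_pmf_eq_1) (use p in auto)
  finally have "shannon_cond_entropy (measure_pmf ?J) ?Z fst = real ?N * binary_entropy e"
    by (simp add: algebra_simps)
  with H show ?thesis by (simp add: bsc_information_def)
qed

section \<open>Processes with prescribed word probabilities\<close>

text \<open>Every finite set of times lies in a centred window, so the laws of these windows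
  determine all cylinder probabilities.\<close>

lemma path_measure_eqI:
  assumes X: "path_measure X" and Y: "path_measure Y"
    and eq: "\<And>N u. window_prob X [- int N..int N] u = window_prob Y [- int N..int N] u"
  shows "X = Y"
proof -
  interpret X: path_measure X by fact
  interpret Y: path_measure Y by fact
  show ?thesis
  proof (rule measure_eqI_PiM_infinite[where I = UNIV and M = "\<lambda>_. count_space UNIV"])
    fix A :: "int \<Rightarrow> bool set" and J :: "int set"
    assume J: "finite J"
    define N where "N = nat (Max (insert 0 (abs ` J)))"
    have N: "\<bar>i\<bar> \<le> int N" if "i \<in> J" for i
      using that J Max_ge[of "insert 0 (abs ` J)" "\<bar>i\<bar>"] by (auto simp: N_def)
    define U where "U = {u \<in> words (2 * N + 1). \<forall>i\<in>J. u ! nat (i + int N) \<in> A i}"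
    have U: "finite U" unfolding U_def by (rule finite_subset[of _ "words (2 * N + 1)"]) auto
    have nth: "map x [- int N..int N] ! nat (i + int N) = x i" if "i \<in> J" for x :: "int \<Rightarrow> bool" and i
    proof -
      have "[- int N..int N] ! nat (i + int N) = i"
        using N[OF that] by (subst nth_upto) auto
      then show ?thesis
        using N[OF that] by (subst nth_map) (auto simp: nat_less_iff)
    qed
    have ev: "prod_emb UNIV (\<lambda>_. count_space UNIV) J (PiE J A) = (\<Union>u\<in>U. {x. map x [- int N..int N] = u})"
      by (auto simp: prod_emb_def space_PiM PiE_iff U_def nth simp del: nth_map)
    have "measure Z (\<Union>u\<in>U. {x. map x [- int N..int N] = u}) = (\<Sum>u\<in>U. window_prob Z [- int N..int N] u)"
      if Z: "path_measure Z" for Z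
    proof -
      interpret Z: path_measure Z by fact
      show ?thesis
        unfolding window_prob_def
        by (rule Z.finite_measure_finite_Union[OF U]) (auto simp: disjoint_family_on_def)
    qed
    then show "emeasure X (prod_emb UNIV (\<lambda>_. count_space UNIV) J (PiE J A))
        = emeasure Y (prod_emb UNIV (\<lambda>_. count_space UNIV) J (PiE J A))"
      unfolding ev X.emeasure_eq_measure Y.emeasure_eq_measure using X Y eq by simp
  qed (auto simp: X.sets_X Y.sets_X path_space_def intro: X.finite_measure_axioms)
qed

definition block_pmf :: "(bool list \<Rightarrow> real) \<Rightarrow> nat \<Rightarrow> bool list pmf" where
  "block_pmf q k = embed_pmf (\<lambda>u. if length u = k then q u else 0)"

context
  fixes q :: "bool list \<Rightarrow> real"
  assumes q: "word_law q"
begin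

lemma pmf_block_pmf: "pmf (block_pmf q k) u = (if length u = k then q u else 0)"
  unfolding block_pmf_def
proof (rule pmf_embed_pmf)
  have "(\<integral>\<^sup>+ u. ennreal (if length u = k then q u else 0) \<partial>count_space UNIV)
      = (\<Sum>u\<in>words k. ennreal (if length u = k then q u else 0))"
    by (rule nn_integral_count_space') auto
  also have "\<dots> = ennreal (\<Sum>u\<in>words k. q u)"
    using word_lawD(1)[OF q] by (subst sum_ennreal[symmetric]) (auto intro!: sum.cong)
  finally show "(\<integral>\<^sup>+ u. ennreal (if length u = k then q u else 0) \<partial>count_space UNIV) = 1"
    by (simp add: word_law_sum[OF q])
qed (simp add: word_lawD(1)[OF q])

lemma set_block_pmf: "set_pmf (block_pmf q k) \<subseteq> words k"
  by (auto simp: set_pmf_eq pmf_block_pmf split: if_splits)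

lemma length_block_pmf: "u \<in> set_pmf (block_pmf q k) \<Longrightarrow> length u = k"
  by (metis set_block_pmf subsetD in_words)

lemma map_drop_block_pmf: "map_pmf (drop i) (block_pmf q (i + k)) = block_pmf q k"
proof (rule pmf_eqI)
  fix u
  have "pmf (map_pmf (drop i) (block_pmf q (i + k))) u = measure (block_pmf q (i + k)) (drop i -` {u})"
    by (simp add: pmf_map)
  also have "\<dots> = measure (block_pmf q (i + k)) (if length u = k then (\<lambda>x. x @ u) ` words i else {})"
  proof (rule measure_pmf.finite_measure_eq_AE)
    have "x \<in> (\<lambda>x. x @ u) ` words i" if "length x = i + k" "drop i x = u" for x
      using that by (intro image_eqI[of _ _ "take i x"]) auto
    then show "AE x in block_pmf q (i + k).
        (x \<in> drop i -` {u}) = (x \<in> (if length u = k then (\<lambda>x. x @ u) ` words i else {}))"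
      by (auto simp: AE_measure_pmf_iff dest!: length_block_pmf)
  qed auto
  also have "\<dots> = pmf (block_pmf q k) u"
    by (auto simp: measure_measure_pmf_finite sum.reindex inj_on_def pmf_block_pmf word_law_sum_left[OF q])
  finally show "pmf (map_pmf (drop i) (block_pmf q (i + k))) u = pmf (block_pmf q k) u" .
qed

lemma map_take_block_pmf: "map_pmf (take k) (block_pmf q (k + j)) = block_pmf q k"
proof (rule pmf_eqI)
  fix u
  have "pmf (map_pmf (take k) (block_pmf q (k + j))) u = measure (block_pmf q (k + j)) (take k -` {u})"
    by (simp add: pmf_map)
  also have "\<dots> = measure (block_pmf q (k + j)) (if length u = k then (\<lambda>x. u @ x) ` words j else {})"
  proof (rule measure_pmf.finite_measure_eq_AE)
    have "x \<in> (\<lambda>x. u @ x) ` words j" if "length x = k + j" "take k x = u" for x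
      using that by (intro image_eqI[of _ _ "drop k x"]) auto
    then show "AE x in block_pmf q (k + j).
        (x \<in> take k -` {u}) = (x \<in> (if length u = k then (\<lambda>x. u @ x) ` words j else {}))"
      by (auto simp: AE_measure_pmf_iff dest!: length_block_pmf)
  qed auto
  also have "\<dots> = pmf (block_pmf q k) u"
    by (auto simp: measure_measure_pmf_finite sum.reindex inj_on_def pmf_block_pmf word_law_sum_right[OF q])
  finally show "pmf (map_pmf (take k) (block_pmf q (k + j))) u = pmf (block_pmf q k) u" .
qed

lemma map_slice_block_pmf:
  "i + k \<le> n \<Longrightarrow> map_pmf (\<lambda>u. take k (drop i u)) (block_pmf q n) = block_pmf q k"
proof -
  assume "i + k \<le> n"
  then obtain j where n: "n = i + (k + j)" by (metis le_iff_add add.assoc)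
  have "map_pmf (\<lambda>u. take k (drop i u)) (block_pmf q n) = map_pmf (take k) (map_pmf (drop i) (block_pmf q n))"
    by (simp add: map_pmf_comp)
  then show ?thesis
    by (simp add: n map_drop_block_pmf map_take_block_pmf)
qed

text \<open>Position \<open>N\<close> of the word is time 0. Letters are wrapped in
  \<open>discrete\<close> because the Kolmogorov extension of \<open>polish_projective\<close> is
  formulated for Polish spaces.\<close>

definition centered_path :: "nat \<Rightarrow> bool list \<Rightarrow> int \<Rightarrow> bool discrete" where
  "centered_path N u i = discrete (u ! nat (i + int N))"

definition path_law :: "nat \<Rightarrow> (int \<Rightarrow> bool discrete) pmf" where
  "path_law N = map_pmf (centered_path N) (block_pmf q (2 * N + 1))"

text \<open>The central slice of length \<open>2 * N + 1\<close> of a longer block has the law of a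
  block of that length, because letters can be summed out at both ends.\<close>

lemma path_law_restrict:
  assumes J: "J \<subseteq> {- int N..int N}" and NM: "N \<le> M"
  shows "map_pmf (\<lambda>x. restrict x J) (path_law M) = map_pmf (\<lambda>x. restrict x J) (path_law N)"
proof -
  have "map_pmf (\<lambda>x. restrict x J) (path_law N)
      = map_pmf (\<lambda>u. restrict (centered_path N u) J)
          (map_pmf (\<lambda>u. take (2 * N + 1) (drop (M - N) u)) (block_pmf q (2 * M + 1)))"
    using NM by (subst map_slice_block_pmf) (auto simp: path_law_def map_pmf_comp)
  also have "\<dots> = map_pmf (\<lambda>u. restrict (centered_path M u) J) (block_pmf q (2 * M + 1))"
    unfolding map_pmf_comp
  proof (rule map_pmf_cong[OF refl])
    fix u assume "u \<in> set_pmf (block_pmf q (2 * M + 1))"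
    then have l: "length u = 2 * M + 1" by (rule length_block_pmf)
    have "take (2 * N + 1) (drop (M - N) u) ! nat (i + int N) = u ! nat (i + int M)" if "i \<in> J" for i
    proof -
      have "- int N \<le> i" "i \<le> int N" using that J by auto
      then have "nat (i + int N) < 2 * N + 1" "M - N + nat (i + int N) = nat (i + int M)"
        using NM by auto
      then show ?thesis using l NM by (simp add: nth_drop)
    qed
    then show "restrict (centered_path N (take (2 * N + 1) (drop (M - N) u))) J
        = restrict (centered_path M u) J"
      by (auto simp: centered_path_def restrict_def)
  qed
  also have "\<dots> = map_pmf (\<lambda>x. restrict x J) (path_law M)"
    by (simp add: path_law_def map_pmf_comp)
  finally show ?thesis ..
qed

definition radius :: "int set \<Rightarrow> nat" where
  "radius J = nat (Max (insert 0 (abs ` J)))"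

lemma radius_subset: "finite J \<Longrightarrow> J \<subseteq> {- int (radius J)..int (radius J)}"
proof
  fix i assume J: "finite J" and i: "i \<in> J"
  have "\<bar>i\<bar> \<le> Max (insert 0 (abs ` J))" using J i by (intro Max_ge) auto
  then show "i \<in> {- int (radius J)..int (radius J)}" by (auto simp: radius_def)
qed

lemma radius_mono: "J \<subseteq> H \<Longrightarrow> finite H \<Longrightarrow> radius J \<le> radius H"
  unfolding radius_def by (intro nat_mono Max_mono) auto

text \<open>The finite-dimensional law at the times \<open>J\<close>, read off in the smallest
  centred window containing \<open>J\<close>; by \<open>fdd_eq\<close> any larger window gives the
  same law.\<close>

definition fdd :: "int set \<Rightarrow> (int \<Rightarrow> bool discrete) measure" where
  "fdd J = distr (measure_pmf (path_law (radius J))) (PiM J (\<lambda>_. borel)) (\<lambda>x. restrict x J)"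

lemma restrict_path_measurable [measurable]:
  "(\<lambda>x. restrict x J) \<in> measurable (measure_pmf p) (PiM J (\<lambda>_. borel :: bool discrete measure))"
  by (auto simp: measurable_def space_PiM)

lemma fdd_eq:
  assumes "finite J" "radius J \<le> M"
  shows "fdd J = distr (measure_pmf (path_law M)) (PiM J (\<lambda>_. borel)) (\<lambda>x. restrict x J)"
proof -
  have *: "distr (measure_pmf (path_law N)) (PiM J (\<lambda>_. borel)) (\<lambda>x. restrict x J)
     = distr (measure_pmf (map_pmf (\<lambda>x. restrict x J) (path_law N))) (PiM J (\<lambda>_. borel)) (\<lambda>x. restrict x J)"
    for N
    by (subst map_pmf_rep_eq) (subst distr_distr, auto simp: o_def measurable_def space_PiM)
  show ?thesis
    unfolding fdd_def *[of "radius J"] *[of M]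
    using path_law_restrict[OF radius_subset[OF assms(1)] assms(2)] by simp
qed

lemma polish_projective_fdd: "polish_projective UNIV fdd"
  unfolding polish_projective_def
proof (rule projective_family.intro)
  fix J H :: "int set" assume JH: "J \<subseteq> H" "finite H"
  have "distr (fdd H) (PiM J (\<lambda>_. borel)) (\<lambda>f. restrict f J)
      = distr (measure_pmf (path_law (radius H))) (PiM J (\<lambda>_. borel)) ((\<lambda>f. restrict f J) \<circ> (\<lambda>x. restrict x H))"
    unfolding fdd_def using JH by (intro distr_distr measurable_restrict_subset restrict_path_measurable)
  also have "(\<lambda>f. restrict f J) \<circ> (\<lambda>x. restrict x H) = (\<lambda>x :: int \<Rightarrow> bool discrete. restrict x J)"
    using JH by (auto simp: fun_eq_iff restrict_def)
  finally have *: "distr (fdd H) (PiM J (\<lambda>_. borel)) (\<lambda>f. restrict f J)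
      = distr (measure_pmf (path_law (radius H))) (PiM J (\<lambda>_. borel)) (\<lambda>x. restrict x J)" .
  show "fdd J = distr (fdd H) (PiM J (\<lambda>_. borel)) (\<lambda>f. restrict f J)"
    by (rule trans[OF fdd_eq[OF finite_subset[OF JH] radius_mono[OF JH]] *[symmetric]])
next
  fix J :: "int set" assume "finite J"
  show "prob_space (fdd J)"
    unfolding fdd_def by (intro measure_pmf.prob_space_distr restrict_path_measurable)
qed

lemma path_law_window:
  assumes "set [a..b] \<subseteq> {- int N..int N}"
  shows "map_pmf (\<lambda>x. map (\<lambda>i. of_discrete (x i)) [a..b]) (path_law N) = block_pmf q (length [a..b])"
proof (cases "a \<le> b")
  case True
  with assms have ab: "- int N \<le> a" "b \<le> int N" by auto
  let ?k = "length [a..b]"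
  have "map_pmf (\<lambda>x. map (\<lambda>i. of_discrete (x i)) [a..b]) (path_law N)
      = map_pmf (\<lambda>u. take ?k (drop (nat (a + int N)) u)) (block_pmf q (2 * N + 1))"
    unfolding path_law_def map_pmf_comp
  proof (rule map_pmf_cong[OF refl])
    fix u assume "u \<in> set_pmf (block_pmf q (2 * N + 1))"
    then have l: "length u = 2 * N + 1" by (rule length_block_pmf)
    have "u ! nat (a + int j + int N) = u ! (nat (a + int N) + j)" for j
      using ab True by (intro arg_cong[where f = "(!) u"]) auto
    then show "map (\<lambda>i. of_discrete (centered_path N u i)) [a..b] = take ?k (drop (nat (a + int N)) u)"
      using l ab True by (intro nth_equalityI) (auto simp: centered_path_def discrete_inverse)
  qed
  also have "\<dots> = block_pmf q ?k"
    using ab True by (intro map_slice_block_pmf) auto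
  finally show ?thesis .
next
  case False
  have "map_pmf (\<lambda>_. []) p = block_pmf q 0" for p :: "(int \<Rightarrow> bool discrete) pmf"
  proof (rule pmf_eqI)
    fix u :: "bool list"
    show "pmf (map_pmf (\<lambda>_. []) p) u = pmf (block_pmf q 0) u"
      using word_lawD(2)[OF q] by (simp add: pmf_block_pmf map_pmf_const)
  qed
  then show ?thesis using False by simp
qed

text \<open>Maximality of the chain is a statement about processes, whereas its perturbations are
  built as families of word probabilities. Kolmogorov extension turns them into processes.\<close>

theorem stationary_process_of_word_law: "\<exists>X. stationary_process X \<and> word_prob X = q"
proof -
  interpret P: polish_projective UNIV fdd by (rule polish_projective_fdd)
  let ?g = "\<lambda>x i. of_discrete (x i) :: bool"
  have od: "of_discrete \<in> measurable (borel :: bool discrete measure) (count_space UNIV)"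
    by (rule measurableI) (auto intro: borel_open open_discrete)
  have g: "?g \<in> measurable P.lim path_space"
    unfolding path_space_def
  proof (rule measurable_PiM_single')
    fix i :: int
    have "(\<lambda>x. x i) \<in> measurable P.lim (borel :: bool discrete measure)"
      using measurable_component_singleton[of i UNIV "\<lambda>_. borel :: bool discrete measure"]
        measurable_cong_sets[OF P.sets_lim refl] by blast
    then show "(\<lambda>x. of_discrete (x i)) \<in> measurable P.lim (count_space UNIV)"
      by (rule measurable_compose[OF _ od])
  qed auto
  define X where "X = distr P.lim path_space ?g"
  have PX: "path_measure X"
    unfolding path_measure_def path_measure_axioms_def X_def using P.P.prob_space_distr[OF g] by simp
  interpret X: path_measure X by fact
  \<comment> \<open>The value does not depend on the position of the window, which is
    stationarity.\<close>
  have win: "window_prob X [a..b] u = q u" if u: "length u = length [a..b]" for a b u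
  proof -
    let ?L = "[a..b]" and ?J = "{a..b}"
    define f where "f i = u ! nat (i - a)" for i
    have uf: "u = map f ?L"
      using u by (intro nth_equalityI) (auto simp: f_def)
    let ?B = "PiE ?J (\<lambda>i. {discrete (f i)})"
    have B: "?B \<in> sets (PiM ?J (\<lambda>_. borel))"
      by (intro sets_PiM_I_finite) (auto intro!: borel_closed)
    have dsc: "of_discrete y = c \<longleftrightarrow> y = discrete c" for y :: "bool discrete" and c
    proof
      assume "of_discrete y = c"
      then have "discrete (of_discrete y) = discrete c" by simp
      then show "y = discrete c" by (simp add: of_discrete_inverse)
    qed (simp add: discrete_inverse)
    have ev: "?g -` {x. map x ?L = u} \<inter> space P.lim = prod_emb UNIV (\<lambda>_. borel) ?J ?B"
      by (auto simp: uf prod_emb_def space_PiM PiE_iff extensional_def dsc)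
    have "window_prob X ?L u = measure P.lim (?g -` {x. map x ?L = u} \<inter> space P.lim)"
      unfolding X_def window_prob_def
      using X.sets_window X.sets_X by (intro measure_distr[OF g]) auto
    also have "\<dots> = measure (fdd ?J) ?B"
      unfolding ev by (rule P.measure_lim_emb) (auto simp: B)
    also have "\<dots> = measure (path_law (radius ?J)) ((\<lambda>x. restrict x ?J) -` ?B \<inter> space (measure_pmf (path_law (radius ?J))))"
      unfolding fdd_def using B by (intro measure_distr restrict_path_measurable)
    also have "(\<lambda>x. restrict x ?J) -` ?B \<inter> space (measure_pmf (path_law (radius ?J)))
        = (\<lambda>x. map (\<lambda>i. of_discrete (x i)) ?L) -` {u}"
      by (auto simp: uf PiE_iff dsc)
    also have "measure (path_law (radius ?J)) \<dots>
        = pmf (map_pmf (\<lambda>x. map (\<lambda>i. of_discrete (x i)) ?L) (path_law (radius ?J))) u"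
      by (simp add: pmf_map)
    also have "\<dots> = q u"
      using radius_subset[of ?J] u by (subst path_law_window) (auto simp: pmf_block_pmf)
    finally show ?thesis .
  qed
  have win0: "window_prob X L u = 0" if "length u \<noteq> length L" for L u
  proof -
    have "{x. map x L = u} = {}" using that by auto
    then show ?thesis by (simp add: window_prob_def)
  qed
  let ?s = "\<lambda>(x :: int \<Rightarrow> bool) i. x (i + 1)"
  have PY: "path_measure (distr X path_space ?s)"
    unfolding path_measure_def path_measure_axioms_def using X.prob_space_distr[OF X.measurable_shift] by simp
  have "distr X path_space ?s = X"
  proof (rule path_measure_eqI[OF PY PX])
    fix N u
    let ?L = "[- int N..int N]"
    have "window_prob (distr X path_space ?s) ?L u = window_prob X (map ((+) 1) ?L) u"
      using X.window_prob_shift[of ?L u] by (simp add: window_prob_def)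
    also have "\<dots> = window_prob X [- int N + 1..int N + 1] u"
      by (simp only: map_Suc_upto_int)
    also have "\<dots> = window_prob X ?L u"
      using win[of u "- int N + 1" "int N + 1"] win[of u "- int N" "int N"] win0
      by (cases "length u = length ?L") auto
    finally show "window_prob (distr X path_space ?s) ?L u = window_prob X ?L u" .
  qed
  moreover have "word_prob X = q"
    by (rule ext) (simp add: X.word_prob_eq_window win)
  ultimately show ?thesis
    using PX unfolding stationary_process_def path_measure_def path_measure_axioms_def by blast
qed

end

section \<open>Markov extension of a block law\<close>

text \<open>A circulation of total mass 1 on the de Bruijn graph: words of length \<open>m\<close>
  are vertices, words of length \<open>m + 1\<close> are edges. The balance and mass conditions
  concern only these lengths, so values elsewhere are merely nonnegative.\<close>

definition stationary_block :: "nat \<Rightarrow> (bool list \<Rightarrow> real) \<Rightarrow> bool" where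
  "stationary_block m p \<longleftrightarrow> (\<forall>u. 0 \<le> p u) \<and> (\<Sum>u\<in>words (Suc m). p u) = 1 \<and>
     (\<forall>w\<in>words m. right_marginal p w = left_marginal p w)"

lemma stationary_blockD:
  assumes "stationary_block m p"
  shows "0 \<le> p u" "(\<Sum>u\<in>words (Suc m). p u) = 1" "length w = m \<Longrightarrow> right_marginal p w = left_marginal p w"
    "0 \<le> right_marginal p w" "p (w @ [v]) \<le> right_marginal p w" "p (a # w) \<le> left_marginal p w"
  using assms by (auto simp: stationary_block_def right_marginal_def left_marginal_def)
    (cases v; simp; fail | cases a; simp; fail)+

text \<open>Built from the right end by the backward transition probabilities; meaningful only for words
  of length at least \<open>m\<close>.\<close>

primrec backward_law :: "nat \<Rightarrow> (bool list \<Rightarrow> real) \<Rightarrow> bool list \<Rightarrow> real" where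
  "backward_law m p [] = right_marginal p []"
| "backward_law m p (a # u) = (if length u < m then right_marginal p (a # u)
     else p (a # take m u) / right_marginal p (take m u) * backward_law m p u)"

definition markov_extension :: "nat \<Rightarrow> (bool list \<Rightarrow> real) \<Rightarrow> bool list \<Rightarrow> real" where
  "markov_extension m p u = (if length u < m
     then \<Sum>y\<in>words (m - length u). right_marginal p (u @ y) else backward_law m p u)"

context
  fixes m :: nat and p :: "bool list \<Rightarrow> real"
  assumes p: "stationary_block m p"
begin

lemma backward_law_nonneg: "0 \<le> backward_law m p u"
  using stationary_blockD(1,4)[OF p] by (induction u) auto

lemma backward_law_m: "length u = m \<Longrightarrow> backward_law m p u = right_marginal p u"
  by (cases u) auto

text \<open>Where a backward transition probability is the default \<open>0 / 0 = 0\<close>, the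
  weight to be distributed is 0 as well, so no mass is lost in
  \<open>backward_law_left\<close>.\<close>

lemma backward_law_zero:
  assumes "m \<le> length u" "right_marginal p (take m u) = 0"
  shows "backward_law m p u = 0"
proof (cases "length u = m")
  case False
  then obtain a u' where u: "u = a # u'" "m \<le> length u'" using assms(1) by (cases u) auto
  \<comment> \<open>The prefix of length \<open>m + 1\<close> is read once as a letter before a
    state and once as a state before a letter.\<close>
  have "a # take m u' = take m u @ [u ! m]"
    using u take_Suc_conv_app_nth[of m u] by simp
  then have "p (a # take m u') = 0"
    using stationary_blockD(1)[OF p, of "a # take m u'"] stationary_blockD(5)[OF p, of "take m u" "u ! m"] assms(2)
    by simp
  then show ?thesis using u by simp
qed (use assms in \<open>simp add: backward_law_m\<close>)

lemma backward_law_Suc: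
  assumes "length u = Suc m"
  shows "backward_law m p u = p u"
proof -
  obtain a w where u: "u = a # w" "length w = m" using assms by (cases u) auto
  have "right_marginal p w = 0 \<Longrightarrow> p (a # w) = 0"
    using stationary_blockD(1)[OF p, of "a # w"] stationary_blockD(3)[OF p, of w]
      stationary_blockD(6)[OF p, of a w] u by simp
  then show ?thesis using u by (simp add: backward_law_m)
qed

lemma backward_law_right:
  assumes "m \<le> length u"
  shows "backward_law m p (u @ [True]) + backward_law m p (u @ [False]) = backward_law m p u"
  using assms
proof (induction u)
  case Nil
  then show ?case by (simp add: backward_law_Suc right_marginal_def)
next
  case (Cons a u)
  show ?case
  proof (cases "length u < m")
    case True
    then have "length (a # u) = m" using Cons.prems by simp
    then show ?thesis
      using backward_law_Suc[of "(a # u) @ [_]"] backward_law_m[of "a # u"]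
      by (simp add: right_marginal_def del: backward_law.simps append_Cons)
  next
    case False
    let ?c = "p (a # take m u) / right_marginal p (take m u)"
    have "backward_law m p ((a # u) @ [True]) + backward_law m p ((a # u) @ [False])
        = ?c * (backward_law m p (u @ [True]) + backward_law m p (u @ [False]))"
      using False by (simp add: algebra_simps)
    then show ?thesis using Cons.IH False by simp
  qed
qed

lemma backward_law_left:
  assumes "m \<le> length u"
  shows "backward_law m p (True # u) + backward_law m p (False # u) = backward_law m p u"
proof -
  let ?r = "right_marginal p (take m u)"
  have eq: "backward_law m p (True # u) + backward_law m p (False # u)
      = left_marginal p (take m u) / ?r * backward_law m p u"
    using assms by (simp add: left_marginal_def add_divide_distrib distrib_right)
  have "left_marginal p (take m u) = ?r"
    using assms by (simp add: stationary_blockD(3)[OF p])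
  then show ?thesis
    unfolding eq using backward_law_zero[OF assms] by (cases "?r = 0") (auto simp del: backward_law.simps)
qed

lemma backward_law_markov:
  assumes "m \<le> length y"
  shows "backward_law m p (x @ y @ z) * backward_law m p y
    = backward_law m p (x @ y) * backward_law m p (y @ z)"
  using assms by (induction x) auto

lemma markov_extension_ge: "m \<le> length u \<Longrightarrow> markov_extension m p u = backward_law m p u"
  by (simp add: markov_extension_def)

lemma markov_extension_less:
  assumes "length u \<le> m"
  shows "markov_extension m p u = (\<Sum>y\<in>words (m - length u). right_marginal p (u @ y))"
  using assms by (cases "length u = m") (simp_all add: markov_extension_def backward_law_m)

lemma markov_extension_Suc: "length u = Suc m \<Longrightarrow> markov_extension m p u = p u"
  by (simp add: markov_extension_ge backward_law_Suc)

lemma word_law_markov_extension: "word_law (markov_extension m p)"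
  unfolding word_law_def
proof (intro conjI allI ext)
  fix u
  show "0 \<le> markov_extension m p u"
    unfolding markov_extension_def
    using backward_law_nonneg stationary_blockD(4)[OF p] by (auto intro: sum_nonneg)
next
  have "(\<Sum>u\<in>words (Suc m). p u) = (\<Sum>w\<in>words m. right_marginal p w)"
    by (simp add: sum_words_snoc right_marginal_def)
  then show "markov_extension m p [] = 1"
    using stationary_blockD(2)[OF p] by (simp add: markov_extension_less)
next
  fix u
  show "right_marginal (markov_extension m p) u = markov_extension m p u"
  proof (cases "length u < m")
    case True
    then have "m - length u = Suc (m - Suc (length u))" by simp
    then show ?thesis using True
      by (simp add: right_marginal_def[of "markov_extension m p"] markov_extension_less
          sum_words_Cons sum.distrib)
  next
    case False
    then show ?thesis
      by (simp add: right_marginal_def[of "markov_extension m p"] markov_extension_ge backward_law_right)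
  qed
next
  fix u
  show "left_marginal (markov_extension m p) u = markov_extension m p u"
  proof (cases "length u < m")
    case True
    define l where "l = m - Suc (length u)"
    have l: "m - length u = Suc l" using True by (simp add: l_def)
    \<comment> \<open>The balance of the block law replaces the letter summed out on the right by
      one summed out on the left.\<close>
    have "markov_extension m p u = (\<Sum>y\<in>words (Suc l). left_marginal p (u @ y))"
      using True l stationary_blockD(3)[OF p] by (simp add: markov_extension_less)
    also have "\<dots> = (\<Sum>y\<in>words l. right_marginal p (True # u @ y) + right_marginal p (False # u @ y))"
      unfolding sum_words_snoc by (simp add: left_marginal_def right_marginal_def algebra_simps)
    also have "\<dots> = left_marginal (markov_extension m p) u"
      using True l by (simp add: left_marginal_def markov_extension_less l_def sum.distrib)
    finally show ?thesis ..
  next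
    case False
    then show ?thesis
      by (simp add: left_marginal_def[of "markov_extension m p"] markov_extension_ge backward_law_left
          del: backward_law.simps)
  qed
qed

lemma markov_law_extension: "markov_law m (markov_extension m p)"
  unfolding markov_law_def
  using word_law_markov_extension backward_law_markov by (simp add: markov_extension_ge)

end

text \<open>A longer word is allowed exactly when its factors of length \<open>m + 1\<close> are,
  and a shorter one exactly when some extension to that length is. It ensures that perturbed chains
  keep the full support \<open>S\<close>.\<close>

lemma markov_law_support_eq:
  assumes q: "markov_law m q" and q': "markov_law m q'"
    and eq: "\<And>u. length u = Suc m \<Longrightarrow> q u = 0 \<longleftrightarrow> q' u = 0"
  shows "q u = 0 \<longleftrightarrow> q' u = 0"
proof (induction u rule: length_induct)
  case (1 u)
  have short: "r u = 0 \<longleftrightarrow> (\<forall>y\<in>words (Suc m - length u). r (u @ y) = 0)" if "markov_law m r" for r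
  proof -
    note W = markov_law_word_law[OF that]
    show ?thesis
      using word_law_sum_right[OF W, of u "Suc m - length u"] word_lawD(1)[OF W]
        sum_nonneg_eq_0_iff[of "words (Suc m - length u)" "\<lambda>y. r (u @ y)"] by auto
  qed
  show ?case
  proof (cases "length u \<le> Suc m")
    case True
    then show ?thesis
      unfolding short[OF q] short[OF q'] using eq by auto
  next
    case False
    obtain w v where u: "u = w @ [v]" using False by (cases u rule: rev_cases) auto
    define x y where "x = take (length w - m) w" and "y = drop (length w - m) w"
    have w: "w = x @ y" and ly: "length y = m" and lx: "length x \<noteq> 0"
      using False u by (auto simp: x_def y_def)
    \<comment> \<open>The words \<open>w\<close> and \<open>y @ [v]\<close> cover \<open>u\<close>
      and overlap in \<open>y\<close>, which has length \<open>m\<close>.\<close>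
    have long: "r u = 0 \<longleftrightarrow> r w = 0 \<or> r (y @ [v]) = 0" if r: "markov_law m r" for r
    proof -
      have "r (x @ y @ [v]) * r y = r (x @ y) * r (y @ [v])"
        using markov_law_eq[OF r] ly by simp
      then show ?thesis
        using markov_zero_right[OF r, of y x] markov_zero_right[OF r, of "y @ [v]" x] markov_zero_left[OF r, of w "[v]"]
        unfolding u w by auto
    qed
    have "length w < length u" "length (y @ [v]) < length u"
      using u w lx ly by auto
    then show ?thesis
      unfolding long[OF q] long[OF q'] using 1 by blast
  qed
qed


section \<open>Entropy rates\<close>

text \<open>The weight of the context is computed from words of length \<open>n + 1\<close> rather
  than read off as \<open>P (butlast u)\<close>, because \<open>P\<close> may be a block law that is
  meaningful at that length only.\<close>

definition cond_entropy :: "nat \<Rightarrow> (bool list \<Rightarrow> real) \<Rightarrow> real" where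
  "cond_entropy n P = - (\<Sum>u\<in>words (Suc n). P u * ln (P u / right_marginal P (butlast u)))"

lemma block_entropy_nonneg:
  assumes "word_law q"
  shows "0 \<le> block_entropy q n"
proof -
  have "0 \<le> (\<Sum>u\<in>words n. q u * - ln (q u))"
  proof (rule sum_nonneg)
    fix u
    show "0 \<le> q u * - ln (q u)"
    proof (cases "q u = 0")
      case False
      then have "ln (q u) \<le> 0"
        using word_lawD(1)[OF assms, of u] word_law_le_1[OF assms, of u] by simp
      then show ?thesis
        using word_lawD(1)[OF assms, of u] by (intro mult_nonneg_nonneg) auto
    qed simp
  qed
  then show ?thesis by (simp add: block_entropy_def sum_negf)
qed

lemma mult_ln_divide:
  fixes a b :: real
  assumes "0 \<le> a" "a \<le> b"
  shows "a * ln (a / b) = a * ln a - a * ln b"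
  using assms by (cases "a = 0") (auto simp: ln_div algebra_simps)

lemma word_law_butlast:
  assumes "word_law q" "u \<noteq> []"
  shows "q u \<le> q (butlast u)"
  using word_law_mono[OF assms(1), of "[]" "butlast u" "[last u]"] assms(2) by simp

lemma block_entropy_Suc:
  assumes q: "word_law q"
  shows "block_entropy q (Suc n) = block_entropy q n + cond_entropy n q"
proof -
  have "cond_entropy n q = - (\<Sum>u\<in>words (Suc n). q u * ln (q u) - q u * ln (q (butlast u)))"
    unfolding cond_entropy_def word_lawD(5)[OF q]
    by (intro arg_cong[where f = uminus] sum.cong refl mult_ln_divide word_lawD(1)[OF q] word_law_butlast[OF q])
       auto
  also have "\<dots> = block_entropy q (Suc n) + (\<Sum>u\<in>words (Suc n). q u * ln (q (butlast u)))"
    by (simp add: block_entropy_def sum_subtractf)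
  also have "(\<Sum>u\<in>words (Suc n). q u * ln (q (butlast u))) = - block_entropy q n"
    unfolding sum_words_snoc block_entropy_def
    by (simp add: distrib_right[symmetric] word_lawD(3)[OF q])
  finally show ?thesis by simp
qed

lemma markov_ratio:
  assumes M: "markov_law m q" and y: "length y = Suc m" and nz: "q (x @ y) \<noteq> 0"
  shows "q (x @ y) / q (butlast (x @ y)) = q y / q (butlast y)"
proof -
  obtain w v where wv: "y = w @ [v]" "length w = m" using y by (cases y rule: rev_cases) auto
  have "q (x @ w @ [v]) * q w = q (x @ w) * q (w @ [v])"
    using markov_law_eq[OF M] wv by simp
  moreover have "q w \<noteq> 0" "q (x @ w) \<noteq> 0"
    using nz markov_zero_mid[OF M, of w x "[v]"] markov_zero_left[OF M, of "x @ w" "[v]"] wv by auto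
  ultimately show ?thesis by (simp add: wv butlast_append field_simps)
qed

lemma cond_entropy_markov:
  assumes q: "markov_law m q" and n: "m \<le> n"
  shows "cond_entropy n q = cond_entropy m q"
proof -
  note W = markov_law_word_law[OF q]
  have "(\<Sum>u\<in>words (Suc n). q u * ln (q u / q (butlast u)))
      = (\<Sum>x\<in>words (n - m). \<Sum>y\<in>words (Suc m). q (x @ y) * ln (q (x @ y) / q (butlast (x @ y))))"
    using sum_words_append[of "\<lambda>u. q u * ln (q u / q (butlast u))" "n - m" "Suc m"] n by simp
  also have "\<dots> = (\<Sum>x\<in>words (n - m). \<Sum>y\<in>words (Suc m). q (x @ y) * ln (q y / q (butlast y)))"
  proof (intro sum.cong refl)
    fix x y assume "y \<in> words (Suc m)"
    then show "q (x @ y) * ln (q (x @ y) / q (butlast (x @ y))) = q (x @ y) * ln (q y / q (butlast y))"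
      using markov_ratio[OF q, of y x] by (cases "q (x @ y) = 0") auto
  qed
  also have "\<dots> = (\<Sum>y\<in>words (Suc m). q y * ln (q y / q (butlast y)))"
    by (subst sum.swap) (simp add: sum_distrib_right[symmetric] word_law_sum_left[OF W])
  finally show ?thesis by (simp add: cond_entropy_def word_lawD(5)[OF W])
qed

lemma fekete:
  fixes a :: "nat \<Rightarrow> real"
  assumes sub: "\<And>i j. a (i + j) \<le> a i + a j" and lower: "\<And>n. c * real n \<le> a n"
  shows "convergent (\<lambda>n. a (Suc n) / real (Suc n))"
proof -
  define L where "L = (INF k\<in>{1..}. a k / real k)"
  have bdd: "bdd_below ((\<lambda>k. a k / real k) ` {1..})"
    by (rule bdd_belowI2[of _ c]) (use lower in \<open>simp add: field_simps\<close>)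
  have L_le: "L \<le> a k / real k" if "1 \<le> k" for k
    unfolding L_def using that bdd by (intro cINF_lower) auto
  have mult: "a (k * i + j) \<le> real i * a k + a j" for i j k
  proof (induction i)
    case (Suc i)
    have "a (k * Suc i + j) \<le> a k + a (k * i + j)"
      using sub[of k "k * i + j"] by (simp add: algebra_simps)
    then show ?case using Suc by (simp add: algebra_simps)
  qed simp
  have "(\<lambda>n. a n / real n) \<longlonglongrightarrow> L"
  proof (rule LIMSEQ_I)
    fix r :: real assume r: "0 < r"
    have "\<exists>k\<in>{1..}. a k / real k < L + r / 2"
      using r bdd cINF_less_iff[of "{1::nat..}" "\<lambda>k. a k / real k" "L + r / 2"] unfolding L_def by force
    then obtain k where k: "1 \<le> k" "a k / real k < L + r / 2" by auto
    \<comment> \<open>The constant covers both errors of division with remainder: the leftover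
      \<open>a (n mod k)\<close>, and the missing fraction of \<open>a k\<close>.\<close>
    define B where "B = (\<Sum>j<k. \<bar>a j\<bar>) + \<bar>a k\<bar>"
    have B: "\<bar>a j\<bar> \<le> B - \<bar>a k\<bar>" if "j < k" for j
      unfolding B_def using that by (auto intro!: member_le_sum)
    have B0: "0 \<le> B" unfolding B_def by (intro add_nonneg_nonneg sum_nonneg) auto
    obtain n0 :: nat where n0: "2 * B / r < real n0" using reals_Archimedean2 by blast
    show "\<exists>no. \<forall>n\<ge>no. norm (a n / real n - L) < r"
    proof (intro exI[of _ "Suc n0"] allI impI)
      fix n assume n: "Suc n0 \<le> n"
      then have np: "0 < real n" by simp
      have "a n \<le> real (n div k) * a k + a (n mod k)"
        using mult[of k "n div k" "n mod k"] by simp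
      also have "real (n div k) = (real n - real (n mod k)) / real k"
      proof -
        have "real n = real k * real (n div k) + real (n mod k)"
          by (metis mult_div_mod_eq of_nat_add of_nat_mult)
        then show ?thesis using k by (simp add: field_simps)
      qed
      also have "(real n - real (n mod k)) / real k * a k + a (n mod k)
          = real n * (a k / real k) - real (n mod k) / real k * a k + a (n mod k)"
        by (simp add: diff_divide_distrib algebra_simps)
      also have "\<dots> \<le> real n * (a k / real k) + B"
      proof -
        have "- (real (n mod k) / real k * a k) \<le> (real (n mod k) / real k) * \<bar>a k\<bar>"
          using abs_ge_minus_self[of "real (n mod k) / real k * a k"] by (simp add: abs_mult)
        also have "\<dots> \<le> 1 * \<bar>a k\<bar>"
          using k by (intro mult_right_mono) auto
        finally show ?thesis using B[of "n mod k"] k by (auto simp: abs_le_iff)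
      qed
      finally have "a n / real n \<le> a k / real k + B / real n"
        using np by (simp add: field_simps)
      also have "B / real n < r / 2"
      proof -
        have "2 * B / r < real n" using n0 n by simp
        then show ?thesis using r np by (simp add: field_simps)
      qed
      finally have "a n / real n < L + r" using k by simp
      moreover have "L \<le> a n / real n" using n by (intro L_le) simp
      ultimately show "norm (a n / real n - L) < r" using r by (simp add: abs_less_iff)
    qed
  qed
  then have "(\<lambda>n. a (Suc n) / real (Suc n)) \<longlonglongrightarrow> L"
    by (rule LIMSEQ_Suc)
  then show ?thesis by (rule convergentI)
qed

text \<open>Gibbs' inequality against the product of the two marginals. Shift invariance is not
  assumed, so that the lemma applies to arbitrary channel inputs.\<close>

lemma entropy_subadditive:
  fixes P :: "bool list \<Rightarrow> real"
  assumes P: "\<And>u. 0 \<le> P u" and s: "(\<Sum>u\<in>words (i + j). P u) = 1"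
  shows "block_entropy P (i + j)
    \<le> block_entropy (\<lambda>x. \<Sum>y\<in>words j. P (x @ y)) i + block_entropy (\<lambda>y. \<Sum>x\<in>words i. P (x @ y)) j"
proof -
  let ?A = "\<lambda>x. \<Sum>y\<in>words j. P (x @ y)" and ?B = "\<lambda>y. \<Sum>x\<in>words i. P (x @ y)"
  let ?r = "\<lambda>u. ?A (take i u) * ?B (drop i u)"
  have A0: "0 \<le> ?A x" and B0: "0 \<le> ?B x" for x
    using P by (auto intro: sum_nonneg)
  have leA: "P (x @ y) \<le> ?A x" if "length y = j" for x y
    using that member_le_sum[of y "words j" "\<lambda>y. P (x @ y)"] P by simp
  have leB: "P (x @ y) \<le> ?B y" if "length x = i" for x y
    using that member_le_sum[of x "words i" "\<lambda>x. P (x @ y)"] P by simp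
  have sA: "(\<Sum>x\<in>words i. ?A x) = 1" using s by (simp add: sum_words_append)
  have sB: "(\<Sum>y\<in>words j. ?B y) = 1" using s by (subst sum.swap) (simp add: sum_words_append)
  have "(\<Sum>u\<in>words (i + j). P u * ln (?r u)) \<le> (\<Sum>u\<in>words (i + j). P u * ln (P u))"
  proof (rule gibbs)
    have "(\<Sum>u\<in>words (i + j). ?r u) = (\<Sum>x\<in>words i. \<Sum>y\<in>words j. ?A x * ?B y)"
      unfolding sum_words_append by (intro sum.cong refl) auto
    also have "\<dots> = 1"
      by (simp add: sum_distrib_left[symmetric] sB sA)
    finally show "sum ?r (words (i + j)) \<le> sum P (words (i + j))" using s by simp
    fix u assume u: "u \<in> words (i + j)" 
    show "0 \<le> ?r u" using A0 B0 by simp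
    assume "0 < P u"
    then show "0 < ?r u"
      using leA[of "drop i u" "take i u"] leB[of "take i u" "drop i u"] u by (simp add: mult_pos_pos)
  qed (rule P)
  also have "(\<Sum>u\<in>words (i + j). P u * ln (?r u))
      = (\<Sum>u\<in>words (i + j). P u * ln (?A (take i u)) + P u * ln (?B (drop i u)))"
  proof (intro sum.cong refl)
    fix u assume u: "u \<in> words (i + j)"
    show "P u * ln (?r u) = P u * ln (?A (take i u)) + P u * ln (?B (drop i u))"
    proof (cases "P u = 0")
      case False
      then have "0 < P u" using P[of u] by simp
      then have "0 < ?A (take i u)" "0 < ?B (drop i u)"
        using leA[of "drop i u" "take i u"] leB[of "take i u" "drop i u"] u by auto
      then show ?thesis by (simp add: ln_mult algebra_simps)
    qed simp
  qed
  also have "\<dots> = (\<Sum>x\<in>words i. \<Sum>y\<in>words j. P (x @ y) * ln (?A x))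
      + (\<Sum>x\<in>words i. \<Sum>y\<in>words j. P (x @ y) * ln (?B y))"
    unfolding sum_words_append sum.distrib[symmetric] by (intro sum.cong refl) auto
  also have "(\<Sum>x\<in>words i. \<Sum>y\<in>words j. P (x @ y) * ln (?B y)) = (\<Sum>y\<in>words j. \<Sum>x\<in>words i. P (x @ y) * ln (?B y))"
    by (rule sum.swap)
  finally show ?thesis
    by (simp add: block_entropy_def sum_distrib_right[symmetric])
qed

lemma block_entropy_subadditive:
  assumes "word_law q"
  shows "block_entropy q (i + j) \<le> block_entropy q i + block_entropy q j"
  using entropy_subadditive[of q i j] word_lawD(1)[OF assms]
  by (simp add: word_law_sum_left[OF assms] word_law_sum_right[OF assms] word_law_sum[OF assms])

text \<open>Convergence comes from subadditivity of the block entropies; it is what gives the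
  \<open>lim\<close> in \<open>entropy_rate\<close> its meaning.\<close>

lemma entropy_rate_LIMSEQ:
  assumes "path_measure X" "word_law (word_prob X)"
  shows "(\<lambda>n. block_entropy (word_prob X) (Suc n) / real (Suc n)) \<longlonglongrightarrow> entropy_rate X"
  unfolding entropy_rate_eq_lim[OF assms(1)]
  by (intro convergent_LIMSEQ_iff[THEN iffD1] fekete[of _ 0] block_entropy_subadditive assms)
     (simp add: block_entropy_nonneg[OF assms(2)])

lemma LIMSEQ_affine_average: "(\<lambda>n. (b + (real (Suc n) - d) * c) / real (Suc n)) \<longlonglongrightarrow> (c :: real)"
  by real_asymp

lemma entropy_rate_ge:
  assumes X: "path_measure X" "word_law (word_prob X)"
    and lower: "\<And>k. k0 \<le> k \<Longrightarrow> c \<le> cond_entropy k (word_prob X)"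
  shows "c \<le> entropy_rate X"
proof (rule LIMSEQ_le[OF LIMSEQ_affine_average[of 0 "real k0" c] entropy_rate_LIMSEQ[OF X]])
  have "(real n - real k0) * c \<le> block_entropy (word_prob X) n" if "k0 \<le> n" for n
    using that
  proof (induction n rule: dec_induct)
    case (step n)
    then show ?case using lower[of n] by (simp add: block_entropy_Suc[OF X(2)] algebra_simps)
  qed (simp add: block_entropy_nonneg[OF X(2)])
  then show "\<exists>N. \<forall>n\<ge>N. (0 + (real (Suc n) - real k0) * c) / real (Suc n)
      \<le> block_entropy (word_prob X) (Suc n) / real (Suc n)"
    by (intro exI[of _ k0] allI impI divide_right_mono) (simp_all del: of_nat_Suc)
qed

lemma entropy_rate_markov:
  assumes "markov_order m X"
  shows "entropy_rate X = cond_entropy m (word_prob X)"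
proof -
  note M = markov_law_word_prob[OF assms]
  note W = markov_law_word_law[OF M]
  have X: "path_measure X" using assms stationary_processD(1) by (simp add: markov_order_def)
  let ?c = "cond_entropy m (word_prob X)" and ?b = "block_entropy (word_prob X) m"
  have eq: "block_entropy (word_prob X) n = ?b + (real n - real m) * ?c" if "m \<le> n" for n
    using that
  proof (induction n rule: dec_induct)
    case (step n)
    then show ?case using cond_entropy_markov[OF M, of n] by (simp add: block_entropy_Suc[OF W] algebra_simps)
  qed simp
  have "\<forall>\<^sub>F n in sequentially. (?b + (real (Suc n) - real m) * ?c) / real (Suc n)
      = block_entropy (word_prob X) (Suc n) / real (Suc n)"
  proof (rule eventually_sequentiallyI)
    fix n assume "m \<le> n"
    then have "m \<le> Suc n" by simp
    from eq[OF this] show "(?b + (real (Suc n) - real m) * ?c) / real (Suc n)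
        = block_entropy (word_prob X) (Suc n) / real (Suc n)"
      by (simp only:)
  qed
  then have "(\<lambda>n. block_entropy (word_prob X) (Suc n) / real (Suc n)) \<longlonglongrightarrow> ?c"
    using LIMSEQ_affine_average by (rule Lim_transform_eventually[rotated])
  then show ?thesis
    using entropy_rate_LIMSEQ[OF X W] LIMSEQ_unique by blast
qed


section \<open>First-order optimality of the maximal entropy chain\<close>

text \<open>The upper counterpart of \<open>ln_diff_ge\<close>. The linear part \<open>P - R\<close>
  is kept apart because it sums to 0 over two laws of equal mass, which leaves a quadratic
  bound.\<close>

lemma mult_ln_le_chi_square:
  fixes P R :: real
  assumes "0 \<le> P" "0 < R"
  shows "P * ln (P / R) \<le> (P - R)\<^sup>2 / R + (P - R)"
proof (cases "P = 0")
  case False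
  then have "P * ln (P / R) \<le> P * (P / R - 1)"
    using assms by (intro mult_left_mono ln_le_minus_one) auto
  also have "\<dots> = (P - R)\<^sup>2 / R + (P - R)"
    using assms by (simp add: power2_eq_square field_simps)
  finally show ?thesis .
qed (use assms in \<open>simp add: power2_eq_square\<close>)

text \<open>Perturb the block law \<open>q\<close> towards \<open>p\<close>: the entropy rate of the Markov chain generated by
  \<open>(1 - t) * q + t * p\<close> is linear in \<open>t\<close> up to a relative entropy of order \<open>t\<^sup>2\<close>.\<close>

lemma cross_entropy_le_max:
  assumes X: "max_entropy_chain S X" and m: "m = topological_order S"
    and p: "stationary_block m p" and supp: "\<And>u. length u = Suc m \<Longrightarrow> u \<notin> S \<Longrightarrow> p u = 0"
  defines "q \<equiv> word_prob X"
  shows "- (\<Sum>u\<in>words (Suc m). p u * ln (q u / q (butlast u))) \<le> entropy_rate X"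
proof -
  have MX: "markov_order m X" and S: "allowed_words X = S"
    and max: "\<And>Y. markov_order m Y \<Longrightarrow> allowed_words Y = S \<Longrightarrow> entropy_rate Y \<le> entropy_rate X"
    using X m by (auto simp: max_entropy_chain_def)
  have M: "markov_law m q" unfolding q_def by (rule markov_law_word_prob[OF MX])
  note W = markov_law_word_law[OF M]
  have S_iff: "u \<in> S \<longleftrightarrow> q u \<noteq> 0" for u
    using S word_lawD(1)[OF W, of u] by (auto simp: q_def allowed_words_def less_le)
  define C where "C = entropy_rate X"
  have C: "C = - (\<Sum>u\<in>words (Suc m). q u * ln (q u / q (butlast u)))"
    unfolding C_def entropy_rate_markov[OF MX] cond_entropy_def q_def[symmetric] word_lawD(5)[OF W] ..
  define L where "L = - (\<Sum>u\<in>words (Suc m). p u * ln (q u / q (butlast u)))"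
  define p' where "p' = right_marginal p"
  \<comment> \<open>The product \<open>t * d u\<close> will be exactly the distance of the mixture
    from the law with the same contexts and the transition probabilities of \<open>q\<close>. The 2
    in \<open>K\<close> comes from bounding that law below by \<open>q u / 2\<close> for
    \<open>t \<le> 1 / 2\<close>.\<close>
  define d where "d u = (p u - q u) - (p' (butlast u) - q (butlast u)) * q u / q (butlast u)" for u
  define K where "K = (\<Sum>u\<in>words (Suc m). 2 * (d u)\<^sup>2 / q u)"
  have key: "L \<le> C + K * t" if t: "0 < t" "t \<le> 1 / 2" for t
  proof -
    define r where "r u = (1 - t) * q u + t * p u" for u
    have r': "right_marginal r w = (1 - t) * q w + t * p' w" for w
    proof -
      have "right_marginal r w = (1 - t) * (q (w @ [True]) + q (w @ [False])) + t * p' w"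
        by (simp add: right_marginal_def r_def p'_def algebra_simps)
      then show ?thesis by (simp only: word_lawD(3)[OF W])
    qed
    have rl: "left_marginal r w = (1 - t) * q w + t * left_marginal p w" for w
    proof -
      have "left_marginal r w = (1 - t) * (q (True # w) + q (False # w)) + t * left_marginal p w"
        by (simp add: left_marginal_def r_def algebra_simps)
      then show ?thesis by (simp only: word_lawD(4)[OF W])
    qed
    have rS: "stationary_block m r"
      unfolding stationary_block_def
    proof (intro conjI allI ballI)
      show "0 \<le> r u" for u
        using t word_lawD(1)[OF W, of u] stationary_blockD(1)[OF p, of u] by (simp add: r_def)
      show "(\<Sum>u\<in>words (Suc m). r u) = 1"
        by (simp add: r_def sum.distrib sum_distrib_left[symmetric] word_law_sum[OF W] stationary_blockD(2)[OF p])
      show "right_marginal r w = left_marginal r w" if "w \<in> words m" for w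
        using that stationary_blockD(3)[OF p, of w] by (simp add: r' rl p'_def)
    qed
    \<comment> \<open>The share \<open>1 - t\<close> of \<open>q\<close> keeps every word of
      \<open>S\<close>, and \<open>p\<close> adds none outside, so the perturbed chain is an
      admissible competitor.\<close>
    have r0: "r u = 0 \<longleftrightarrow> q u = 0" if "length u = Suc m" for u
    proof (cases "q u = 0")
      case True
      then show ?thesis using supp[OF that] S_iff[of u] by (simp add: r_def)
    next
      case False
      then have "0 < q u" using word_lawD(1)[OF W, of u] by simp
      then have "0 < r u" using t stationary_blockD(1)[OF p, of u] by (simp add: r_def add_pos_nonneg)
      then show ?thesis using False by simp
    qed
    obtain Y where Y: "stationary_process Y" "word_prob Y = markov_extension m r"
      using stationary_process_of_word_law[OF word_law_markov_extension[OF rS]] by blast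
    have MY: "markov_order m Y"
      using Y markov_law_extension[OF rS] by (intro markov_order_of_law) auto
    have "markov_extension m r u = 0 \<longleftrightarrow> q u = 0" for u
      by (rule markov_law_support_eq[OF markov_law_extension[OF rS] M])
         (simp add: markov_extension_Suc[OF rS] r0)
    then have "allowed_words Y = S"
      using S_iff word_lawD(1)[OF word_law_markov_extension[OF rS]]
      by (auto simp: allowed_words_def Y less_le)
    then have "entropy_rate Y \<le> C" using max MY by (simp add: C_def)
    moreover have "entropy_rate Y = cond_entropy m r"
    proof -
      have "right_marginal (markov_extension m r) w = right_marginal r w" if "length w = m" for w
        using that by (simp add: right_marginal_def markov_extension_Suc[OF rS])
      then show ?thesis
        unfolding entropy_rate_markov[OF MY] Y cond_entropy_def
        by (simp add: markov_extension_Suc[OF rS])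
    qed
    ultimately have le: "cond_entropy m r \<le> C" by simp
    let ?R = "\<lambda>u. right_marginal r (butlast u) * q u / q (butlast u)"
    have qb: "0 < q (butlast u)" "q u \<le> q (butlast u)" if "q u \<noteq> 0" "length u = Suc m" for u
    proof -
      have "u \<noteq> []" using that by auto
      then show le: "q u \<le> q (butlast u)" by (rule word_law_butlast[OF W])
      show "0 < q (butlast u)" using le that word_lawD(1)[OF W, of u] by linarith
    qed
    have p'0: "0 \<le> p' w" for w
      using stationary_blockD(4)[OF p] by (simp add: p'_def)
    have bound: "r u * ln (r u / right_marginal r (butlast u)) - r u * ln (q u / q (butlast u))
        \<le> 2 * t\<^sup>2 * (d u)\<^sup>2 / q u + (r u - ?R u)" if u: "u \<in> words (Suc m)" for u
    proof (cases "q u = 0")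
      case True
      then show ?thesis using r0[of u] u by simp
    next
      case False
      note qb = qb[OF False]
      have qu: "0 < q u" using False word_lawD(1)[OF W, of u] by simp
      have ru: "0 < r u" using r0[of u] u False stationary_blockD(1)[OF rS, of u] by simp
      have Rge: "q u / 2 \<le> ?R u"
      proof -
        have "q (butlast u) / 2 \<le> (1 - t) * q (butlast u)"
          using t qb u by (simp add: field_simps)
        also have "\<dots> \<le> right_marginal r (butlast u)"
          using t p'0[of "butlast u"] by (simp add: r')
        finally show ?thesis using qu qb u by (simp add: field_simps)
      qed
      then have R: "0 < ?R u" using qu by linarith
      have rm: "0 < right_marginal r (butlast u)"
        using R qu qb u by (simp add: zero_less_divide_iff zero_less_mult_iff)
      have "r u * ln (r u / right_marginal r (butlast u)) - r u * ln (q u / q (butlast u)) = r u * ln (r u / ?R u)"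
        using ru rm qu qb u by (simp add: ln_div ln_mult algebra_simps)
      also have "\<dots> \<le> (r u - ?R u)\<^sup>2 / ?R u + (r u - ?R u)"
        using ru R by (intro mult_ln_le_chi_square) auto
      also have "(r u - ?R u)\<^sup>2 / ?R u \<le> (r u - ?R u)\<^sup>2 / (q u / 2)"
        by (intro divide_left_mono Rge mult_pos_pos R) (use qu in auto)
      also have "(r u - ?R u)\<^sup>2 / (q u / 2) = 2 * t\<^sup>2 * (d u)\<^sup>2 / q u"
      proof -
        have "r u - ?R u = t * d u"
          using qb u by (simp add: r' r_def d_def field_simps)
        then show ?thesis by (simp only:) (simp add: power_mult_distrib mult_ac)
      qed
      finally show ?thesis by simp
    qed
    have sumR: "(\<Sum>u\<in>words (Suc m). ?R u) = (\<Sum>u\<in>words (Suc m). r u)"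
    proof -
      have "right_marginal r w * q (w @ [True]) / q w + right_marginal r w * q (w @ [False]) / q w
          = r (w @ [True]) + r (w @ [False])" if w: "length w = m" for w
      proof (cases "q w = 0")
        case True
        then have "q (w @ [v]) = 0" for v using markov_zero_left[OF M] by blast
        then have "r (w @ [v]) = 0" for v using r0[of "w @ [v]"] w by simp
        then show ?thesis using True by simp
      next
        case False
        have "right_marginal r w * q (w @ [True]) / q w + right_marginal r w * q (w @ [False]) / q w
            = right_marginal r w * (q (w @ [True]) + q (w @ [False])) / q w"
          by (simp add: add_divide_distrib distrib_left)
        then show ?thesis using False word_lawD(3)[OF W, of w] by (simp add: right_marginal_def)
      qed
      then show ?thesis unfolding sum_words_snoc by (intro sum.cong) simp_all
    qed
    have "(\<Sum>u\<in>words (Suc m). r u * ln (r u / right_marginal r (butlast u)) - r u * ln (q u / q (butlast u)))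
        \<le> (\<Sum>u\<in>words (Suc m). 2 * t\<^sup>2 * (d u)\<^sup>2 / q u + (r u - ?R u))"
      by (rule sum_mono) (rule bound)
    also have "\<dots> = t\<^sup>2 * K"
      using sumR by (simp add: sum.distrib sum_subtractf K_def sum_distrib_left mult_ac)
    finally have "- cond_entropy m r - (\<Sum>u\<in>words (Suc m). r u * ln (q u / q (butlast u))) \<le> t\<^sup>2 * K"
      by (simp add: cond_entropy_def sum_subtractf)
    moreover have "(\<Sum>u\<in>words (Suc m). r u * ln (q u / q (butlast u))) = - ((1 - t) * C + t * L)"
    proof -
      have "(\<Sum>u\<in>words (Suc m). r u * ln (q u / q (butlast u)))
          = (1 - t) * (\<Sum>u\<in>words (Suc m). q u * ln (q u / q (butlast u)))
            + t * (\<Sum>u\<in>words (Suc m). p u * ln (q u / q (butlast u)))"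
        unfolding sum_distrib_left sum.distrib[symmetric]
        by (intro sum.cong refl) (simp add: r_def algebra_simps)
      then show ?thesis by (simp add: C L_def)
    qed
    \<comment> \<open>The constant \<open>C\<close> cancels; dividing by \<open>t\<close> leaves an
      error \<open>K * t\<close> that vanishes in the limit.\<close>
    ultimately have "(1 - t) * C + t * L \<le> C + t\<^sup>2 * K" using le by simp
    then have "t * L \<le> t * (C + K * t)" by (simp add: algebra_simps power2_eq_square)
    then show ?thesis using t by simp
  qed
  have "L \<le> C"
  proof (rule tendsto_lowerbound)
    show "((\<lambda>t. C + K * t) \<longlongrightarrow> C) (at_right 0)"
      by (rule tendsto_eq_intros | simp)+
    show "\<forall>\<^sub>F t in at_right 0. L \<le> C + K * t"
      unfolding eventually_at_right_field by (rule exI[of _ "1 / 2"]) (use key in auto)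
  qed simp
  then show ?thesis by (simp add: L_def C_def)
qed

section \<open>Stability of the stationary block law\<close>

lemma stationary_block_marginal:
  assumes p: "stationary_block n p"
  shows "(\<Sum>w\<in>words n. right_marginal p w) = 1"
  using stationary_blockD(2)[OF p] by (simp add: sum_words_snoc right_marginal_def)

text \<open>A maximum principle: the density \<open>r = \<mu> / q\<close> of the approximately invariant marginal \<open>\<mu>\<close>
  is almost maximal at every predecessor of a point where it is almost maximal, and by
  irreducibility every state is reached by a backward path of bounded length.\<close>

lemma stationary_perturbation:
  assumes q: "word_law q" and irr: "\<And>u v. q u \<noteq> 0 \<Longrightarrow> q v \<noteq> 0 \<Longrightarrow> \<exists>w. q (u @ w @ v) \<noteq> 0"
  shows "\<exists>K\<ge>0. \<forall>p. stationary_block n p \<longrightarrow> (\<forall>u\<in>words (Suc n). q u = 0 \<longrightarrow> p u = 0) \<longrightarrow>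
    (\<Sum>u\<in>words (Suc n). \<bar>p u - q u\<bar>)
      \<le> K * (\<Sum>u\<in>words (Suc n). \<bar>p u - right_marginal p (butlast u) * q u / q (butlast u)\<bar>)"
proof -
  define A where "A = {w \<in> words n. q w \<noteq> 0}"
  have finA: "finite A" unfolding A_def by (rule finite_subset[of _ "words n"]) auto
  have "\<exists>w\<in>words n. q w \<noteq> 0"
    using word_law_sum[OF q, of n] by (metis sum.neutral zero_neq_one)
  then have neA: "A \<noteq> {}" by (auto simp: A_def)
  \<comment> \<open>The smallest positive probability of a word of length \<open>n + 1\<close>; the
    inserted 1 gives \<open>\<kappa> \<le> 1\<close>, so that powers of \<open>2 / \<kappa>\<close>
    increase.\<close>
  define \<kappa> where "\<kappa> = Min (insert 1 (q ` {u \<in> words (Suc n). q u \<noteq> 0}))"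
  have finU: "finite (q ` {u \<in> words (Suc n). q u \<noteq> 0})"
    by (rule finite_imageI, rule finite_subset[of _ "words (Suc n)"]) auto
  have \<kappa>0: "0 < \<kappa>"
    unfolding \<kappa>_def using finU word_lawD(1)[OF q] by (subst Min_gr_iff) (auto simp: less_le)
  have \<kappa>1: "\<kappa> \<le> 1" unfolding \<kappa>_def using finU by (intro Min_le) auto
  have \<kappa>q: "\<kappa> \<le> q u" if "length u = Suc n" "q u \<noteq> 0" for u
    unfolding \<kappa>_def using finU that by (intro Min_le) auto
  have "\<exists>N. \<forall>x\<in>A \<times> A. \<exists>c. q (fst x @ c @ snd x) \<noteq> 0 \<and> length c \<le> N"
  proof -
    have "\<forall>x\<in>A \<times> A. \<exists>c. q (fst x @ c @ snd x) \<noteq> 0"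
      using irr by (auto simp: A_def)
    then obtain g where g: "\<forall>x\<in>A \<times> A. q (fst x @ g x @ snd x) \<noteq> 0" by metis
    have "length (g x) \<le> Max ((\<lambda>x. length (g x)) ` (A \<times> A))" if "x \<in> A \<times> A" for x
      using that finA by (intro Max_ge) auto
    with g show ?thesis by blast
  qed
  then obtain N where N: "\<And>w w'. w \<in> A \<Longrightarrow> w' \<in> A \<Longrightarrow> \<exists>c. q (w @ c @ w') \<noteq> 0 \<and> length c \<le> N"
    by auto
  \<comment> \<open>Each backward step multiplies the deviation from the maximum by at most
    \<open>2 / \<kappa>\<close>, up to the error \<open>d\<close>, and a connecting word of length
    at most \<open>N\<close> is traversed in at most \<open>n + N\<close> steps.\<close>
  define C where "C = (2 / \<kappa>) ^ (n + N)"
  have C0: "0 \<le> C" using \<kappa>0 by (simp add: C_def)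
  have "(\<Sum>u\<in>words (Suc n). \<bar>p u - q u\<bar>) \<le> (C + 1) * d"
    if p: "stationary_block n p" and supp: "\<forall>u\<in>words (Suc n). q u = 0 \<longrightarrow> p u = 0"
      and d: "d = (\<Sum>u\<in>words (Suc n). \<bar>p u - right_marginal p (butlast u) * q u / q (butlast u)\<bar>)" for p d
  proof -
    define \<mu> where "\<mu> = right_marginal p"
    define r where "r w = \<mu> w / q w" for w
    define e where "e u = p u - \<mu> (butlast u) * q u / q (butlast u)" for u
    have d': "d = (\<Sum>u\<in>words (Suc n). \<bar>e u\<bar>)" by (simp add: d e_def \<mu>_def)
    have d0: "0 \<le> d" unfolding d' by (intro sum_nonneg) auto
    have \<mu>0: "\<mu> w = 0" if "length w = n" "q w = 0" for w
      using that supp word_law_eq_0[OF q, of w "[]"] by (simp add: \<mu>_def right_marginal_def)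
    have pe: "p u = r (butlast u) * q u + e u" for u
      by (simp add: e_def r_def)
    define M where "M = Max (r ` A)"
    have rM: "r w \<le> M" if "w \<in> A" for w
      unfolding M_def using that finA by (intro Max_ge) auto
    have "M \<in> r ` A" unfolding M_def using finA neA by (intro Max_in) auto
    then obtain ws where ws: "ws \<in> A" "r ws = M" by auto
    have bA: "butlast u \<in> A" if "length u = Suc n" "q u \<noteq> 0" for u
      using that word_law_eq_0[OF q, of "butlast u" "[]" "[last u]"]
      by (cases u rule: rev_cases) (auto simp: A_def)
    \<comment> \<open>Balance expresses \<open>q w * (M - r w)\<close> as a sum of nonnegative terms
      over the two predecessors of \<open>w\<close>, up to an error of at most \<open>d\<close>;
      each allowed predecessor has weight at least \<open>\<kappa>\<close>.\<close>
    have step: "M - r (butlast (a # w)) \<le> (M - r w + d) / \<kappa>"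
      if w: "length w = n" and qa: "q (a # w) \<noteq> 0" for a w
    proof -
      have wA: "w \<in> A" using qa w word_law_eq_0[OF q, of w "[a]" "[]"] by (auto simp: A_def)
      let ?t = "\<lambda>b. q (b # w) * (M - r (butlast (b # w)))"
      have t0: "0 \<le> ?t b" for b
      proof (cases "q (b # w) = 0")
        case False
        then show ?thesis using bA[of "b # w"] rM w word_lawD(1)[OF q] by (intro mult_nonneg_nonneg) auto
      qed simp
      have "\<mu> w = p (True # w) + p (False # w)"
        using stationary_blockD(3)[OF p w] by (simp add: \<mu>_def left_marginal_def)
      moreover have "q w = q (True # w) + q (False # w)"
        using word_lawD(4)[OF q, of w] by simp
      moreover have "\<mu> w = r w * q w" using wA by (simp add: r_def A_def)
      ultimately have "q w * (M - r w) = ?t True + ?t False - (e (True # w) + e (False # w))"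
        unfolding pe by (simp add: algebra_simps)
      moreover have "\<bar>e (True # w) + e (False # w)\<bar> \<le> d"
      proof -
        have "\<bar>e (True # w) + e (False # w)\<bar> \<le> (\<Sum>u\<in>{True # w, False # w}. \<bar>e u\<bar>)" by simp
        also have "\<dots> \<le> d" unfolding d' using w by (intro sum_mono2) auto
        finally show ?thesis .
      qed
      moreover have "?t a \<le> ?t True + ?t False"
        using t0[of True] t0[of False] by (cases a) auto
      ultimately have "?t a \<le> q w * (M - r w) + d" by linarith
      moreover have "\<kappa> * (M - r (butlast (a # w))) \<le> ?t a"
        using \<kappa>q[of "a # w"] qa w bA[of "a # w"] rM by (intro mult_right_mono) auto
      moreover have "q w * (M - r w) \<le> M - r w"
        using rM[OF wA] word_law_le_1[OF q, of w] by (simp add: mult_left_le_one_le word_lawD(1)[OF q])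
      ultimately show ?thesis using \<kappa>0 by (simp add: field_simps)
    qed
    have path: "M - r (take n y) \<le> (2 / \<kappa>) ^ k * (M - r (drop k y) + d)"
      if "length y = n + k" "q y \<noteq> 0" for k y
      using that
    proof (induction k arbitrary: y)
      case 0
      then show ?case using d0 by simp
    next
      case (Suc k)
      then obtain a y' where y: "y = a # y'" "length y' = n + k" by (cases y) auto
      have y'q: "q y' \<noteq> 0" using Suc.prems y word_law_eq_0[OF q, of y' "[a]" "[]"] by auto
      have qa: "q (a # take n y') \<noteq> 0"
        using Suc.prems y word_law_eq_0[OF q, of "a # take n y'" "[]" "drop n y'"] by auto
      have tk: "take n y = butlast (a # take n y')"
        using y by (cases n) (auto simp: butlast_take butlast_conv_take)
      let ?g = "M - r (drop k y') + d"
      have "drop k y' \<in> A"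
        using y y'q word_law_eq_0[OF q, of "drop k y'" "take k y'" "[]"] by (auto simp: A_def)
      then have g: "0 \<le> M - r (drop k y')" using rM by auto
      have one: "1 \<le> (2 / \<kappa>) ^ k" using \<kappa>0 \<kappa>1 by (intro one_le_power) (simp add: field_simps)
      have "M - r (take n y) \<le> (M - r (take n y') + d) / \<kappa>"
        unfolding tk using y qa by (intro step) auto
      also have "\<dots> \<le> ((2 / \<kappa>) ^ k * ?g + (2 / \<kappa>) ^ k * ?g) / \<kappa>"
      proof (rule divide_right_mono)
        have "1 * d \<le> (2 / \<kappa>) ^ k * ?g" using one g d0 by (intro mult_mono) auto
        then show "M - r (take n y') + d \<le> (2 / \<kappa>) ^ k * ?g + (2 / \<kappa>) ^ k * ?g"
          using Suc.IH[OF y(2) y'q] by simp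
      qed (use \<kappa>0 in auto)
      also have "\<dots> = (2 / \<kappa>) ^ Suc k * ?g" by simp
      finally show ?case by (simp add: y)
    qed
    have low: "M - r w \<le> C * d" if w: "w \<in> A" for w
    proof -
      obtain c where c: "q (w @ c @ ws) \<noteq> 0" "length c \<le> N" using N[OF w ws(1)] by auto
      have l: "length w = n" "length ws = n" using w ws by (auto simp: A_def)
      have "M - r (take n (w @ c @ ws)) \<le> (2 / \<kappa>) ^ (n + length c) * (M - r (drop (n + length c) (w @ c @ ws)) + d)"
        using c l by (intro path) auto
      then have "M - r w \<le> (2 / \<kappa>) ^ (n + length c) * d"
        using l ws by simp
      also have "\<dots> \<le> C * d"
        unfolding C_def using c d0 \<kappa>0 \<kappa>1 by (intro mult_right_mono power_increasing) (auto simp: field_simps)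
      finally show ?thesis .
    qed
    have sA: "(\<Sum>w\<in>A. f w) = (\<Sum>w\<in>words n. f w)" if "\<And>w. length w = n \<Longrightarrow> q w = 0 \<Longrightarrow> f w = 0" for f :: "bool list \<Rightarrow> real"
      unfolding A_def by (rule sum.mono_neutral_left) (use that in auto)
    have s1: "(\<Sum>w\<in>A. q w) = 1" using sA[of q] word_law_sum[OF q, of n] by simp
    have s2: "(\<Sum>w\<in>A. q w * r w) = 1"
    proof -
      have "(\<Sum>w\<in>A. q w * r w) = (\<Sum>w\<in>A. \<mu> w)"
        by (rule sum.cong) (auto simp: r_def A_def)
      also have "\<dots> = 1"
        using sA[of \<mu>] \<mu>0 stationary_block_marginal[OF p] by (simp add: \<mu>_def)
      finally show ?thesis .
    qed
    \<comment> \<open>The average of \<open>r\<close> with respect to \<open>q\<close> is 1, and all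
      values of \<open>r\<close> lie between \<open>M - C * d\<close> and \<open>M\<close>. Hence
      \<open>M\<close>, and with it every value of \<open>r\<close>, is pinned near 1.\<close>
    have "1 \<le> M"
    proof -
      have "(\<Sum>w\<in>A. q w * r w) \<le> (\<Sum>w\<in>A. q w * M)"
        using rM word_lawD(1)[OF q] by (intro sum_mono mult_left_mono) auto
      then show ?thesis using s1 s2 by (simp add: sum_distrib_right[symmetric])
    qed
    moreover have "M - C * d \<le> 1"
    proof -
      have "(\<Sum>w\<in>A. q w * (M - C * d)) \<le> (\<Sum>w\<in>A. q w * r w)"
        using low word_lawD(1)[OF q] by (intro sum_mono mult_left_mono) (auto simp: algebra_simps)
      then show ?thesis using s1 s2 by (simp add: sum_distrib_right[symmetric])
    qed
    ultimately have close: "\<bar>r w - 1\<bar> \<le> C * d" if "w \<in> A" for w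
      using low[OF that] rM[OF that] by (auto simp: abs_le_iff)
    have "(\<Sum>u\<in>words (Suc n). \<bar>p u - q u\<bar>) \<le> (\<Sum>u\<in>words (Suc n). \<bar>e u\<bar> + q u * (C * d))"
    proof (rule sum_mono)
      fix u assume u: "u \<in> words (Suc n)"
      show "\<bar>p u - q u\<bar> \<le> \<bar>e u\<bar> + q u * (C * d)"
      proof (cases "q u = 0")
        case True
        then show ?thesis using supp u by simp
      next
        case False
        have "p u - q u = e u + q u * (r (butlast u) - 1)" by (simp add: pe algebra_simps)
        moreover have "\<bar>q u * (r (butlast u) - 1)\<bar> \<le> q u * (C * d)"
          using close[OF bA[of u]] u False word_lawD(1)[OF q, of u] by (simp add: abs_mult mult_left_mono)
        ultimately show ?thesis by linarith
      qed
    qed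
    also have "\<dots> = d + (\<Sum>u\<in>words (Suc n). q u) * (C * d)"
      by (simp add: sum.distrib d' sum_distrib_right)
    also have "\<dots> = (C + 1) * d"
      by (simp add: word_law_sum[OF q] algebra_simps)
    finally show ?thesis .
  qed
  then show ?thesis using C0 by (intro exI[of _ "C + 1"]) auto
qed


section \<open>Upper bound for the noisy conditional entropy\<close>

lemma jet_tendsto:
  assumes "jet f a b"
  shows "(f \<longlongrightarrow> a) (at_right 0)"
proof -
  obtain c where "\<forall>\<^sub>F e in at_right 0. norm (f e - a) \<le> c * norm e"
    using jet_diff_bigo_id[OF assms] by (elim landau_o.bigE)
  moreover have "((\<lambda>e::real. c * norm e) \<longlongrightarrow> 0) (at_right 0)"
    by (auto intro!: tendsto_eq_intros)
  ultimately have "((\<lambda>e. f e - a) \<longlongrightarrow> 0) (at_right 0)"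
    by (rule Lim_null_comparison)
  then show ?thesis by (rule LIM_zero_cancel)
qed

lemma jet_bounded_below:
  assumes "jet f a b" "0 < a"
  shows "\<forall>\<^sub>F e in at_right 0. a / 2 < f e"
  using order_tendstoD(1)[OF jet_tendsto[OF assms(1)], of "a / 2"] assms(2) by simp

lemma jet_inverse_bigo_1:
  assumes "jet f a b" "0 < a"
  shows "(\<lambda>e. inverse (f e)) \<in> O[at_right 0](\<lambda>_. 1)"
proof (rule landau_o.bigI[of "2 / a"])
  show "\<forall>\<^sub>F e in at_right 0. norm (inverse (f e)) \<le> 2 / a * norm (1::real)"
    using jet_bounded_below[OF assms]
  proof eventually_elim
    case (elim e)
    then have "inverse (f e) \<le> inverse (a / 2)" using assms(2) by (intro le_imp_inverse_le) auto
    then show ?case using elim assms(2) by simp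
  qed
qed (use assms in auto)

lemma jet_ln:
  assumes f: "jet f a b" and a: "0 < a"
  shows "jet (\<lambda>e. ln (f e)) (ln a) (b / a)"
proof -
  define y where "y e = f e / a - 1" for e
  have y1: "y \<in> O[at_right 0](\<lambda>e. e)"
  proof -
    have "(\<lambda>e. (f e - a) / a) \<in> O[at_right 0](\<lambda>e. e)"
      using jet_diff_bigo_id[OF f] a by simp
    moreover have "y = (\<lambda>e. (f e - a) / a)"
      using a by (auto simp: y_def fun_eq_iff field_simps)
    ultimately show ?thesis by simp
  qed
  have "((\<lambda>e. f e / a - 1) \<longlongrightarrow> a / a - 1) (at_right 0)"
    using a by (intro tendsto_intros jet_tendsto[OF f]) auto
  then have "(y \<longlongrightarrow> 0) (at_right 0)" using a by (simp add: y_def[abs_def])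
  then have ysmall: "\<forall>\<^sub>F e in at_right 0. \<bar>y e\<bar> < 1 / 2"
    unfolding tendsto_iff dist_real_def by (auto dest!: spec[of _ "1 / 2"])
  have "(\<lambda>e. ln (1 + y e) - y e) \<in> O[at_right 0](\<lambda>e. (y e)\<^sup>2)"
  proof (rule landau_o.bigI[of 2])
    show "\<forall>\<^sub>F e in at_right 0. norm (ln (1 + y e) - y e) \<le> 2 * norm ((y e)\<^sup>2)"
      using ysmall by eventually_elim (use abs_ln_one_plus_x_minus_x_bound in auto)
  qed simp
  also have "(\<lambda>e. (y e)\<^sup>2) \<in> O[at_right 0](\<lambda>e. e\<^sup>2)"
    using landau_o.big_power[OF y1] by simp
  finally have 1: "(\<lambda>e. ln (1 + y e) - y e) \<in> O[at_right 0](\<lambda>e. e\<^sup>2)" .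
  have 2: "(\<lambda>e. (f e - a - b * e) / a) \<in> O[at_right 0](\<lambda>e. e\<^sup>2)"
    using f a unfolding jet_def by simp
  have ev: "\<forall>\<^sub>F e in at_right 0. (ln (1 + y e) - y e) + (f e - a - b * e) / a = ln (f e) - ln a - b / a * e"
    using jet_bounded_below[OF f a]
  proof eventually_elim
    case (elim e)
    have "ln (1 + y e) = ln (f e) - ln a"
      using elim a by (simp add: y_def ln_div)
    moreover have "(f e - a - b * e) / a = y e - b / a * e"
      using a by (simp add: y_def diff_divide_distrib)
    ultimately show ?case by simp
  qed
  show ?thesis
    unfolding jet_def by (rule iffD1[OF landau_o.big.in_cong[OF ev] sum_in_bigo(1)[OF 1 2]])
qed

lemma jet_power_self: "jet (\<lambda>e. (1 - e) ^ k) 1 (- real k)"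
proof (induction k)
  case (Suc k)
  show ?case using jet_mult[OF jet_one_minus Suc] by (simp add: algebra_simps)
qed (simp add: jet_const)

text \<open>The bound \<open>exp (- 1)\<close> yields \<open>1 \<le> ln (1 / e)\<close>, so that
  constants are absorbed by logarithms; the bound \<open>1 / 2\<close> is the hypothesis of
  \<open>chan_ge\<close>.\<close>

lemma eventually_small: "\<forall>\<^sub>F e in at_right 0. 0 < e \<and> e < exp (- 1) \<and> e < (1 / 2 :: real)"
  unfolding eventually_at_right_field by (intro exI[of _ "min (exp (- 1)) (1 / 2)"]) auto

lemma neg_ln_noisy_le:
  assumes e: "0 < e" "e \<le> 1 / 2" and P: "e ^ k \<le> P" "P \<le> P'" "P' \<le> 1"
  shows "\<bar>ln (P / P')\<bar> \<le> real k * ln (1 / e)"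
proof -
  have P0: "0 < P" using P e by (meson less_le_trans zero_less_power)
  have "ln (e ^ k) \<le> ln P" using P e P0 by (subst ln_le_cancel_iff) auto
  moreover have le: "ln P \<le> ln P'" and "ln P' \<le> 0" using P P0 by auto
  moreover have "\<bar>ln (P / P')\<bar> = ln P' - ln P" using P P0 le by (simp add: ln_div)
  moreover have "ln (e ^ k) = - (real k * ln (1 / e))" using e by (simp add: ln_div ln_realpow)
  ultimately show ?thesis by linarith
qed

section \<open>Linear cost and relative entropy with respect to the noisy law\<close>

context
  fixes q :: "bool list \<Rightarrow> real" and n :: nat
  assumes W: "word_law q"
begin

definition log_ratio :: "real \<Rightarrow> bool list \<Rightarrow> real" where
  "log_ratio e u = ln (noisy e q u / noisy e q (butlast u))"

text \<open>The expected ideal code length of the last output letter for the input block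
  \<open>x\<close>, when letters are coded with the conditional probabilities of the noisy
  \<open>q\<close>. Averaged over \<open>x\<close> it is a cross entropy, linear in the input
  law.\<close>

definition letter_cost :: "real \<Rightarrow> bool list \<Rightarrow> real" where
  "letter_cost e x = - (\<Sum>u\<in>words (Suc n). chan e x u * log_ratio e u)"

lemma noisy_bounds:
  assumes "0 < e" "e \<le> 1 / 2"
  shows "e ^ length u \<le> noisy e q u" "0 < noisy e q u" "noisy e q u \<le> 1"
    "length u = Suc k \<Longrightarrow> noisy e q u \<le> noisy e q (butlast u)"
proof -
  have WZ: "word_law (noisy e q)" using assms by (intro word_law_noisy W) auto
  show ge: "e ^ length u \<le> noisy e q u"
    using assms by (intro noisy_ge) (auto simp: word_lawD(1)[OF W] word_law_sum[OF W])
  then show "0 < noisy e q u" using assms by (meson less_le_trans zero_less_power)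
  show "noisy e q u \<le> 1" by (rule word_law_le_1[OF WZ])
  assume "length u = Suc k"
  then have "u \<noteq> []" by auto
  then show "noisy e q u \<le> noisy e q (butlast u)" by (rule word_law_butlast[OF WZ])
qed

lemma log_ratio_bigo:
  assumes u: "length u = Suc n"
  shows "(\<lambda>e. log_ratio e u) \<in> O[at_right 0](\<lambda>e. ln (1 / e))"
proof (rule landau_o.bigI[of "real (Suc n)"])
  show "\<forall>\<^sub>F e in at_right 0. norm (log_ratio e u) \<le> real (Suc n) * norm (ln (1 / e))"
    using eventually_small
  proof eventually_elim
    case (elim e)
    have "\<bar>log_ratio e u\<bar> \<le> real (Suc n) * ln (1 / e)"
      unfolding log_ratio_def using elim noisy_bounds[of e u] noisy_bounds[of e "butlast u"] u
      by (intro neg_ln_noisy_le) auto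
    also have "\<dots> \<le> real (Suc n) * norm (ln (1 / e))" by (intro mult_left_mono) auto
    finally show ?case by simp
  qed
qed simp

text \<open>Without errors the output is \<open>x\<close>, whose logarithm is differentiable at 0
  because \<open>q x\<close> is positive. Any other output has probability at most \<open>e\<close>
  and a logarithm of order \<open>ln (1 / e)\<close>.\<close>

lemma letter_cost_bigo:
  assumes x: "length x = Suc n" "q x \<noteq> 0"
  shows "(\<lambda>e. letter_cost e x + ln (q x / q (butlast x))) \<in> O[at_right 0](\<lambda>e. e * ln (1 / e))"
proof -
  have qx: "0 < q x" using x word_lawD(1)[OF W, of x] by simp
  have "x \<noteq> []" using x by auto
  then have qb: "0 < q (butlast x)" using qx word_law_butlast[OF W, of x] by simp
  have noise: "(\<lambda>e. chan e x u * log_ratio e u) \<in> O[at_right 0](\<lambda>e. e * ln (1 / e))"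
    if u: "u \<in> words (Suc n) - {x}" for u
  proof (rule landau_o.big_mult)
    show "(\<lambda>e. chan e x u) \<in> O[at_right 0](\<lambda>e. e)"
    proof (rule landau_o.bigI[of 1])
      show "\<forall>\<^sub>F e in at_right 0. norm (chan e x u) \<le> 1 * norm e"
        using eventually_small
        by eventually_elim (use u x chan_le_noise[of x u] chan_nonneg[of _ x u] in auto)
    qed simp
    show "(\<lambda>e. log_ratio e u) \<in> O[at_right 0](\<lambda>e. ln (1 / e))"
      using u by (intro log_ratio_bigo) auto
  qed
  have J: "jet (\<lambda>e. ln (noisy e q x) + - 1 * ln (noisy e q (butlast x))) (ln (q x) + - 1 * ln (q (butlast x)))
    (flip_coeff q x / q x + (- 1 * (flip_coeff q (butlast x) / q (butlast x)) + 0 * ln (q (butlast x))))"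
    by (intro jet_add jet_mult jet_const jet_ln jet_noisy qx qb)
  obtain c where Jc: "jet (\<lambda>e. (1 - e) ^ Suc n * (ln (noisy e q x) + - 1 * ln (noisy e q (butlast x))))
      (ln (q x) + - 1 * ln (q (butlast x))) c"
    using jet_mult[OF jet_power_self[of "Suc n"] J] by simp
  have "(\<lambda>e. (1 - e) ^ Suc n * (ln (noisy e q x) + - 1 * ln (noisy e q (butlast x)))
      - (ln (q x) + - 1 * ln (q (butlast x)))) \<in> O[at_right 0](\<lambda>e. e)"
    by (rule jet_diff_bigo_id[OF Jc])
  also have "(\<lambda>e. e) \<in> O[at_right 0](\<lambda>e::real. e * ln (1 / e))" by real_asymp
  finally have main: "(\<lambda>e. (1 - e) ^ Suc n * (ln (noisy e q x) + - 1 * ln (noisy e q (butlast x)))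
      - (ln (q x) + - 1 * ln (q (butlast x)))) \<in> O[at_right 0](\<lambda>e. e * ln (1 / e))" .
  have ev: "\<forall>\<^sub>F e in at_right 0. letter_cost e x + ln (q x / q (butlast x))
      = - (\<Sum>u\<in>words (Suc n) - {x}. chan e x u * log_ratio e u)
        - ((1 - e) ^ Suc n * (ln (noisy e q x) + - 1 * ln (noisy e q (butlast x)))
          - (ln (q x) + - 1 * ln (q (butlast x))))"
    using eventually_small
  proof eventually_elim
    case (elim e)
    have "letter_cost e x = - (chan e x x * log_ratio e x) - (\<Sum>u\<in>words (Suc n) - {x}. chan e x u * log_ratio e u)"
      unfolding letter_cost_def using x by (subst sum.remove[of _ x]) auto
    moreover have "log_ratio e x = ln (noisy e q x) + - 1 * ln (noisy e q (butlast x))"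
      using elim noisy_bounds(2)[of e x] noisy_bounds(2)[of e "butlast x"] by (simp add: log_ratio_def ln_div)
    ultimately show ?case
      using qx qb x by (simp add: chan_self ln_div)
  qed
  have "(\<lambda>e. - (\<Sum>u\<in>words (Suc n) - {x}. chan e x u * log_ratio e u)
        - ((1 - e) ^ Suc n * (ln (noisy e q x) + - 1 * ln (noisy e q (butlast x)))
          - (ln (q x) + - 1 * ln (q (butlast x))))) \<in> O[at_right 0](\<lambda>e. e * ln (1 / e))"
  proof (rule sum_in_bigo(2)[OF _ main])
    have "(\<lambda>e. \<Sum>u\<in>words (Suc n) - {x}. chan e x u * log_ratio e u) \<in> O[at_right 0](\<lambda>e. e * ln (1 / e))"
      by (rule big_sum_in_bigo[OF noise])
    then show "(\<lambda>e. - (\<Sum>u\<in>words (Suc n) - {x}. chan e x u * log_ratio e u)) \<in> O[at_right 0](\<lambda>e. e * ln (1 / e))"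
      by simp
  qed
  then show ?thesis
    by (rule iffD2[OF landau_o.big.in_cong[OF ev]])
qed

lemma letter_cost_bound:
  "\<exists>K\<ge>0. \<forall>\<^sub>F e in at_right 0. (\<Sum>x | x \<in> words (Suc n) \<and> q x \<noteq> 0.
     \<bar>letter_cost e x + ln (q x / q (butlast x))\<bar>) \<le> K * (e * ln (1 / e))"
proof -
  have "(\<lambda>e. \<Sum>x | x \<in> words (Suc n) \<and> q x \<noteq> 0. \<bar>letter_cost e x + ln (q x / q (butlast x))\<bar>)
      \<in> O[at_right 0](\<lambda>e. e * ln (1 / e))"
    using letter_cost_bigo by (intro big_sum_in_bigo) auto
  then obtain K where K: "0 < K" "\<forall>\<^sub>F e in at_right 0. norm (\<Sum>x | x \<in> words (Suc n) \<and> q x \<noteq> 0.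
     \<bar>letter_cost e x + ln (q x / q (butlast x))\<bar>) \<le> K * norm (e * ln (1 / e))"
    by (elim landau_o.bigE)
  have "\<forall>\<^sub>F e in at_right 0. (\<Sum>x | x \<in> words (Suc n) \<and> q x \<noteq> 0.
     \<bar>letter_cost e x + ln (q x / q (butlast x))\<bar>) \<le> K * (e * ln (1 / e))"
    using K(2) eventually_small
  proof eventually_elim
    case (elim e)
    then have "0 \<le> e * ln (1 / e)" by (intro mult_nonneg_nonneg) auto
    with elim show ?case by (simp add: abs_mult)
  qed
  with K(1) show ?thesis by (intro exI[of _ K]) auto
qed

text \<open>Only allowed contexts occur in the sum: there the denominator stays away from 0 and the
  noisy transition probability differs from the noiseless one by \<open>O(e)\<close>.\<close>

lemma transition_bound:
  "\<exists>K\<ge>0. \<forall>\<^sub>F e in at_right 0. (\<Sum>u | u \<in> words (Suc n) \<and> q (butlast u) \<noteq> 0.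
     \<bar>noisy e q u / noisy e q (butlast u) - q u / q (butlast u)\<bar>) \<le> K * e"
proof -
  have "(\<lambda>e. noisy e q u / noisy e q (butlast u) - q u / q (butlast u)) \<in> O[at_right 0](\<lambda>e. e)"
    if u: "q (butlast u) \<noteq> 0" for u
  proof -
    have qb: "0 < q (butlast u)" using u word_lawD(1)[OF W, of "butlast u"] by simp
    have J: "jet (\<lambda>e. noisy e q u * q (butlast u) + - q u * noisy e q (butlast u))
       (q u * q (butlast u) + - q u * q (butlast u))
       ((q u * 0 + flip_coeff q u * q (butlast u)) + (- q u * flip_coeff q (butlast u) + 0 * q (butlast u)))"
      by (intro jet_add jet_mult jet_const jet_noisy)
    then have "(\<lambda>e. noisy e q u * q (butlast u) + - q u * noisy e q (butlast u)) \<in> O[at_right 0](\<lambda>e. e)"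
      by (intro jet_bigo_id) simp
    then have big: "(\<lambda>e. (noisy e q u * q (butlast u) + - q u * noisy e q (butlast u)) * inverse (noisy e q (butlast u))
        * inverse (q (butlast u))) \<in> O[at_right 0](\<lambda>e. e * 1 * 1)"
      by (intro landau_o.big_mult jet_inverse_bigo_1[OF jet_noisy[of q "butlast u"] qb]) auto
    have ev: "\<forall>\<^sub>F e in at_right 0. (noisy e q u * q (butlast u) + - q u * noisy e q (butlast u))
        * inverse (noisy e q (butlast u)) * inverse (q (butlast u))
        = noisy e q u / noisy e q (butlast u) - q u / q (butlast u)"
      using eventually_small
    proof eventually_elim
      case (elim e)
      then have "noisy e q (butlast u) \<noteq> 0" using noisy_bounds(2)[of e "butlast u"] by auto
      then show ?case using qb by (simp add: field_simps)
    qed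
    show ?thesis
      using iffD1[OF landau_o.big.in_cong[OF ev] big] by simp
  qed
  then have "(\<lambda>e. \<Sum>u | u \<in> words (Suc n) \<and> q (butlast u) \<noteq> 0.
     \<bar>noisy e q u / noisy e q (butlast u) - q u / q (butlast u)\<bar>) \<in> O[at_right 0](\<lambda>e. e)"
    by (intro big_sum_in_bigo) auto
  then obtain K where K: "0 < K" "\<forall>\<^sub>F e in at_right 0. norm (\<Sum>u | u \<in> words (Suc n) \<and> q (butlast u) \<noteq> 0.
     \<bar>noisy e q u / noisy e q (butlast u) - q u / q (butlast u)\<bar>) \<le> K * norm e"
    by (elim landau_o.bigE)
  have "\<forall>\<^sub>F e in at_right 0. (\<Sum>u | u \<in> words (Suc n) \<and> q (butlast u) \<noteq> 0.
     \<bar>noisy e q u / noisy e q (butlast u) - q u / q (butlast u)\<bar>) \<le> K * e"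
    using K(2) eventually_small by eventually_elim simp
  with K(1) show ?thesis by (intro exI[of _ K]) auto
qed

text \<open>The probability of at least one error is at most \<open>(n + 1) * e\<close> by
  Bernoulli's inequality. It counts twice, as mass leaving the correct word and as mass arriving
  elsewhere.\<close>

lemma noisy_l1_distance:
  assumes p: "stationary_block n p" and e: "0 \<le> e" "e \<le> 1"
  shows "(\<Sum>u\<in>words (Suc n). \<bar>noisy e p u - p u\<bar>) \<le> 2 * real (Suc n) * e"
proof -
  have "(\<Sum>u\<in>words (Suc n). \<bar>noisy e p u - p u\<bar>)
      \<le> (\<Sum>u\<in>words (Suc n). \<Sum>x\<in>words (Suc n). p x * \<bar>chan e x u - (if x = u then 1 else 0)\<bar>)"
  proof (rule sum_mono)
    fix u assume u: "u \<in> words (Suc n)"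
    have "p u = (\<Sum>x\<in>words (Suc n). p x * (if x = u then 1 else 0))"
      using u by (simp add: if_distrib[of "(*) _"] cong: if_cong)
    then have "noisy e p u - p u = (\<Sum>x\<in>words (Suc n). p x * (chan e x u - (if x = u then 1 else 0)))"
      using u by (simp add: noisy_def sum_subtractf right_diff_distrib)
    also have "\<bar>\<dots>\<bar> \<le> (\<Sum>x\<in>words (Suc n). \<bar>p x * (chan e x u - (if x = u then 1 else 0))\<bar>)"
      by (rule sum_abs)
    finally show "\<bar>noisy e p u - p u\<bar> \<le> (\<Sum>x\<in>words (Suc n). p x * \<bar>chan e x u - (if x = u then 1 else 0)\<bar>)"
      using stationary_blockD(1)[OF p] by (simp add: abs_mult)
  qed
  also have "\<dots> = (\<Sum>x\<in>words (Suc n). p x * (\<Sum>u\<in>words (Suc n). \<bar>chan e x u - (if x = u then 1 else 0)\<bar>))"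
    by (subst sum.swap) (simp add: sum_distrib_left)
  also have "\<dots> \<le> (\<Sum>x\<in>words (Suc n). p x * (2 * real (Suc n) * e))"
  proof (intro sum_mono mult_left_mono stationary_blockD(1)[OF p])
    fix x assume x: "x \<in> words (Suc n)"
    have b: "1 - real (Suc n) * e \<le> (1 - e) ^ Suc n"
      using Bernoulli_inequality[of "- e" "Suc n"] e by (simp add: algebra_simps)
    have c1: "chan e x x \<le> 1" using e by (rule chan_le_1)
    have "(\<Sum>u\<in>words (Suc n). \<bar>chan e x u - (if x = u then 1 else 0)\<bar>)
        = \<bar>chan e x x - 1\<bar> + (\<Sum>u\<in>words (Suc n) - {x}. \<bar>chan e x u - (if x = u then 1 else 0)\<bar>)"
      using x by (subst sum.remove[of _ x]) auto
    also have "(\<Sum>u\<in>words (Suc n) - {x}. \<bar>chan e x u - (if x = u then 1 else 0)\<bar>) = (\<Sum>u\<in>words (Suc n) - {x}. chan e x u)"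
      using chan_nonneg[OF e] by (intro sum.cong) auto
    also have "\<dots> = 1 - chan e x x"
      using sum_chan[of e x] x sum.remove[of "words (Suc n)" x "chan e x"] by simp
    finally have eq: "(\<Sum>u\<in>words (Suc n). \<bar>chan e x u - (if x = u then 1 else 0)\<bar>)
        = \<bar>chan e x x - 1\<bar> + (1 - chan e x x)" .
    have "1 - real (Suc n) * e \<le> chan e x x" using b x by (simp add: chan_self)
    then show "(\<Sum>u\<in>words (Suc n). \<bar>chan e x u - (if x = u then 1 else 0)\<bar>) \<le> 2 * real (Suc n) * e"
      unfolding eq using c1 by (simp add: algebra_simps)
  qed
  also have "\<dots> = 2 * real (Suc n) * e"
    by (simp add: sum_distrib_right[symmetric] stationary_blockD(2)[OF p])
  finally show ?thesis .
qed

lemma sum_abs_marginal_diff: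
  "(\<Sum>u\<in>words (Suc n). \<bar>right_marginal P (butlast u) - right_marginal R (butlast u)\<bar>)
    \<le> 2 * (\<Sum>u\<in>words (Suc n). \<bar>P u - R u\<bar>)"
proof -
  have "(\<Sum>u\<in>words (Suc n). \<bar>right_marginal P (butlast u) - right_marginal R (butlast u)\<bar>)
      = 2 * (\<Sum>w\<in>words n. \<bar>right_marginal P w - right_marginal R w\<bar>)"
    by (simp add: sum_words_snoc sum_distrib_left)
  also have "\<dots> \<le> 2 * (\<Sum>w\<in>words n. \<bar>P (w @ [True]) - R (w @ [True])\<bar> + \<bar>P (w @ [False]) - R (w @ [False])\<bar>)"
    by (intro mult_left_mono sum_mono) (auto simp: right_marginal_def)
  finally show ?thesis by (simp add: sum_words_snoc)
qed

text \<open>A conditional entropy is a cross entropy minus a relative entropy. Here \<open>R\<close>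
  has the contexts of \<open>P\<close> and the transition probabilities of the noisy
  \<open>q\<close>, and the relative entropy of \<open>P\<close> to \<open>R\<close> is bounded
  below by their distance. For \<open>p = q\<close> it vanishes.\<close>

lemma cond_entropy_decomposition:
  assumes p: "stationary_block n p" and e: "0 < e" "e \<le> 1 / 2"
  defines "P \<equiv> noisy e p"
  defines "R \<equiv> \<lambda>u. right_marginal P (butlast u) * noisy e q u / noisy e q (butlast u)"
  shows "cond_entropy n P \<le> (\<Sum>x\<in>words (Suc n). p x * letter_cost e x)
    - (\<Sum>u\<in>words (Suc n). \<bar>P u - R u\<bar>)\<^sup>2 / 4"
    "cond_entropy n (noisy e q) = (\<Sum>x\<in>words (Suc n). q x * letter_cost e x)"
proof -
  have cost: "(\<Sum>u\<in>words (Suc n). noisy e r u * log_ratio e u) = - (\<Sum>x\<in>words (Suc n). r x * letter_cost e x)" for r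
  proof -
    have "(\<Sum>u\<in>words (Suc n). noisy e r u * log_ratio e u)
        = (\<Sum>u\<in>words (Suc n). \<Sum>x\<in>words (Suc n). r x * (chan e x u * log_ratio e u))"
      by (simp add: noisy_def sum_distrib_right mult.assoc)
    also have "\<dots> = (\<Sum>x\<in>words (Suc n). \<Sum>u\<in>words (Suc n). r x * (chan e x u * log_ratio e u))"
      by (rule sum.swap)
    finally show ?thesis
      by (simp add: letter_cost_def sum_distrib_left sum_negf)
  qed
  have WZ: "word_law (noisy e q)" using e by (intro word_law_noisy W) auto
  show "cond_entropy n (noisy e q) = (\<Sum>x\<in>words (Suc n). q x * letter_cost e x)"
    using cost[of q] by (simp add: cond_entropy_def word_lawD(5)[OF WZ] log_ratio_def)
  have P0: "0 \<le> P u" for u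
    unfolding P_def using stationary_blockD(1)[OF p] e by (intro noisy_nonneg) auto
  have P0': "0 \<le> right_marginal P w" for w
    using P0 by (simp add: right_marginal_def)
  have Ple: "P u \<le> right_marginal P (butlast u)" if l: "length u = Suc n" for u
  proof -
    obtain w v where "u = w @ [v]" using l by (cases u rule: rev_cases) auto
    then show ?thesis using P0 by (cases v) (auto simp: right_marginal_def)
  qed
  have sP: "(\<Sum>u\<in>words (Suc n). P u) = 1"
    unfolding P_def sum_noisy by (rule stationary_blockD(2)[OF p])
  have qz: "0 < noisy e q u" for u using noisy_bounds(2)[OF e] .
  have sR: "(\<Sum>u\<in>words (Suc n). R u) = 1"
  proof -
    have "(\<Sum>u\<in>words (Suc n). R u) = (\<Sum>w\<in>words n. right_marginal P w)"
      unfolding sum_words_snoc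
    proof (intro sum.cong refl)
      fix w :: "bool list"
      have "R (w @ [True]) + R (w @ [False])
          = right_marginal P w * (noisy e q (w @ [True]) + noisy e q (w @ [False])) / noisy e q w"
        by (simp add: R_def add_divide_distrib distrib_left)
      then show "R (w @ [True]) + R (w @ [False]) = right_marginal P w"
        using qz[of w] word_lawD(3)[OF WZ, of w] by simp
    qed
    also have "\<dots> = (\<Sum>u\<in>words (Suc n). P u)"
      by (simp add: sum_words_snoc right_marginal_def)
    finally show ?thesis using sP by simp
  qed
  have R0: "0 < R u" if "0 < P u" "length u = Suc n" for u
    unfolding R_def using that Ple[of u] qz by (intro divide_pos_pos mult_pos_pos) auto
  have "(\<Sum>u\<in>words (Suc n). \<bar>P u - R u\<bar>)\<^sup>2 / 4 \<le> (\<Sum>u\<in>words (Suc n). P u * ln (P u / R u))"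
  proof (rule l1_distance_le_divergence)
    show "0 \<le> R u" for u
      unfolding R_def using P0'[of "butlast u"] qz[of u] qz[of "butlast u"] by simp
  qed (use P0 sP sR R0 in auto)
  also have "\<dots> = (\<Sum>u\<in>words (Suc n). P u * ln (P u / right_marginal P (butlast u)) - P u * log_ratio e u)"
  proof (intro sum.cong refl)
    fix u assume u: "u \<in> words (Suc n)"
    show "P u * ln (P u / R u) = P u * ln (P u / right_marginal P (butlast u)) - P u * log_ratio e u"
    proof (cases "P u = 0")
      case False
      then have "0 < P u" using P0[of u] by simp
      moreover from this have "0 < right_marginal P (butlast u)" using Ple[of u] u by simp
      ultimately show ?thesis
        unfolding R_def log_ratio_def using qz[of u] qz[of "butlast u"] by (simp add: ln_div ln_mult algebra_simps)
    qed simp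
  qed
  also have "\<dots> = - cond_entropy n P + (\<Sum>x\<in>words (Suc n). p x * letter_cost e x)"
    by (simp add: sum_subtractf cond_entropy_def P_def cost)
  finally show "cond_entropy n P \<le> (\<Sum>x\<in>words (Suc n). p x * letter_cost e x)
    - (\<Sum>u\<in>words (Suc n). \<bar>P u - R u\<bar>)\<^sup>2 / 4" by simp
qed

text \<open>The gain in the linear term is at most \<open>O(\<epsilon> ln (1 / \<epsilon>))\<close> times the distance of \<open>p\<close> from \<open>q\<close>,
  while the relative entropy loses the square of that distance.\<close>

lemma noisy_cond_entropy_upper:
  assumes irr: "\<And>u v. q u \<noteq> 0 \<Longrightarrow> q v \<noteq> 0 \<Longrightarrow> \<exists>w. q (u @ w @ v) \<noteq> 0"
    and opt: "\<And>p. stationary_block n p \<Longrightarrow> (\<And>u. length u = Suc n \<Longrightarrow> q u = 0 \<Longrightarrow> p u = 0) \<Longrightarrow>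
      - (\<Sum>u\<in>words (Suc n). p u * ln (q u / q (butlast u))) \<le> cond_entropy n q"
  shows "\<exists>K. \<forall>\<^sub>F e in at_right 0. \<forall>p. stationary_block n p \<longrightarrow> (\<forall>u\<in>words (Suc n). q u = 0 \<longrightarrow> p u = 0) \<longrightarrow>
     cond_entropy n (noisy e p) \<le> cond_entropy n (noisy e q) + K * (e\<^sup>2 * (ln e)\<^sup>2)"
proof -
  obtain K0 where K0: "0 \<le> K0" and pert: "\<And>p. stationary_block n p \<Longrightarrow>
      (\<forall>u\<in>words (Suc n). q u = 0 \<longrightarrow> p u = 0) \<Longrightarrow> (\<Sum>u\<in>words (Suc n). \<bar>p u - q u\<bar>)
      \<le> K0 * (\<Sum>u\<in>words (Suc n). \<bar>p u - right_marginal p (butlast u) * q u / q (butlast u)\<bar>)"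
    using stationary_perturbation[OF W irr, of n] by blast
  obtain K1 where K1: "0 \<le> K1" and cost: "\<forall>\<^sub>F e in at_right 0. (\<Sum>x | x \<in> words (Suc n) \<and> q x \<noteq> 0.
     \<bar>letter_cost e x + ln (q x / q (butlast x))\<bar>) \<le> K1 * (e * ln (1 / e))"
    using letter_cost_bound by auto
  obtain K2 where K2: "0 \<le> K2" and trans: "\<forall>\<^sub>F e in at_right 0. (\<Sum>u | u \<in> words (Suc n) \<and> q (butlast u) \<noteq> 0.
     \<bar>noisy e q u / noisy e q (butlast u) - q u / q (butlast u)\<bar>) \<le> K2 * e"
    using transition_bound by auto
  \<comment> \<open>The 6 is 2 for the distance of \<open>P\<close> from \<open>p\<close> plus 4 for
    that of their context marginals; \<open>K2\<close> accounts for the transition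
    probabilities.\<close>
  define K3 where "K3 = 6 * real (Suc n) + K2"
  have K3: "0 \<le> K3" using K2 by (simp add: K3_def)
  show ?thesis
  proof (intro exI[of _ "K1\<^sup>2 * K0\<^sup>2 + K1 * K0 * K3"])
    show "\<forall>\<^sub>F e in at_right 0. \<forall>p. stationary_block n p \<longrightarrow> (\<forall>u\<in>words (Suc n). q u = 0 \<longrightarrow> p u = 0) \<longrightarrow>
     cond_entropy n (noisy e p) \<le> cond_entropy n (noisy e q) + (K1\<^sup>2 * K0\<^sup>2 + K1 * K0 * K3) * (e\<^sup>2 * (ln e)\<^sup>2)"
      using cost trans eventually_small
    proof (eventually_elim, intro allI impI)
      fix e p
      assume A: "(\<Sum>x | x \<in> words (Suc n) \<and> q x \<noteq> 0. \<bar>letter_cost e x + ln (q x / q (butlast x))\<bar>) \<le> K1 * (e * ln (1 / e))"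
        and T: "(\<Sum>u | u \<in> words (Suc n) \<and> q (butlast u) \<noteq> 0.
          \<bar>noisy e q u / noisy e q (butlast u) - q u / q (butlast u)\<bar>) \<le> K2 * e"
        and e12: "0 < e \<and> e < exp (- 1) \<and> e < 1 / 2"
        and p: "stationary_block n p" and supp: "\<forall>u\<in>words (Suc n). q u = 0 \<longrightarrow> p u = 0"
      have e1: "0 < e \<and> e < exp (- 1)" and e2: "0 < e \<and> e < 1 / 2" using e12 by auto
      define P where "P = noisy e p"
      define \<rho> where "\<rho> u = noisy e q u / noisy e q (butlast u)" for u
      define R where "R u = right_marginal P (butlast u) * noisy e q u / noisy e q (butlast u)" for u
      define \<mu> where "\<mu> = right_marginal p"
      define \<eta> where "\<eta> = (\<Sum>u\<in>words (Suc n). \<bar>P u - R u\<bar>)"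
      define \<delta> where "\<delta> = (\<Sum>u\<in>words (Suc n). \<bar>p u - q u\<bar>)"
      define l where "l = ln (1 / e)"
      have l1: "1 \<le> l"
      proof -
        have "ln e \<le> ln (exp (- 1))" using e1 by (subst ln_le_cancel_iff) auto
        then show ?thesis using e1 by (simp add: l_def ln_div)
      qed
      have \<rho>01: "0 \<le> \<rho> u" "\<rho> u \<le> 1" if "length u = Suc n" for u
        using that noisy_bounds[of e u] noisy_bounds(2)[of e "butlast u"] e2 by (auto simp: \<rho>_def)
      have Pp: "(\<Sum>u\<in>words (Suc n). \<bar>P u - p u\<bar>) \<le> 2 * real (Suc n) * e"
        unfolding P_def using e2 by (intro noisy_l1_distance p) auto
      have \<mu>01: "0 \<le> \<mu> w" "\<mu> w \<le> 1" if "length w = n" for w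
        using that stationary_block_marginal[OF p] stationary_blockD(4)[OF p]
          member_le_sum[of w "words n" "right_marginal p"] by (auto simp: \<mu>_def)
      have \<mu>0: "\<mu> w = 0" if "length w = n" "q w = 0" for w
        using that supp word_law_eq_0[OF W, of w "[]"] by (simp add: \<mu>_def right_marginal_def)
      \<comment> \<open>The relative entropy controls \<open>P\<close> against the noisy
        transitions, while the stability estimate needs \<open>p\<close> against the noiseless ones.
        The three corrections are all \<open>O(e)\<close>.\<close>
      have "(\<Sum>u\<in>words (Suc n). \<bar>p u - \<mu> (butlast u) * q u / q (butlast u)\<bar>)
          \<le> (\<Sum>u\<in>words (Suc n). \<bar>P u - p u\<bar> + \<bar>P u - R u\<bar>
              + \<bar>right_marginal P (butlast u) - right_marginal p (butlast u)\<bar>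
              + (if q (butlast u) \<noteq> 0 then \<bar>\<rho> u - q u / q (butlast u)\<bar> else 0))"
      proof (rule sum_mono)
        fix u assume u: "u \<in> words (Suc n)"
        have Ru: "R u = right_marginal P (butlast u) * \<rho> u" by (simp add: R_def \<rho>_def)
        have lb: "length (butlast u) = n" using u by simp
        have "p u - \<mu> (butlast u) * q u / q (butlast u)
            = (p u - P u) + (P u - R u) + (right_marginal P (butlast u) - \<mu> (butlast u)) * \<rho> u
              + \<mu> (butlast u) * (\<rho> u - q u / q (butlast u))"
          by (simp add: Ru algebra_simps)
        moreover have "\<bar>(right_marginal P (butlast u) - \<mu> (butlast u)) * \<rho> u\<bar>
            \<le> \<bar>right_marginal P (butlast u) - right_marginal p (butlast u)\<bar>"
          using \<rho>01[of u] u by (simp add: abs_mult \<mu>_def mult_left_le)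
        moreover have "\<bar>\<mu> (butlast u) * (\<rho> u - q u / q (butlast u))\<bar>
            \<le> (if q (butlast u) \<noteq> 0 then \<bar>\<rho> u - q u / q (butlast u)\<bar> else 0)"
          using \<mu>0[OF lb] \<mu>01[OF lb] by (auto simp: abs_mult mult_left_le_one_le)
        ultimately show "\<bar>p u - \<mu> (butlast u) * q u / q (butlast u)\<bar>
            \<le> \<bar>P u - p u\<bar> + \<bar>P u - R u\<bar> + \<bar>right_marginal P (butlast u) - right_marginal p (butlast u)\<bar>
              + (if q (butlast u) \<noteq> 0 then \<bar>\<rho> u - q u / q (butlast u)\<bar> else 0)"
          by linarith
      qed
      also have "\<dots> = (\<Sum>u\<in>words (Suc n). \<bar>P u - p u\<bar>) + \<eta>
          + (\<Sum>u\<in>words (Suc n). \<bar>right_marginal P (butlast u) - right_marginal p (butlast u)\<bar>)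
          + (\<Sum>u | u \<in> words (Suc n) \<and> q (butlast u) \<noteq> 0. \<bar>\<rho> u - q u / q (butlast u)\<bar>)"
      proof -
        have "(\<Sum>u | u \<in> words (Suc n) \<and> q (butlast u) \<noteq> 0. \<bar>\<rho> u - q u / q (butlast u)\<bar>)
            = (\<Sum>u\<in>words (Suc n). if q (butlast u) \<noteq> 0 then \<bar>\<rho> u - q u / q (butlast u)\<bar> else 0)"
          using sum.inter_filter[OF finite_words[of "Suc n"], of "\<lambda>u. \<bar>\<rho> u - q u / q (butlast u)\<bar>" "\<lambda>u. q (butlast u) \<noteq> 0"]
          by simp
        then show ?thesis by (simp add: sum.distrib \<eta>_def)
      qed
      also have "\<dots> \<le> \<eta> + K3 * e"
        using Pp T sum_abs_marginal_diff[of P p] by (simp add: K3_def \<rho>_def algebra_simps)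
      finally have "\<delta> \<le> K0 * (\<eta> + K3 * e)"
        using pert[OF p supp] K0 unfolding \<delta>_def \<mu>_def by (meson mult_left_mono order_trans)
      note \<delta> = this
      have \<delta>0: "0 \<le> \<delta>" unfolding \<delta>_def by (intro sum_nonneg) auto
      have lin: "(\<Sum>x\<in>words (Suc n). p x * letter_cost e x) - (\<Sum>x\<in>words (Suc n). q x * letter_cost e x)
          \<le> \<delta> * (K1 * (e * l))"
      proof -
        \<comment> \<open>Optimality of \<open>q\<close> disposes of the noiseless part of the cost;
          only the perturbation \<open>?c\<close>, of order \<open>e * ln (1 / e)\<close>, is tested
          against \<open>p - q\<close>.\<close>
        let ?c = "\<lambda>x. letter_cost e x + ln (q x / q (butlast x))"
        have "- (\<Sum>u\<in>words (Suc n). p u * ln (q u / q (butlast u))) \<le> cond_entropy n q"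
          using supp by (intro opt p) auto
        then have "- (\<Sum>u\<in>words (Suc n). p u * ln (q u / q (butlast u)))
            \<le> - (\<Sum>u\<in>words (Suc n). q u * ln (q u / q (butlast u)))"
          by (simp add: cond_entropy_def word_lawD(5)[OF W])
        then have "(\<Sum>x\<in>words (Suc n). p x * letter_cost e x) - (\<Sum>x\<in>words (Suc n). q x * letter_cost e x)
            \<le> (\<Sum>x\<in>words (Suc n). (p x - q x) * ?c x)"
          by (simp add: sum.distrib sum_subtractf algebra_simps)
        also have "\<dots> = (\<Sum>x | x \<in> words (Suc n) \<and> q x \<noteq> 0. (p x - q x) * ?c x)"
          by (rule sum.mono_neutral_right) (use supp in auto)
        also have "\<dots> \<le> (\<Sum>x | x \<in> words (Suc n) \<and> q x \<noteq> 0. \<delta> * \<bar>?c x\<bar>)"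
        proof (rule sum_mono)
          fix x assume x: "x \<in> {x. x \<in> words (Suc n) \<and> q x \<noteq> 0}"
          have "\<bar>p x - q x\<bar> \<le> \<delta>"
            unfolding \<delta>_def using x by (intro member_le_sum) auto
          then have "\<bar>(p x - q x) * ?c x\<bar> \<le> \<delta> * \<bar>?c x\<bar>"
            by (simp add: abs_mult mult_right_mono)
          then show "(p x - q x) * ?c x \<le> \<delta> * \<bar>?c x\<bar>" by linarith
        qed
        also have "\<dots> = \<delta> * (\<Sum>x | x \<in> words (Suc n) \<and> q x \<noteq> 0. \<bar>?c x\<bar>)"
          by (simp add: sum_distrib_left)
        also have "\<dots> \<le> \<delta> * (K1 * (e * l))"
          using A \<delta>0 by (intro mult_left_mono) (auto simp: l_def)
        finally show ?thesis .
      qed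
      have el: "0 \<le> e * l" using e1 l1 by simp
      have "cond_entropy n P - cond_entropy n (noisy e q) \<le> \<delta> * (K1 * (e * l)) - \<eta>\<^sup>2 / 4"
        using cond_entropy_decomposition[OF p, of e] e2 lin unfolding P_def \<eta>_def R_def by auto
      also have "\<dots> \<le> K0 * (\<eta> + K3 * e) * (K1 * (e * l)) - \<eta>\<^sup>2 / 4"
        using \<delta> K1 el by (intro diff_right_mono mult_right_mono) auto
      also have "\<dots> \<le> (K1\<^sup>2 * K0\<^sup>2) * (e * l)\<^sup>2 + K1 * K0 * K3 * (e * (e * l))"
      proof -
        \<comment> \<open>Completing the square eliminates the uncontrolled \<open>\<eta>\<close>
          and creates the squared logarithm in the error term.\<close>
        have "0 \<le> (K1 * K0 * (e * l) - \<eta> / 2)\<^sup>2" by simp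
        also have "\<dots> = (K1\<^sup>2 * K0\<^sup>2) * (e * l)\<^sup>2 - K0 * \<eta> * (K1 * (e * l)) + \<eta>\<^sup>2 / 4"
          by (simp add: power2_diff power_mult_distrib power_divide)
        finally show ?thesis by (simp add: algebra_simps)
      qed
      also have "\<dots> \<le> (K1\<^sup>2 * K0\<^sup>2) * (e * l)\<^sup>2 + K1 * K0 * K3 * (e * l)\<^sup>2"
      proof -
        have "e * (e * l) \<le> (e * l)\<^sup>2"
          using l1 e1 by (simp add: power2_eq_square mult_left_mono)
        then show ?thesis
          using K0 K1 K3 by (intro add_left_mono mult_left_mono mult_nonneg_nonneg) auto
      qed
      also have "(e * l)\<^sup>2 = e\<^sup>2 * (ln e)\<^sup>2"
        using e1 by (simp add: l_def ln_div power_mult_distrib)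
      finally show "cond_entropy n (noisy e p)
          \<le> cond_entropy n (noisy e q) + (K1\<^sup>2 * K0\<^sup>2 + K1 * K0 * K3) * (e\<^sup>2 * (ln e)\<^sup>2)"
        by (simp add: P_def algebra_simps)
    qed
  qed
qed

end

section \<open>Lower bound for the output entropy\<close>

text \<open>The three ways in which a term \<open>P ln (P / Q)\<close> of a relative entropy can be of second order.\<close>

lemma divergence_term_regular:
  fixes P Q :: "real \<Rightarrow> real"
  assumes pos: "\<forall>\<^sub>F e in at_right 0. 0 \<le> P e \<and> 0 < Q e"
    and diff: "(\<lambda>e. P e - Q e) \<in> O[at_right 0](\<lambda>e. e)" and c: "0 < c" "\<forall>\<^sub>F e in at_right 0. c \<le> Q e"
  shows "\<exists>K. \<forall>\<^sub>F e in at_right 0. P e * ln (P e / Q e) \<le> K * (e\<^sup>2 * ln (1 / e)) + (P e - Q e)"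
proof -
  obtain K where K: "\<forall>\<^sub>F e in at_right 0. norm (P e - Q e) \<le> K * norm e"
    using diff by (elim landau_o.bigE)
  have "\<forall>\<^sub>F e in at_right 0. P e * ln (P e / Q e) \<le> K\<^sup>2 / c * (e\<^sup>2 * ln (1 / e)) + (P e - Q e)"
    using pos K c(2) eventually_small
  proof eventually_elim
    case (elim e)
    have l1: "1 \<le> ln (1 / e)"
      using elim ln_less_cancel_iff[of e "exp (- 1)"] by (simp add: ln_div)
    have "P e * ln (P e / Q e) \<le> (P e - Q e)\<^sup>2 / Q e + (P e - Q e)"
      using elim by (intro mult_ln_le_chi_square) auto
    also have "(P e - Q e)\<^sup>2 / Q e \<le> (K * e)\<^sup>2 / c"
    proof (rule frac_le)
      have "\<bar>P e - Q e\<bar> \<le> K * e" using elim by simp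
      then show "(P e - Q e)\<^sup>2 \<le> (K * e)\<^sup>2"
        by (meson abs_ge_zero order_trans power2_le_iff_abs_le)
    qed (use elim c in auto)
    also have "(K * e)\<^sup>2 / c = K\<^sup>2 / c * (e\<^sup>2 * 1)"
      by (simp add: power_mult_distrib)
    also have "\<dots> \<le> K\<^sup>2 / c * (e\<^sup>2 * ln (1 / e))"
      using l1 c by (intro mult_left_mono) auto
    finally show ?case by simp
  qed
  then show ?thesis by blast
qed

lemma divergence_term_first_order:
  fixes P Q :: "real \<Rightarrow> real"
  assumes pos: "\<forall>\<^sub>F e in at_right 0. 0 \<le> P e \<and> 0 < Q e"
    and diff: "(\<lambda>e. P e - Q e) \<in> O[at_right 0](\<lambda>e. e\<^sup>2)" and c: "0 < c" "\<forall>\<^sub>F e in at_right 0. c * e \<le> Q e"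
  shows "\<exists>K. \<forall>\<^sub>F e in at_right 0. P e * ln (P e / Q e) \<le> K * (e\<^sup>2 * ln (1 / e)) + (P e - Q e)"
proof -
  obtain K where K: "\<forall>\<^sub>F e in at_right 0. norm (P e - Q e) \<le> K * norm (e\<^sup>2)"
    using diff by (elim landau_o.bigE)
  have "\<forall>\<^sub>F e in at_right 0. P e * ln (P e / Q e) \<le> K\<^sup>2 / c * (e\<^sup>2 * ln (1 / e)) + (P e - Q e)"
    using pos K c(2) eventually_small
  proof eventually_elim
    case (elim e)
    have l1: "1 \<le> ln (1 / e)"
      using elim ln_less_cancel_iff[of e "exp (- 1)"] by (simp add: ln_div)
    have "P e * ln (P e / Q e) \<le> (P e - Q e)\<^sup>2 / Q e + (P e - Q e)"
      using elim by (intro mult_ln_le_chi_square) auto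
    also have "(P e - Q e)\<^sup>2 / Q e \<le> (K * e\<^sup>2)\<^sup>2 / (c * e)"
    proof (rule frac_le)
      have "\<bar>P e - Q e\<bar> \<le> K * e\<^sup>2" using elim by simp
      then show "(P e - Q e)\<^sup>2 \<le> (K * e\<^sup>2)\<^sup>2"
        by (meson abs_ge_zero order_trans power2_le_iff_abs_le)
    qed (use elim c in auto)
    also have "(K * e\<^sup>2)\<^sup>2 / (c * e) = K\<^sup>2 / c * (e\<^sup>2 * e)"
      using elim c by (simp add: power2_eq_square)
    also have "\<dots> \<le> K\<^sup>2 / c * (e\<^sup>2 * ln (1 / e))"
      using l1 c elim by (intro mult_left_mono) (auto intro: order_trans[of _ 1])
    finally show ?case by simp
  qed
  then show ?thesis by blast
qed

text \<open>Closeness of \<open>P\<close> and \<open>Q\<close> is not assumed here: \<open>P\<close>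
  is already of second order, and the logarithm costs no more than a factor
  \<open>ln (1 / e)\<close>.\<close>

lemma divergence_term_second_order:
  fixes P Q :: "real \<Rightarrow> real"
  assumes pos: "\<forall>\<^sub>F e in at_right 0. 0 \<le> P e \<and> 0 < Q e"
    and P: "P \<in> O[at_right 0](\<lambda>e. e\<^sup>2)" and Q: "Q \<in> O[at_right 0](\<lambda>e. e\<^sup>2)"
    and k: "0 \<le> k" "\<forall>\<^sub>F e in at_right 0. P e * ln (P e / Q e) \<le> P e * (k * ln (1 / e))"
  shows "\<exists>K. \<forall>\<^sub>F e in at_right 0. P e * ln (P e / Q e) \<le> K * (e\<^sup>2 * ln (1 / e)) + (P e - Q e)"
proof -
  obtain K1 where K1: "0 < K1" "\<forall>\<^sub>F e in at_right 0. norm (P e) \<le> K1 * norm (e\<^sup>2)"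
    using P by (elim landau_o.bigE)
  obtain K2 where K2: "0 < K2" "\<forall>\<^sub>F e in at_right 0. norm (Q e) \<le> K2 * norm (e\<^sup>2)"
    using Q by (elim landau_o.bigE)
  have "\<forall>\<^sub>F e in at_right 0. P e * ln (P e / Q e) \<le> (K1 * k + K2) * (e\<^sup>2 * ln (1 / e)) + (P e - Q e)"
    using pos K1(2) K2(2) k(2) eventually_small
  proof eventually_elim
    case (elim e)
    have l1: "1 \<le> ln (1 / e)"
      using elim ln_less_cancel_iff[of e "exp (- 1)"] by (simp add: ln_div)
    have "P e * (k * ln (1 / e)) \<le> (K1 * e\<^sup>2) * (k * ln (1 / e))"
      using elim l1 k by (intro mult_right_mono mult_nonneg_nonneg) auto
    moreover have "Q e \<le> K2 * e\<^sup>2 * ln (1 / e)"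
    proof -
      have "Q e \<le> K2 * e\<^sup>2 * 1" using elim by simp
      also have "\<dots> \<le> K2 * e\<^sup>2 * ln (1 / e)" using l1 K2 by (intro mult_left_mono) auto
      finally show ?thesis .
    qed
    ultimately show ?case using elim by (simp add: algebra_simps)
  qed
  then show ?thesis by blast
qed

lemma jet_first_order_lower:
  assumes "jet f 0 a" "0 < a"
  shows "\<forall>\<^sub>F e in at_right 0. a / 2 * e \<le> f e"
proof -
  obtain K where K: "0 < K" "\<forall>\<^sub>F e in at_right 0. norm (f e - 0 - a * e) \<le> K * norm (e\<^sup>2)"
    using assms(1) unfolding jet_def by (elim landau_o.bigE)
  have "\<forall>\<^sub>F e in at_right 0. 0 < e \<and> e < a / (2 * K)"
    unfolding eventually_at_right_field using assms K by (intro exI[of _ "a / (2 * K)"]) auto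
  with K(2) show ?thesis
  proof eventually_elim
    case (elim e)
    then have "K * e\<^sup>2 \<le> a / 2 * e"
      using K by (simp add: power2_eq_square field_simps)
    moreover have "\<bar>f e - a * e\<bar> \<le> K * e\<^sup>2" using elim by simp
    ultimately show ?case by linarith
  qed
qed

section \<open>Conditioning on the input state before the window\<close>

context
  fixes m n :: nat and q :: "bool list \<Rightarrow> real"
  assumes M: "markov_law m q"
begin

text \<open>The joint probability of the noiseless input word \<open>b\<close> and the output word
  \<open>u\<close> that follows it.\<close>

definition joint_prob :: "real \<Rightarrow> bool list \<Rightarrow> bool list \<Rightarrow> real" where
  "joint_prob e b u = noisy e (\<lambda>y. q (b @ y)) u"

lemma joint_prob_nonneg: "0 \<le> e \<Longrightarrow> e \<le> 1 \<Longrightarrow> 0 \<le> joint_prob e b u"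
  unfolding joint_prob_def by (intro noisy_nonneg word_lawD(1)[OF markov_law_word_law[OF M]])

lemma joint_prob_butlast:
  assumes "0 \<le> e" "e \<le> 1" "u \<noteq> []"
  shows "joint_prob e b u \<le> joint_prob e b (butlast u)"
proof -
  obtain w v where u: "u = w @ [v]" using assms(3) by (cases u rule: rev_cases) auto
  have "right_marginal (\<lambda>y. q (b @ y)) = (\<lambda>y. q (b @ y))"
    using word_lawD(3)[OF markov_law_word_law[OF M], of "b @ _"] by (auto simp: right_marginal_def)
  then have "joint_prob e b w = right_marginal (joint_prob e b) w"
    using right_marginal_noisy[of e "\<lambda>y. q (b @ y)"] unfolding joint_prob_def[abs_def] by metis
  then have "joint_prob e b w = joint_prob e b (w @ [True]) + joint_prob e b (w @ [False])"
    by (simp add: right_marginal_def)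
  then show ?thesis
    using joint_prob_nonneg[OF assms(1,2), of b "w @ [True]"] joint_prob_nonneg[OF assms(1,2), of b "w @ [False]"]
    by (cases v) (auto simp: u)
qed

lemma sum_joint_prob: "(\<Sum>b\<in>words j. joint_prob e b u) = noisy e q u"
  unfolding joint_prob_def noisy_def
  by (subst sum.swap)
     (simp add: sum_distrib_right[symmetric] word_law_sum_left[OF markov_law_word_law[OF M]])

lemma noisy_append_joint: "noisy e q (z @ u) = (\<Sum>x\<in>words (length z). chan e x z * joint_prob e x u)"
  unfolding noisy_append by (simp add: joint_prob_def noisy_def sum_distrib_left mult_ac)

lemma joint_prob_append:
  assumes "m \<le> length b"
  shows "joint_prob e (x @ b) u * q b = q (x @ b) * joint_prob e b u"
proof -
  have "q ((x @ b) @ y) * q b = q (x @ b) * q (b @ y)" for y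
    using markov_law_eq[OF M, of b x y] assms by simp
  then show ?thesis
    unfolding joint_prob_def noisy_def sum_distrib_left sum_distrib_right
    by (intro sum.cong refl) (metis mult.assoc mult.commute)
qed

text \<open>The entropy of the last output letter given the \<open>n\<close> output letters before
  it and the input state \<open>b\<close> preceding all of them.\<close>

definition state_cond_entropy :: "real \<Rightarrow> real" where
  "state_cond_entropy e = - (\<Sum>b\<in>words m. \<Sum>u\<in>words (Suc n).
     joint_prob e b u * ln (joint_prob e b u / joint_prob e b (butlast u)))"

text \<open>The log-sum inequality replaces the distant past of the output by the input state before the
  window, which by the Markov property carries all information about the window.\<close>

lemma cond_entropy_noisy_ge_state:
  assumes e: "0 < e" "e < 1" and k: "n + m \<le> k"
  shows "state_cond_entropy e \<le> cond_entropy k (noisy e q)"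
proof -
  note W = markov_law_word_law[OF M]
  define j where "j = k - n"
  have kj: "Suc k = j + Suc n" and jm: "j = (j - m) + m" using k by (auto simp: j_def)
  have WZ: "word_law (noisy e q)" using e by (intro word_law_noisy W) auto
  let ?g = "\<lambda>x u. joint_prob e x u * ln (joint_prob e x u / joint_prob e x (butlast u))"
  have cpos: "0 < chan e x z" for x z
    using e by (induction e x z rule: chan.induct) auto
  have J0: "0 \<le> joint_prob e x u" for x u using e by (intro joint_prob_nonneg) auto
  have step: "noisy e q (z @ u) * ln (noisy e q (z @ u) / noisy e q (butlast (z @ u)))
      \<le> (\<Sum>x\<in>words j. chan e x z * ?g x u)" if z: "length z = j" and u: "length u = Suc n" for z u
  proof -
    have ne: "u \<noteq> []" using u by auto
    have "noisy e q (z @ u) * ln (noisy e q (z @ u) / noisy e q (butlast (z @ u)))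
       = (\<Sum>x\<in>words j. chan e x z * joint_prob e x u) * ln ((\<Sum>x\<in>words j. chan e x z * joint_prob e x u)
          / (\<Sum>x\<in>words j. chan e x z * joint_prob e x (butlast u)))"
      using ne z by (simp add: butlast_append noisy_append_joint)
    also have "\<dots> \<le> (\<Sum>x\<in>words j. chan e x z * joint_prob e x u
        * ln (chan e x z * joint_prob e x u / (chan e x z * joint_prob e x (butlast u))))"
    proof (rule log_sum)
      fix x assume "0 < chan e x z * joint_prob e x u"
      then have "0 < joint_prob e x u" using cpos[of x z] by (simp add: zero_less_mult_iff)
      then have "0 < joint_prob e x (butlast u)"
        using joint_prob_butlast[of e u x] e ne by simp
      then show "0 < chan e x z * joint_prob e x (butlast u)" using cpos by simp
    qed (use cpos J0 in \<open>simp_all add: less_imp_le\<close>)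
    also have "\<dots> = (\<Sum>x\<in>words j. chan e x z * ?g x u)"
      using cpos by (intro sum.cong refl) (simp add: less_imp_neq[symmetric])
    finally show ?thesis .
  qed
  have "- cond_entropy k (noisy e q) = (\<Sum>z\<in>words j. \<Sum>u\<in>words (Suc n).
      noisy e q (z @ u) * ln (noisy e q (z @ u) / noisy e q (butlast (z @ u))))"
    unfolding cond_entropy_def word_lawD(5)[OF WZ] kj sum_words_append by simp
  also have "\<dots> \<le> (\<Sum>z\<in>words j. \<Sum>u\<in>words (Suc n). \<Sum>x\<in>words j. chan e x z * ?g x u)"
    by (intro sum_mono step) auto
  also have "\<dots> = (\<Sum>z\<in>words j. \<Sum>x\<in>words j. chan e x z * (\<Sum>u\<in>words (Suc n). ?g x u))"
    unfolding sum_distrib_left by (rule sum.cong[OF refl], rule sum.swap)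
  \<comment> \<open>The distant outputs \<open>z\<close> now enter only through the channel weights,
    which sum to 1.\<close>
  also have "\<dots> = (\<Sum>x\<in>words j. (\<Sum>z\<in>words j. chan e x z) * (\<Sum>u\<in>words (Suc n). ?g x u))"
    by (subst sum.swap) (simp add: sum_distrib_right)
  also have "\<dots> = (\<Sum>x\<in>words j. \<Sum>u\<in>words (Suc n). ?g x u)"
    by (intro sum.cong refl) (use sum_chan[of e] in auto)
  also have "\<dots> = (\<Sum>x\<in>words (j - m). \<Sum>b\<in>words m. \<Sum>u\<in>words (Suc n). ?g (x @ b) u)"
    by (subst jm) (rule sum_words_append)
  \<comment> \<open>Only the last \<open>m\<close> input letters \<open>b\<close> matter for the
    window: a longer past rescales both arguments of the logarithm alike.\<close>
  also have "\<dots> = (\<Sum>x\<in>words (j - m). \<Sum>b\<in>words m. q (x @ b) / q b * (\<Sum>u\<in>words (Suc n). ?g b u))"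
  proof (intro sum.cong refl)
    fix x b assume b: "b \<in> words m"
    have "?g (x @ b) u = q (x @ b) / q b * ?g b u" for u
    proof (cases "q (x @ b) = 0")
      case True
      have "q (x @ b @ y) = 0" for y
        using markov_zero_left[OF M True, of y] by simp
      then have "joint_prob e (x @ b) u = 0" by (simp add: joint_prob_def noisy_def)
      then show ?thesis using True by simp
    next
      case False
      then have qb: "q b \<noteq> 0" using markov_zero_right[OF M, of b x] by auto
      have eq: "joint_prob e (x @ b) u = q (x @ b) / q b * joint_prob e b u" for u
        using joint_prob_append[of b e x u] b qb by (simp add: field_simps)
      show ?thesis unfolding eq using False qb by simp
    qed
    then show "(\<Sum>u\<in>words (Suc n). ?g (x @ b) u) = q (x @ b) / q b * (\<Sum>u\<in>words (Suc n). ?g b u)"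
      by (simp add: sum_distrib_left)
  qed
  also have "\<dots> = (\<Sum>b\<in>words m. (\<Sum>x\<in>words (j - m). q (x @ b)) / q b * (\<Sum>u\<in>words (Suc n). ?g b u))"
    by (subst sum.swap) (simp add: sum_distrib_right sum_divide_distrib)
  also have "\<dots> = (\<Sum>b\<in>words m. \<Sum>u\<in>words (Suc n). ?g b u)"
  proof (intro sum.cong refl)
    fix b :: "bool list"
    show "(\<Sum>x\<in>words (j - m). q (x @ b)) / q b * (\<Sum>u\<in>words (Suc n). ?g b u) = (\<Sum>u\<in>words (Suc n). ?g b u)"
    proof (cases "q b = 0")
      case True
      then have "q (b @ y) = 0" for y using markov_zero_left[OF M] by blast
      then have "joint_prob e b u = 0" for u by (simp add: joint_prob_def noisy_def)
      then show ?thesis by simp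
    next
      case False
      then show ?thesis by (simp add: word_law_sum_left[OF W])
    qed
  qed
  finally show ?thesis by (simp add: state_cond_entropy_def)
qed

text \<open>The comparison law makes the last output letter independent of \<open>b\<close> given
  the preceding outputs \<open>w\<close>. If \<open>b @ u\<close> is allowed, both laws stay away
  from 0 and differ by \<open>O(e)\<close>. If it is forbidden and \<open>w\<close> needs at most
  one error, the flip identities cancel the leading part of the difference. If \<open>w\<close>
  needs two errors, both laws are \<open>O(e^2)\<close>.\<close>

lemma divergence_term_bound:
  assumes n: "3 * m \<le> n" and b: "length b = m" "q b \<noteq> 0" and u: "length u = Suc n"
  shows "\<exists>K. \<forall>\<^sub>F e in at_right 0. joint_prob e b u * ln (joint_prob e b u / (joint_prob e b (butlast u) * noisy e q u / noisy e q (butlast u)))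
    \<le> K * (e\<^sup>2 * ln (1 / e)) + (joint_prob e b u - joint_prob e b (butlast u) * noisy e q u / noisy e q (butlast u))"
proof -
  note W = markov_law_word_law[OF M]
  obtain w v where uw: "u = w @ [v]" using u by (cases u rule: rev_cases) auto
  have bu: "butlast u = w" and lw: "length w = n" using u uw by auto
  define F where "F y = q (b @ y)" for y
  have qb: "0 < q b" using b word_lawD(1)[OF W, of b] by simp
  define P P' Z Z' Q where "P e = noisy e F u" and "P' e = noisy e F w"
    and "Z e = noisy e q u" and "Z' e = noisy e q w" and "Q e = P' e * Z e / Z' e" for e
  have jP: "jet P (F u) (flip_coeff F u)" and jP': "jet P' (F w) (flip_coeff F w)"
    and jZ: "jet Z (q u) (flip_coeff q u)" and jZ': "jet Z' (q w) (flip_coeff q w)"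
    unfolding P_def P'_def Z_def Z'_def by (rule jet_noisy)+
  have Jp: "joint_prob e b u = P e" "joint_prob e b w = P' e" for e
    unfolding joint_prob_def P_def P'_def F_def by auto
  have facts: "\<forall>\<^sub>F e in at_right 0. 0 \<le> P e \<and> P e \<le> P' e \<and> P e \<le> Z e \<and> P' e \<le> Z' e \<and> 0 < P' e \<and> 0 < Z e
      \<and> Z e \<le> Z' e \<and> Z' e \<le> 1 \<and> e ^ Suc n \<le> Z e"
    using eventually_small
  proof eventually_elim
    case (elim e)
    then have e: "0 < e" "e \<le> 1 / 2" by auto
    have nn: "u \<noteq> []" using u by auto
    have "P e \<le> P' e" "0 \<le> P e"
      using joint_prob_butlast[of e u b] joint_prob_nonneg[of e b u] e nn by (auto simp: bu Jp)
    moreover have "P e \<le> Z e" "P' e \<le> Z' e"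
    proof -
      have "joint_prob e b y \<le> noisy e q y" for y
        using member_le_sum[of b "words m" "\<lambda>b. joint_prob e b y"] joint_prob_nonneg[of e] e b
          sum_joint_prob[of e y m] by auto
      from this[of u] this[of w] show "P e \<le> Z e" "P' e \<le> Z' e" unfolding Jp Z_def Z'_def by auto
    qed
    moreover have "0 < P' e"
    proof -
      have "0 < q b * e ^ n" using qb e by simp
      also have "\<dots> = (\<Sum>y\<in>words n. q (b @ y) * e ^ n)"
        by (simp add: sum_distrib_right[symmetric] word_law_sum_right[OF W])
      also have "\<dots> \<le> P' e"
        unfolding P'_def F_def noisy_def lw
      proof (intro sum_mono mult_left_mono word_lawD(1)[OF W])
        fix y assume "y \<in> words n"
        then show "e ^ n \<le> chan e y w" using chan_ge[of e y w] e by simp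
      qed
      finally show ?thesis .
    qed
    moreover have "0 < Z e" "Z e \<le> Z' e" "Z' e \<le> 1" "e ^ Suc n \<le> Z e"
      using noisy_bounds[OF W e, of u] noisy_bounds[OF W e, of w] u lw unfolding Z_def Z'_def bu by auto
    ultimately show ?case by blast
  qed
  have pos: "\<forall>\<^sub>F e in at_right 0. 0 \<le> P e \<and> 0 < Q e"
    using facts by eventually_elim (auto simp: Q_def intro!: divide_pos_pos mult_pos_pos)
  define k where "k = real (Suc n)"
  \<comment> \<open>The quotient is \<open>(P / P') * (Z' / Z)\<close>, at most
    \<open>1 / Z\<close>, and \<open>Z\<close> is at least \<open>e ^ (n + 1)\<close>.\<close>
  have logb: "\<forall>\<^sub>F e in at_right 0. P e * ln (P e / Q e) \<le> P e * (k * ln (1 / e))"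
    using facts eventually_small
  proof eventually_elim
    case (elim e)
    show ?case
    proof (cases "P e = 0")
      case False
      then have p: "0 < P e" using elim by simp
      have pq: "P e / Q e = P e / P' e * Z' e / Z e" using elim by (simp add: Q_def)
      have "P e / Q e \<le> 1 / Z e"
        unfolding pq using elim p by (intro divide_right_mono mult_le_one) auto
      also have "\<dots> \<le> 1 / e ^ Suc n"
        using elim by (intro divide_left_mono) auto
      finally have "ln (P e / Q e) \<le> ln (1 / e ^ Suc n)"
        using p elim unfolding pq by (subst ln_le_cancel_iff) auto
      also have "\<dots> = k * ln (1 / e)"
        using elim by (simp add: k_def ln_div ln_realpow ln_mult algebra_simps)
      finally show ?thesis using p by (intro mult_left_mono) auto
    qed simp
  qed
  have k0: "0 \<le> k" by (simp add: k_def)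
  define R where "R e = P e * Z' e + - 1 * (P' e * Z e)" for e
  have diffR: "\<forall>\<^sub>F e in at_right 0. R e * inverse (Z' e) = P e - Q e"
    using facts by eventually_elim (auto simp: R_def Q_def field_simps)
  \<comment> \<open>With equal expansions up to \<open>O(e^2)\<close>, either both laws have a
    positive coefficient of \<open>e\<close>, so that \<open>Q\<close> is bounded below by a
    multiple of \<open>e\<close>, or both are \<open>O(e^2)\<close>.\<close>
  have second: ?thesis if diff: "(\<lambda>e. P e - Q e) \<in> O[at_right 0](\<lambda>e. e\<^sup>2)" and F0: "F u = 0"
  proof -
    have h0: "0 \<le> flip_coeff F u"
      using F0 word_lawD(1)[OF W] by (intro flip_coeff_nonneg) (auto simp: F_def)
    have jQ: "jet Q 0 (flip_coeff F u)"
    proof -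
      have "jet (\<lambda>e. P e + - 1 * (P e - Q e)) (F u + - 1 * 0) (flip_coeff F u + (- 1 * 0 + 0 * 0))"
        using diff by (intro jet_add jP jet_mult jet_const) (simp add: jet_bigo_sq)
      then show ?thesis using F0 by simp
    qed
    have "\<exists>K. \<forall>\<^sub>F e in at_right 0. P e * ln (P e / Q e) \<le> K * (e\<^sup>2 * ln (1 / e)) + (P e - Q e)"
    proof (cases "flip_coeff F u = 0")
      case True
      show ?thesis
        using jP jQ F0 True by (intro divergence_term_second_order[OF pos _ _ k0 logb]) (auto simp: jet_bigo_sq)
    next
      case False
      then show ?thesis
        using h0 jet_first_order_lower[OF jQ]
        by (intro divergence_term_first_order[OF pos diff, of "flip_coeff F u / 2"]) auto
    qed
    then show ?thesis unfolding bu Jp Q_def Z_def Z'_def .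
  qed
  show ?thesis
  proof (cases "q w = 0")
    case False
    then have qw: "0 < q w" using word_lawD(1)[OF W, of w] by simp
    note inv = jet_inverse_bigo_1[OF jZ' qw]
    have jR: "jet R (F u * q w + - 1 * (F w * q u))
       ((F u * flip_coeff q w + flip_coeff F u * q w) + (- 1 * (F w * flip_coeff q u + flip_coeff F w * q u) + 0 * (F w * q u)))"
      unfolding R_def by (intro jet_add jet_mult jet_const jP jP' jZ jZ')
    have mk: "F u * q w = F w * q u"
      using markov_law_eq[OF M, of w b "[v]"] lw n by (simp add: F_def uw)
    show ?thesis
    proof (cases "F u = 0")
      case True
      have "flip_coeff F u * q w = F w * flip_coeff q u + flip_coeff F w * q u"
        using flip_coeff_identity_allowed[OF M False, of b v] True lw n by (simp add: F_def[abs_def] uw)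
      then have "jet R 0 0" using jR True mk by (auto simp: algebra_simps)
      then have "R \<in> O[at_right 0](\<lambda>e. e\<^sup>2)" by (simp add: jet_bigo_sq)
      then have "(\<lambda>e. R e * inverse (Z' e)) \<in> O[at_right 0](\<lambda>e. e\<^sup>2 * 1)"
        using inv by (intro landau_o.big_mult)
      then have "(\<lambda>e. P e - Q e) \<in> O[at_right 0](\<lambda>e. e\<^sup>2 * 1)"
        by (rule iffD1[OF landau_o.big.in_cong[OF diffR]])
      then show ?thesis using True by (intro second) auto
    next
      case F0: False
      then have Fu: "0 < F u" using word_lawD(1)[OF W, of "b @ u"] by (simp add: F_def)
      have "R \<in> O[at_right 0](\<lambda>e. e)" using jR mk by (intro jet_bigo_id) simp
      then have "(\<lambda>e. R e * inverse (Z' e)) \<in> O[at_right 0](\<lambda>e. e * 1)"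
        using inv by (intro landau_o.big_mult)
      then have "(\<lambda>e. P e - Q e) \<in> O[at_right 0](\<lambda>e. e * 1)"
        by (rule iffD1[OF landau_o.big.in_cong[OF diffR]])
      then have diff: "(\<lambda>e. P e - Q e) \<in> O[at_right 0](\<lambda>e. e)" by simp
      have "(Q \<longlongrightarrow> F w * q u / q w) (at_right 0)"
        unfolding Q_def using qw by (intro tendsto_intros jet_tendsto[OF jP'] jet_tendsto[OF jZ] jet_tendsto[OF jZ']) auto
      moreover have "F w * q u / q w = F u" using mk qw by (simp add: field_simps)
      ultimately have "\<forall>\<^sub>F e in at_right 0. F u / 2 < Q e"
        using order_tendstoD(1)[of Q "F u" "at_right 0" "F u / 2"] Fu by simp
      then have "\<forall>\<^sub>F e in at_right 0. F u / 2 \<le> Q e" by eventually_elim simp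
      then have "\<exists>K. \<forall>\<^sub>F e in at_right 0. P e * ln (P e / Q e) \<le> K * (e\<^sup>2 * ln (1 / e)) + (P e - Q e)"
        using Fu by (intro divergence_term_regular[OF pos diff, of "F u / 2"]) auto
      then show ?thesis unfolding bu Jp Q_def Z_def Z'_def .
    qed
  next
    case True
    have z: "F u = 0" "F w = 0" "q u = 0"
      using True markov_zero_mid[OF M, of w b "[v]"] markov_zero_right[OF M, of w b] markov_zero_left[OF M, of w "[v]"]
      by (auto simp: F_def uw)
    have h0: "0 \<le> flip_coeff q w" using True word_lawD(1)[OF W] by (intro flip_coeff_nonneg) auto
    show ?thesis
    proof (cases "flip_coeff q w = 0")
      \<comment> \<open>No single flip repairs \<open>w\<close>, so \<open>w\<close> occurs as an
        output with probability \<open>O(e^2)\<close>, which dominates both \<open>P\<close> and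
        \<open>Q\<close>.\<close>
      case h: True
      then have Z'2: "Z' \<in> O[at_right 0](\<lambda>e. e\<^sup>2)" using jZ' True by (simp add: jet_bigo_sq)
      have "P \<in> O[at_right 0](Z')"
        by (rule landau_o.bigI[of 1]) (use facts in \<open>auto elim!: eventually_mono\<close>)
      then have P2: "P \<in> O[at_right 0](\<lambda>e. e\<^sup>2)" using Z'2 by (rule landau_o.big_trans)
      have "Q \<in> O[at_right 0](Z')"
      proof (rule landau_o.bigI[of 1])
        show "\<forall>\<^sub>F e in at_right 0. norm (Q e) \<le> 1 * norm (Z' e)"
          using facts
        proof eventually_elim
          case (elim e)
          have "Q e = P' e / Z' e * Z e" by (simp add: Q_def)
          also have "\<dots> \<le> 1 * Z e" using elim by (intro mult_right_mono) auto
          finally have "Q e \<le> Z' e" using elim by simp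
          moreover have "0 \<le> Q e" using elim by (simp add: Q_def)
          ultimately show ?case by simp
        qed
      qed simp
      then have Q2: "Q \<in> O[at_right 0](\<lambda>e. e\<^sup>2)" using Z'2 by (rule landau_o.big_trans)
      have "\<exists>K. \<forall>\<^sub>F e in at_right 0. P e * ln (P e / Q e) \<le> K * (e\<^sup>2 * ln (1 / e)) + (P e - Q e)"
        by (rule divergence_term_second_order[OF pos P2 Q2 k0 logb])
      then show ?thesis unfolding bu Jp Q_def Z_def Z'_def .
    next
      case False
      then have h: "0 < flip_coeff q w" using h0 by simp
      let ?a = "flip_coeff F u" and ?a' = "flip_coeff F w" and ?c = "flip_coeff q u" and ?h = "flip_coeff q w"
      have id: "?a * ?h = ?a' * ?c"
        using flip_coeff_identity_forbidden[OF M True, of b v] lw n by (simp add: F_def[abs_def] uw)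
      have r: "(\<lambda>e. P e - ?a * e) \<in> O[at_right 0](\<lambda>e. e\<^sup>2)" "(\<lambda>e. P' e - ?a' * e) \<in> O[at_right 0](\<lambda>e. e\<^sup>2)"
        "(\<lambda>e. Z e - ?c * e) \<in> O[at_right 0](\<lambda>e. e\<^sup>2)" "(\<lambda>e. Z' e - ?h * e) \<in> O[at_right 0](\<lambda>e. e\<^sup>2)"
        using jP jP' jZ jZ' z True by (simp_all add: jet_def)
      have o1: "P \<in> O[at_right 0](\<lambda>e. e)" "P' \<in> O[at_right 0](\<lambda>e. e)"
        using jP jP' z by (auto intro: jet_bigo_id)
      have o2: "(\<lambda>e. c * e) \<in> O[at_right 0](\<lambda>e::real. e)" for c :: real by simp
      \<comment> \<open>Now \<open>Z'\<close> itself is of order \<open>e\<close>, so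
        \<open>R\<close> has to be of third order for the quotient to be of second. The terms of
        order \<open>e^2\<close> in \<open>R\<close> cancel by \<open>id\<close>.\<close>
      have "(\<lambda>e. P e * (Z' e - ?h * e) + (P e - ?a * e) * (?h * e)
          - (P' e * (Z e - ?c * e) + (P' e - ?a' * e) * (?c * e))) \<in> O[at_right 0](\<lambda>e. e * e\<^sup>2)"
        using landau_o.big_mult[OF o1(1) r(4)] landau_o.big_mult[OF r(1) o2[of ?h]]
          landau_o.big_mult[OF o1(2) r(3)] landau_o.big_mult[OF r(2) o2[of ?c]]
        by (intro sum_in_bigo) (simp_all add: mult.commute[of "_\<^sup>2"])
      also have "(\<lambda>e. P e * (Z' e - ?h * e) + (P e - ?a * e) * (?h * e)
          - (P' e * (Z e - ?c * e) + (P' e - ?a' * e) * (?c * e))) = R"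
        using id by (auto simp: R_def fun_eq_iff algebra_simps) 
      finally have R3: "R \<in> O[at_right 0](\<lambda>e. e * e\<^sup>2)" .
      have "(\<lambda>e. inverse (Z' e)) \<in> O[at_right 0](\<lambda>e. inverse e)"
      proof (rule landau_o.bigI[of "2 / ?h"])
        have "\<forall>\<^sub>F e in at_right 0. ?h / 2 * e \<le> Z' e"
          using jZ' True h by (intro jet_first_order_lower) auto
        then show "\<forall>\<^sub>F e in at_right 0. norm (inverse (Z' e)) \<le> 2 / ?h * norm (inverse e)"
          using eventually_small
        proof eventually_elim
          case (elim e)
          then have "0 < ?h / 2 * e" using h by simp
          then have "inverse (Z' e) \<le> inverse (?h / 2 * e)" using elim by (intro le_imp_inverse_le) auto
          moreover have "0 < Z' e" using \<open>0 < ?h / 2 * e\<close> elim by linarith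
          ultimately show ?case using elim by (simp add: field_simps)
        qed
      qed (use h in auto)
      then have "(\<lambda>e. R e * inverse (Z' e)) \<in> O[at_right 0](\<lambda>e. e * e\<^sup>2 * inverse e)"
        using R3 by (intro landau_o.big_mult)
      also have "(\<lambda>e::real. e * e\<^sup>2 * inverse e) \<in> O[at_right 0](\<lambda>e. e\<^sup>2)"
        by real_asymp
      finally have "(\<lambda>e. R e * inverse (Z' e)) \<in> O[at_right 0](\<lambda>e. e\<^sup>2)" .
      then have "(\<lambda>e. P e - Q e) \<in> O[at_right 0](\<lambda>e. e\<^sup>2)"
        by (rule iffD1[OF landau_o.big.in_cong[OF diffR]])
      then show ?thesis using z by (intro second) auto
    qed
  qed
qed

text \<open>The difference is the conditional mutual information of the last output letter and the
  input state \<open>b\<close>, given the other outputs in the window. As a relative entropy it is a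
  sum of the terms just bounded, and the linear parts of those bounds sum to 0 because both laws
  have mass 1.\<close>

lemma state_cond_entropy_bound:
  assumes n: "3 * m \<le> n"
  shows "\<exists>K. \<forall>\<^sub>F e in at_right 0. cond_entropy n (noisy e q) - state_cond_entropy e \<le> K * (e\<^sup>2 * ln (1 / e))"
proof -
  note W = markov_law_word_law[OF M]
  let ?Q = "\<lambda>e b u. joint_prob e b (butlast u) * noisy e q u / noisy e q (butlast u)"
  have "\<exists>K. \<forall>\<^sub>F e in at_right 0. joint_prob e b u * ln (joint_prob e b u / ?Q e b u)
      \<le> K * (e\<^sup>2 * ln (1 / e)) + (joint_prob e b u - ?Q e b u)"
    if "b \<in> words m" "u \<in> words (Suc n)" for b u
  proof (cases "q b = 0")
    case True
    then have "q (b @ y) = 0" for y using markov_zero_left[OF M] by blast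
    then have "joint_prob e b u = 0" for e u by (simp add: joint_prob_def noisy_def)
    then show ?thesis by (intro exI[of _ 0]) simp
  next
    case False
    then show ?thesis using that n by (intro divergence_term_bound) auto
  qed
  then have "\<forall>x\<in>words m \<times> words (Suc n). \<exists>K. \<forall>\<^sub>F e in at_right 0.
      joint_prob e (fst x) (snd x) * ln (joint_prob e (fst x) (snd x) / ?Q e (fst x) (snd x))
      \<le> K * (e\<^sup>2 * ln (1 / e)) + (joint_prob e (fst x) (snd x) - ?Q e (fst x) (snd x))"
    by auto
  then obtain K where K: "\<And>x. x \<in> words m \<times> words (Suc n) \<Longrightarrow> \<forall>\<^sub>F e in at_right 0.
      joint_prob e (fst x) (snd x) * ln (joint_prob e (fst x) (snd x) / ?Q e (fst x) (snd x))
      \<le> K x * (e\<^sup>2 * ln (1 / e)) + (joint_prob e (fst x) (snd x) - ?Q e (fst x) (snd x))"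
    by (subst (asm) bchoice_iff) blast
  have ev: "\<forall>\<^sub>F e in at_right 0. \<forall>x\<in>words m \<times> words (Suc n).
      joint_prob e (fst x) (snd x) * ln (joint_prob e (fst x) (snd x) / ?Q e (fst x) (snd x))
      \<le> K x * (e\<^sup>2 * ln (1 / e)) + (joint_prob e (fst x) (snd x) - ?Q e (fst x) (snd x))"
    by (rule eventually_ball_finite) (use K in auto)
  define C where "C = (\<Sum>x\<in>words m \<times> words (Suc n). K x)"
  have "\<forall>\<^sub>F e in at_right 0. cond_entropy n (noisy e q) - state_cond_entropy e \<le> C * (e\<^sup>2 * ln (1 / e))"
    using ev eventually_small
  proof eventually_elim
    case (elim e)
    then have e: "0 < e" "e \<le> 1 / 2" by auto
    have WZ: "word_law (noisy e q)" using e by (intro word_law_noisy W) auto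
    have Zp: "0 < noisy e q u" for u using noisy_bounds(2)[OF W e] .
    have J0: "0 \<le> joint_prob e b u" for b u using e by (intro joint_prob_nonneg) auto
    have "cond_entropy n (noisy e q) - state_cond_entropy e
        = (\<Sum>b\<in>words m. \<Sum>u\<in>words (Suc n). joint_prob e b u * ln (joint_prob e b u / joint_prob e b (butlast u)))
          - (\<Sum>u\<in>words (Suc n). (\<Sum>b\<in>words m. joint_prob e b u) * ln (noisy e q u / noisy e q (butlast u)))"
      by (simp add: cond_entropy_def state_cond_entropy_def word_lawD(5)[OF WZ] sum_joint_prob)
    also have "(\<Sum>u\<in>words (Suc n). (\<Sum>b\<in>words m. joint_prob e b u) * ln (noisy e q u / noisy e q (butlast u)))
        = (\<Sum>b\<in>words m. \<Sum>u\<in>words (Suc n). joint_prob e b u * ln (noisy e q u / noisy e q (butlast u)))"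
      by (subst sum.swap) (simp add: sum_distrib_right)
    also have "(\<Sum>b\<in>words m. \<Sum>u\<in>words (Suc n). joint_prob e b u * ln (joint_prob e b u / joint_prob e b (butlast u)))
        - (\<Sum>b\<in>words m. \<Sum>u\<in>words (Suc n). joint_prob e b u * ln (noisy e q u / noisy e q (butlast u)))
        = (\<Sum>b\<in>words m. \<Sum>u\<in>words (Suc n). joint_prob e b u * ln (joint_prob e b u / ?Q e b u))"
      unfolding sum_subtractf[symmetric]
    proof (intro sum.cong refl)
      fix b u assume u: "u \<in> words (Suc n)"
      show "joint_prob e b u * ln (joint_prob e b u / joint_prob e b (butlast u))
          - joint_prob e b u * ln (noisy e q u / noisy e q (butlast u))
          = joint_prob e b u * ln (joint_prob e b u / ?Q e b u)"
      proof (cases "joint_prob e b u = 0")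
        case False
        then have "0 < joint_prob e b u" using J0[of b u] by simp
        moreover have "u \<noteq> []" using u by auto
        then have "joint_prob e b u \<le> joint_prob e b (butlast u)"
          using e by (intro joint_prob_butlast) auto
        ultimately have "0 < joint_prob e b u" "0 < joint_prob e b (butlast u)" by auto
        then show ?thesis using Zp[of u] Zp[of "butlast u"] by (simp add: ln_div ln_mult algebra_simps)
      qed simp
    qed
    also have "\<dots> \<le> (\<Sum>b\<in>words m. \<Sum>u\<in>words (Suc n). K (b, u) * (e\<^sup>2 * ln (1 / e)) + (joint_prob e b u - ?Q e b u))"
      using elim by (intro sum_mono) auto
    also have "\<dots> = C * (e\<^sup>2 * ln (1 / e))
        + (\<Sum>b\<in>words m. (\<Sum>u\<in>words (Suc n). joint_prob e b u) - (\<Sum>u\<in>words (Suc n). ?Q e b u))"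
      by (simp add: sum.distrib sum_subtractf C_def sum.cartesian_product' sum_distrib_right)
    also have "(\<Sum>b\<in>words m. (\<Sum>u\<in>words (Suc n). joint_prob e b u) - (\<Sum>u\<in>words (Suc n). ?Q e b u)) = 0"
    proof -
      have "(\<Sum>b\<in>words m. \<Sum>u\<in>words (Suc n). joint_prob e b u) = 1"
        by (subst sum.swap) (simp add: sum_joint_prob word_law_sum[OF WZ])
      moreover have "(\<Sum>b\<in>words m. \<Sum>u\<in>words (Suc n). ?Q e b u) = (\<Sum>u\<in>words (Suc n). noisy e q u)"
      proof (subst sum.swap, rule sum.cong[OF refl])
        fix u
        have "(\<Sum>b\<in>words m. ?Q e b u) = (\<Sum>b\<in>words m. joint_prob e b (butlast u)) * noisy e q u / noisy e q (butlast u)"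
          by (simp add: sum_distrib_right sum_divide_distrib)
        then show "(\<Sum>b\<in>words m. ?Q e b u) = noisy e q u"
          using Zp[of "butlast u"] by (simp add: sum_joint_prob)
      qed
      ultimately show ?thesis by (simp add: sum_subtractf word_law_sum[OF WZ])
    qed
    finally show ?case by simp
  qed
  then show ?thesis by blast
qed

end

section \<open>Expansion of the noisy conditional entropy\<close>

lemma jet_first_order_ln:
  assumes f: "jet f 0 h" and h: "0 < h"
  shows "(\<lambda>e. ln (f e) - (ln e + ln h)) \<in> O[at_right 0](\<lambda>e. e)"
proof -
  obtain K where K: "0 < K" "\<forall>\<^sub>F e in at_right 0. norm (f e - 0 - h * e) \<le> K * norm (e\<^sup>2)"
    using f unfolding jet_def by (elim landau_o.bigE)
  show ?thesis
  proof (rule landau_o.bigI[of "2 * K / h"])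
    show "\<forall>\<^sub>F e in at_right 0. norm (ln (f e) - (ln e + ln h)) \<le> 2 * K / h * norm e"
      using K(2) jet_first_order_lower[OF f h] eventually_small
    proof eventually_elim
      case (elim e)
      have he: "0 < h * e" using h elim by simp
      then have fe: "0 < f e" using elim by linarith
      have d: "\<bar>f e - h * e\<bar> \<le> K * e\<^sup>2" using elim by simp
      \<comment> \<open>The inequality \<open>ln x \<le> x - 1\<close>, used for the quotient and
        for its inverse, bounds the logarithm on both sides.\<close>
      have "ln (f e / (h * e)) \<le> f e / (h * e) - 1" using fe he by (intro ln_le_minus_one) simp
      also have "\<dots> = (f e - h * e) / (h * e)" using he h elim by (simp add: field_simps)
      also have "\<dots> \<le> K * e\<^sup>2 / (h / 2 * e)"
        using d he h elim K by (intro frac_le) auto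
      finally have 1: "ln (f e / (h * e)) \<le> K * e\<^sup>2 / (h / 2 * e)" .
      have "ln (h * e / f e) \<le> h * e / f e - 1" using fe he by (intro ln_le_minus_one) simp
      also have "\<dots> = (h * e - f e) / f e" using fe by (simp add: field_simps)
      also have "\<dots> \<le> K * e\<^sup>2 / (h / 2 * e)"
        using d he h elim K by (intro frac_le) auto
      finally have 2: "ln (h * e / f e) \<le> K * e\<^sup>2 / (h / 2 * e)" .
      have "K * e\<^sup>2 / (h / 2 * e) = 2 * K / h * e"
        using elim h by (simp add: power2_eq_square)
      moreover have "ln (f e / (h * e)) = ln (f e) - (ln e + ln h)" "ln (h * e / f e) = (ln e + ln h) - ln (f e)"
        using fe elim h by (simp_all add: ln_div ln_mult)
      ultimately show ?case using 1 2 elim by (simp add: abs_le_iff)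
    qed
  qed (use K h in auto)
qed

lemma sq_bigo_sq_ln: "(\<lambda>e::real. e\<^sup>2) \<in> O[at_right 0](\<lambda>e. e\<^sup>2 * ln (1 / e))"
  by real_asymp

context
  fixes q :: "bool list \<Rightarrow> real" and n :: nat
  assumes W: "word_law q"
begin

text \<open>The contribution of \<open>u\<close> to the coefficient of \<open>e\<close>. The cases
  are an allowed word, a forbidden word after an allowed context, and a forbidden context, one for
  each sum in \<open>g_coef\<close>. In the last case words with \<open>flip_coeff q u = 0\<close>
  contribute 0.\<close>

definition g_term :: "bool list \<Rightarrow> real" where
  "g_term u = (let q' = q (butlast u); h' = flip_coeff q (butlast u) in
     if q u \<noteq> 0 then - (flip_coeff q u * ln (q u / q') + (flip_coeff q u * q' - h' * q u) / q')
     else if q' \<noteq> 0 then - (flip_coeff q u * ln (flip_coeff q u / q'))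
     else - (flip_coeff q u * ln (flip_coeff q u / h')))"

definition f_term :: "bool list \<Rightarrow> real" where
  "f_term u = (if q (butlast u) \<noteq> 0 \<and> q u = 0 then flip_coeff q u else 0)"

text \<open>After summation over the last letter, the flips of that letter cancel against its loss
  terms.\<close>

lemma flip_coeff_butlast:
  assumes "u \<noteq> []"
  shows "right_marginal (flip_coeff q) (butlast u) = flip_coeff q (butlast u)"
proof -
  have "flip_coeff q (w @ [True]) + flip_coeff q (w @ [False]) = flip_coeff q w" for w
  proof -
    have "(\<lambda>x. q (x @ [True]) + q (x @ [False])) = q"
      using word_lawD(3)[OF W] by auto
    then have "flip_sum (\<lambda>x. q (x @ [True])) w + flip_sum (\<lambda>x. q (x @ [False])) w = flip_sum q w"
      by (simp add: flip_sum_add[symmetric])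
    moreover have h: "flip_coeff q (w @ [v]) = flip_sum (\<lambda>x. q (x @ [v])) w + q (w @ [\<not> v])
        - (real (length w) + 1) * q (w @ [v])" for v
      by (simp add: flip_coeff_def flip_sum_append flip_sum_Cons)
    note h[of True] h[of False]
    moreover have "flip_coeff q w = flip_sum q w - real (length w) * (q (w @ [True]) + q (w @ [False]))"
      by (simp add: flip_coeff_def word_lawD(3)[OF W])
    ultimately show ?thesis by (simp add: algebra_simps)
  qed
  then show ?thesis by (simp add: right_marginal_def)
qed

lemma flip_coeff_le_butlast:
  assumes "u \<noteq> []" "q (butlast u) = 0"
  shows "0 \<le> flip_coeff q u" "flip_coeff q u \<le> flip_coeff q (butlast u)"
proof -
  obtain w v where u: "u = w @ [v]" using assms(1) by (cases u rule: rev_cases) auto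
  have z: "q (w @ [v]) = 0" for v
    using word_law_eq_0[OF W, of w "[]" "[v]"] assms u by simp
  have h: "0 \<le> flip_coeff q (w @ [v])" for v
    using z word_lawD(1)[OF W] by (intro flip_coeff_nonneg) auto
  show "0 \<le> flip_coeff q u" using h u by simp
  have "flip_coeff q (w @ [True]) + flip_coeff q (w @ [False]) = flip_coeff q w"
    using flip_coeff_butlast[OF assms(1)] by (simp add: right_marginal_def u)
  then show "flip_coeff q u \<le> flip_coeff q (butlast u)"
    using h[of True] h[of False] unfolding u by (cases v) auto
qed

text \<open>Allowed words have smooth terms. A forbidden word with flip coefficient
  \<open>h > 0\<close> has probability close to \<open>h * e\<close>; its logarithm contributes
  \<open>e * ln (1 / e)\<close> only when the context stays of order 1, since otherwise
  \<open>ln e\<close> cancels in the quotient. This is why \<open>f_term\<close> retains allowed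
  contexts only.\<close>

lemma entropy_term_expansion:
  assumes u: "length u = Suc n"
  shows "(\<lambda>e. - (noisy e q u * log_ratio q e u) - (- (q u * ln (q u / q (butlast u)))
      + f_term u * e * ln (1 / e) + g_term u * e)) \<in> O[at_right 0](\<lambda>e. e\<^sup>2 * ln (1 / e))"
proof -
  have ne: "u \<noteq> []" using u by auto
  let ?q' = "q (butlast u)" and ?h = "flip_coeff q u" and ?h' = "flip_coeff q (butlast u)"
  define Z Z' where "Z e = noisy e q u" and "Z' e = noisy e q (butlast u)" for e
  have jZ: "jet Z (q u) ?h" and jZ': "jet Z' ?q' ?h'" unfolding Z_def Z'_def by (rule jet_noisy)+
  have Zpos: "\<forall>\<^sub>F e in at_right 0. 0 < Z e \<and> 0 < Z' e"
    using eventually_small by eventually_elim (use noisy_bounds(2)[OF W] in \<open>auto simp: Z_def Z'_def\<close>)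
  have lr: "\<forall>\<^sub>F e in at_right 0. log_ratio q e u = ln (Z e) - ln (Z' e)"
    using Zpos by eventually_elim (simp add: log_ratio_def[OF W] ln_div Z_def Z'_def)
  note lrO = log_ratio_bigo[OF W u]
  have q0: "0 \<le> q u" "0 \<le> ?q'" "q u \<le> ?q'" using word_lawD(1)[OF W] word_law_butlast[OF W ne] by auto
  have zero: ?thesis if z: "q u = 0" "?h = 0"
  proof -
    have "Z \<in> O[at_right 0](\<lambda>e. e\<^sup>2)" using jZ z by (simp add: jet_bigo_sq)
    then have "(\<lambda>e. Z e * log_ratio q e u) \<in> O[at_right 0](\<lambda>e. e\<^sup>2 * ln (1 / e))"
      using lrO by (rule landau_o.big_mult)
    then show ?thesis using z by (simp add: f_term_def g_term_def Z_def)
  qed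
  \<comment> \<open>The function \<open>B\<close> is the leading part of \<open>ln Z'\<close>: a
    constant for an allowed context, and \<open>ln e\<close> plus a constant for a context that one
    flip repairs.\<close>
  have first: ?thesis
    if z: "q u = 0" and h: "0 < ?h"
      and B: "(\<lambda>e. ln (Z' e) - B e) \<in> O[at_right 0](\<lambda>e. e)"
      and coeff: "\<And>e. 0 < e \<Longrightarrow> f_term u * ln (1 / e) + g_term u = - ?h * (ln e + ln ?h - B e)" for B
  proof -
    have "(\<lambda>e. Z e - ?h * e) \<in> O[at_right 0](\<lambda>e. e\<^sup>2)" using jZ z by (simp add: jet_def)
    then have 1: "(\<lambda>e. (Z e - ?h * e) * log_ratio q e u) \<in> O[at_right 0](\<lambda>e. e\<^sup>2 * ln (1 / e))"
      using lrO by (rule landau_o.big_mult)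
    have "(\<lambda>e. (ln (Z e) - (ln e + ln ?h)) - (ln (Z' e) - B e)) \<in> O[at_right 0](\<lambda>e. e)"
    proof (rule sum_in_bigo(2)[OF jet_first_order_ln[OF _ h] B])
      show "jet Z 0 ?h" using jZ z by simp
    qed
    then have "(\<lambda>e. (?h * e) * ((ln (Z e) - (ln e + ln ?h)) - (ln (Z' e) - B e))) \<in> O[at_right 0](\<lambda>e. e * e)"
      by (intro landau_o.big_mult) auto
    also have "(\<lambda>e::real. e * e) \<in> O[at_right 0](\<lambda>e. e\<^sup>2 * ln (1 / e))" by real_asymp
    finally have 2: "(\<lambda>e. (?h * e) * ((ln (Z e) - (ln e + ln ?h)) - (ln (Z' e) - B e)))
        \<in> O[at_right 0](\<lambda>e. e\<^sup>2 * ln (1 / e))" .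
    have "(\<lambda>e. - ((Z e - ?h * e) * log_ratio q e u) - (?h * e) * ((ln (Z e) - (ln e + ln ?h)) - (ln (Z' e) - B e)))
        \<in> O[at_right 0](\<lambda>e. e\<^sup>2 * ln (1 / e))"
      using 1 2 by (intro sum_in_bigo(2)) auto
    moreover have ev: "\<forall>\<^sub>F e in at_right 0.
        - ((Z e - ?h * e) * log_ratio q e u) - (?h * e) * ((ln (Z e) - (ln e + ln ?h)) - (ln (Z' e) - B e))
        = - (noisy e q u * log_ratio q e u) - (- (q u * ln (q u / ?q')) + f_term u * e * ln (1 / e) + g_term u * e)"
      using lr eventually_small
    proof eventually_elim
      case (elim e)
      have "f_term u * e * ln (1 / e) + g_term u * e = e * (f_term u * ln (1 / e) + g_term u)"
        by (simp add: algebra_simps)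
      also have "\<dots> = e * (- ?h * (ln e + ln ?h - B e))" using coeff[of e] elim by simp
      finally have "f_term u * e * ln (1 / e) + g_term u * e = e * (- ?h * (ln e + ln ?h - B e))" .
      moreover have "e * (?h * log_ratio q e u) = e * (?h * ln (Z e)) - e * (?h * ln (Z' e))"
        unfolding elim(1) by (simp only: right_diff_distrib)
      ultimately show ?case using z by (simp add: Z_def algebra_simps)
    qed
    ultimately show ?thesis
      using iffD1[OF landau_o.big.in_cong[OF ev]] by blast
  qed
  show ?thesis
  proof (cases "q u = 0")
    case False
    then have qu: "0 < q u" and qb: "0 < ?q'" using q0 by auto
    have "jet (\<lambda>e. Z e * (ln (Z e) + - 1 * ln (Z' e)))
        (q u * (ln (q u) + - 1 * ln ?q'))
        (q u * (?h / q u + (- 1 * (?h' / ?q') + 0 * ln ?q')) + ?h * (ln (q u) + - 1 * ln ?q'))"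
      by (intro jet_mult jet_add jZ jet_ln[OF jZ qu] jet_const jet_ln[OF jZ' qb])
    then have "(\<lambda>e. Z e * (ln (Z e) + - 1 * ln (Z' e)) - q u * (ln (q u) + - 1 * ln ?q')
        - (q u * (?h / q u + (- 1 * (?h' / ?q') + 0 * ln ?q')) + ?h * (ln (q u) + - 1 * ln ?q')) * e)
        \<in> O[at_right 0](\<lambda>e. e\<^sup>2 * ln (1 / e))"
      unfolding jet_def using sq_bigo_sq_ln by (rule landau_o.big_trans)
    then have "(\<lambda>e. - (Z e * (ln (Z e) + - 1 * ln (Z' e)) - q u * (ln (q u) + - 1 * ln ?q')
        - (q u * (?h / q u + (- 1 * (?h' / ?q') + 0 * ln ?q')) + ?h * (ln (q u) + - 1 * ln ?q')) * e))
        \<in> O[at_right 0](\<lambda>e. e\<^sup>2 * ln (1 / e))"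
      by (simp only: landau_o.big.uminus_in_iff)
    moreover have ev: "\<forall>\<^sub>F e in at_right 0. - (Z e * (ln (Z e) + - 1 * ln (Z' e)) - q u * (ln (q u) + - 1 * ln ?q')
        - (q u * (?h / q u + (- 1 * (?h' / ?q') + 0 * ln ?q')) + ?h * (ln (q u) + - 1 * ln ?q')) * e)
        = - (noisy e q u * log_ratio q e u) - (- (q u * ln (q u / ?q')) + f_term u * e * ln (1 / e) + g_term u * e)"
      using lr
    proof eventually_elim
      case (elim e)
      have l: "ln (q u / ?q') = ln (q u) - ln ?q'" using qu qb by (simp add: ln_div)
      have g: "g_term u = - (?h * (ln (q u) - ln ?q') + (?h - ?h' * q u / ?q'))"
        using qu qb by (simp add: g_term_def Let_def l diff_divide_distrib)
      show ?case
        unfolding elim l g using qu qb by (simp add: f_term_def Z_def algebra_simps)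
    qed
    ultimately show ?thesis
      using iffD1[OF landau_o.big.in_cong[OF ev]] by blast
  next
    case z: True
    have h0: "0 \<le> ?h" using z word_lawD(1)[OF W] by (intro flip_coeff_nonneg) auto
    show ?thesis
    proof (cases "?h = 0")
      case True
      then show ?thesis using z by (intro zero)
    next
      case False
      then have h: "0 < ?h" using h0 by simp
      show ?thesis
      proof (cases "?q' = 0")
        case True
        have h': "0 < ?h'" using flip_coeff_le_butlast[OF ne True] h by simp
        show ?thesis
        proof (rule first[OF z h])
          show "(\<lambda>e. ln (Z' e) - (ln e + ln ?h')) \<in> O[at_right 0](\<lambda>e. e)"
            using jZ' True h' by (intro jet_first_order_ln) auto
          show "f_term u * ln (1 / e) + g_term u = - ?h * (ln e + ln ?h - (ln e + ln ?h'))" if "0 < e" for e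
            using True z h h' by (simp add: f_term_def g_term_def ln_div)
        qed
      next
        case False
        then have qb: "0 < ?q'" using q0 by simp
        show ?thesis
        proof (rule first[OF z h])
          show "(\<lambda>e. ln (Z' e) - ln ?q') \<in> O[at_right 0](\<lambda>e. e)"
            by (rule jet_diff_bigo_id[OF jet_ln[OF jZ' qb]])
          show "f_term u * ln (1 / e) + g_term u = - ?h * (ln e + ln ?h - ln ?q')" if "0 < e" for e
            using False z h qb that by (simp add: f_term_def g_term_def ln_div algebra_simps)
        qed
      qed
    qed
  qed
qed

lemma cond_entropy_expansion:
  "(\<lambda>e. cond_entropy n (noisy e q) - (cond_entropy n q + (\<Sum>u\<in>words (Suc n). f_term u) * e * ln (1 / e)
      + (\<Sum>u\<in>words (Suc n). g_term u) * e)) \<in> O[at_right 0](\<lambda>e. e\<^sup>2 * ln (1 / e))"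
proof -
  have big: "(\<lambda>e. \<Sum>u\<in>words (Suc n). - (noisy e q u * log_ratio q e u) - (- (q u * ln (q u / q (butlast u)))
      + f_term u * e * ln (1 / e) + g_term u * e)) \<in> O[at_right 0](\<lambda>e. e\<^sup>2 * ln (1 / e))"
    by (intro big_sum_in_bigo entropy_term_expansion) auto
  have ev: "\<forall>\<^sub>F e in at_right 0. (\<Sum>u\<in>words (Suc n). - (noisy e q u * log_ratio q e u) - (- (q u * ln (q u / q (butlast u)))
      + f_term u * e * ln (1 / e) + g_term u * e))
      = cond_entropy n (noisy e q) - (cond_entropy n q + (\<Sum>u\<in>words (Suc n). f_term u) * e * ln (1 / e)
      + (\<Sum>u\<in>words (Suc n). g_term u) * e)"
    using eventually_small
  proof eventually_elim
    case (elim e)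
    then have WZ: "word_law (noisy e q)" by (intro word_law_noisy W) auto
    show ?case
      by (simp add: cond_entropy_def word_lawD(5)[OF W] word_lawD(5)[OF WZ] log_ratio_def[OF W]
          sum.distrib sum_subtractf sum_negf sum_distrib_right)
  qed
  show ?thesis
    by (rule iffD1[OF landau_o.big.in_cong[OF ev] big])
qed

end


section \<open>The coefficients\<close>

lemma sum_word_letter_pairs:
  fixes G :: "bool list \<Rightarrow> real"
  shows "(\<Sum>(w, v) \<in> {(w, v). length w = n \<and> Q w v}. G (w @ [v]))
    = (\<Sum>u\<in>words (Suc n). if Q (butlast u) (last u) then G u else 0)"
proof -
  have "(\<Sum>(w, v) \<in> {(w, v). length w = n \<and> Q w v}. G (w @ [v]))
      = (\<Sum>u\<in>{u \<in> words (Suc n). Q (butlast u) (last u)}. G u)"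
  proof (rule sum.reindex_bij_witness[of _ "\<lambda>u. (butlast u, last u)" "\<lambda>(w, v). w @ [v]"])
    fix u assume u: "u \<in> {u \<in> words (Suc n). Q (butlast u) (last u)}"
    then have "u \<noteq> []" by auto
    then show "(case (butlast u, last u) of (w, v) \<Rightarrow> w @ [v]) = u" by simp
    show "(butlast u, last u) \<in> {(w, v). length w = n \<and> Q w v}" using u by auto
  qed auto
  then show ?thesis
    using sum.inter_filter[OF finite_words[of "Suc n"], of G "\<lambda>u. Q (butlast u) (last u)"] by simp
qed

lemma butlast_last_word: "u \<in> words (Suc n) \<Longrightarrow> butlast u @ [last u] = u"
  by (rule append_butlast_last_id) auto

text \<open>The outputs of exact order \<open>e\<close> are the forbidden words that some single
  flip makes allowed, since the flip coefficient of a forbidden word is nonnegative. This resolves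
  the asymptotic condition in \<open>g_coef\<close>.\<close>

lemma noisy_theta_iff:
  assumes W: "word_law q"
  shows "(\<lambda>e. noisy e q u) \<in> \<Theta>[at_right 0](\<lambda>e. e) \<longleftrightarrow> q u = 0 \<and> flip_coeff q u \<noteq> 0"
proof
  assume T: "(\<lambda>e. noisy e q u) \<in> \<Theta>[at_right 0](\<lambda>e. e)"
  have J: "jet (\<lambda>e. noisy e q u) (q u) (flip_coeff q u)" by (rule jet_noisy)
  have "((\<lambda>e. noisy e q u) \<longlongrightarrow> 0) (at_right 0)"
  proof -
    obtain c where "\<forall>\<^sub>F e in at_right 0. norm (noisy e q u) \<le> c * norm e"
      using bigthetaD1[OF T] by (elim landau_o.bigE)
    moreover have "((\<lambda>e::real. c * norm e) \<longlongrightarrow> 0) (at_right 0)"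
      by (auto intro!: tendsto_eq_intros)
    ultimately show ?thesis by (rule Lim_null_comparison)
  qed
  then have q0: "q u = 0"
    using jet_tendsto[OF J] tendsto_unique[of "at_right (0::real)"] by force
  have "flip_coeff q u \<noteq> 0"
  proof
    assume "flip_coeff q u = 0"
    then have "(\<lambda>e. noisy e q u) \<in> O[at_right 0](\<lambda>e. e\<^sup>2)" using J q0 by (simp add: jet_bigo_sq)
    moreover have "(\<lambda>e. e) \<in> O[at_right 0](\<lambda>e. noisy e q u)"
      using T by (simp add: bigtheta_sym bigthetaD1)
    ultimately have "(\<lambda>e::real. e) \<in> O[at_right 0](\<lambda>e. e\<^sup>2)"
      by (rule landau_o.big_trans[rotated])
    moreover have "(\<lambda>e::real. e\<^sup>2) \<in> o[at_right 0](\<lambda>e. e)" by real_asymp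
    ultimately have "(\<lambda>e::real. e) \<in> o[at_right 0](\<lambda>e. e)" by (rule landau_o.big_small_trans)
    then have "\<forall>\<^sub>F e::real in at_right 0. e = 0" by (simp add: landau_o.small_refl_iff)
    then have "\<forall>\<^sub>F e::real in at_right 0. False" using eventually_small by eventually_elim simp
    then show False by (simp add: eventually_False)
  qed
  with q0 show "q u = 0 \<and> flip_coeff q u \<noteq> 0" by simp
next
  assume z: "q u = 0 \<and> flip_coeff q u \<noteq> 0"
  then have h: "0 < flip_coeff q u" using flip_coeff_nonneg[of q u] word_lawD(1)[OF W] by (simp add: less_le)
  have J: "jet (\<lambda>e. noisy e q u) 0 (flip_coeff q u)" using jet_noisy[of q u] z by simp
  have "(\<lambda>e. e) \<in> O[at_right 0](\<lambda>e. noisy e q u)"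
  proof (rule landau_o.bigI[of "2 / flip_coeff q u"])
    show "\<forall>\<^sub>F e in at_right 0. norm e \<le> 2 / flip_coeff q u * norm (noisy e q u)"
      using jet_first_order_lower[OF J h] eventually_small
    proof eventually_elim
      case (elim e)
      then have "0 < flip_coeff q u / 2 * e" using h by simp
      then have "0 \<le> noisy e q u" using elim by linarith
      then show ?case using elim h by (simp add: field_simps)
    qed
  qed (use h in auto)
  then show "(\<lambda>e. noisy e q u) \<in> \<Theta>[at_right 0](\<lambda>e. e)"
    using jet_bigo_id[OF J] by (intro bigthetaI) (simp_all add: bigomega_iff_bigo)
qed

lemma f_coef_eq_sum:
  assumes W: "word_law (word_prob X)"
  shows "f_coef n X = (\<Sum>u\<in>words (Suc n). f_term (word_prob X) u)"
proof -
  have A: "u \<in> allowed_words X \<longleftrightarrow> word_prob X u \<noteq> 0" for u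
    using word_lawD(1)[OF W, of u] by (auto simp: allowed_words_def less_le)
  show ?thesis
    unfolding f_coef_def
    using sum_word_letter_pairs[where G = "h_coef X" and n = n
        and Q = "\<lambda>w v. w \<in> allowed_words X \<and> w @ [v] \<notin> allowed_words X"]
    by (auto simp: f_term_def[OF W] A h_coef_eq_flip_coeff butlast_last_word intro!: sum.cong)
qed

lemma g_coef_eq_sum:
  assumes X: "path_measure X" and W: "word_law (word_prob X)"
  shows "g_coef n X = (\<Sum>u\<in>words (Suc n). g_term (word_prob X) u)"
proof -
  let ?q = "word_prob X"
  have A: "u \<in> allowed_words X \<longleftrightarrow> ?q u \<noteq> 0" for u
    using word_lawD(1)[OF W, of u] by (auto simp: allowed_words_def less_le)
  have theta: "(\<lambda>e. word_prob (bsc_output e X) u) \<in> \<Theta>[at_right 0](\<lambda>e. e) \<longleftrightarrow> ?q u = 0 \<and> flip_coeff ?q u \<noteq> 0" for u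
  proof -
    have ev: "\<forall>\<^sub>F e in at_right 0. word_prob (bsc_output e X) u = noisy e ?q u"
      using eventually_small by eventually_elim (simp add: word_prob_bsc_output(2)[OF X])
    show ?thesis
      unfolding noisy_theta_iff[OF W, symmetric] by (rule landau_theta.in_cong[OF ev])
  qed
  define G1 where "G1 u = flip_coeff ?q u * ln (?q u / ?q (butlast u))
    + (flip_coeff ?q u * ?q (butlast u) - flip_coeff ?q (butlast u) * ?q u) / ?q (butlast u)" for u
  define G2 where "G2 u = flip_coeff ?q u * ln (flip_coeff ?q u / ?q (butlast u))" for u
  define G3 where "G3 u = flip_coeff ?q u * ln (flip_coeff ?q u / flip_coeff ?q (butlast u))" for u
  have "g_coef n X = - (\<Sum>u\<in>words (Suc n). if ?q (butlast u @ [last u]) \<noteq> 0 then G1 u else 0)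
    - (\<Sum>u\<in>words (Suc n). if ?q (butlast u) \<noteq> 0 \<and> ?q (butlast u @ [last u]) = 0 then G2 u else 0)
    - (\<Sum>u\<in>words (Suc n). if (?q (butlast u) = 0 \<and> flip_coeff ?q (butlast u) \<noteq> 0) \<and>
         (?q (butlast u @ [last u]) = 0 \<and> flip_coeff ?q (butlast u @ [last u]) \<noteq> 0) then G3 u else 0)"
    unfolding g_coef_def theta A cond_word_prob_def h_coef_eq_flip_coeff
    using sum_word_letter_pairs[where n = n and Q = "\<lambda>w v. ?q (w @ [v]) \<noteq> 0" and G = G1]
      sum_word_letter_pairs[where n = n and Q = "\<lambda>w v. ?q w \<noteq> 0 \<and> ?q (w @ [v]) = 0" and G = G2]
      sum_word_letter_pairs[where n = n and Q = "\<lambda>w v. (?q w = 0 \<and> flip_coeff ?q w \<noteq> 0) \<and> (?q (w @ [v]) = 0 \<and> flip_coeff ?q (w @ [v]) \<noteq> 0)" and G = G3]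
    by (simp add: G1_def G2_def G3_def)
  also have "\<dots> = (\<Sum>u\<in>words (Suc n). - (if ?q (butlast u @ [last u]) \<noteq> 0 then G1 u else 0)
    - (if ?q (butlast u) \<noteq> 0 \<and> ?q (butlast u @ [last u]) = 0 then G2 u else 0)
    - (if (?q (butlast u) = 0 \<and> flip_coeff ?q (butlast u) \<noteq> 0) \<and>
         (?q (butlast u @ [last u]) = 0 \<and> flip_coeff ?q (butlast u @ [last u]) \<noteq> 0) then G3 u else 0))"
    by (simp only: sum_subtractf sum_negf)
  also have "\<dots> = (\<Sum>u\<in>words (Suc n). g_term ?q u)"
  proof (intro sum.cong refl)
    fix u assume uw: "u \<in> words (Suc n)"
    then have ne: "u \<noteq> []" by auto
    have z: "?q (butlast u) = 0 \<Longrightarrow> ?q u = 0"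
      using word_law_butlast[OF W ne] word_lawD(1)[OF W, of u] by simp
    show "- (if ?q (butlast u @ [last u]) \<noteq> 0 then G1 u else 0)
      - (if ?q (butlast u) \<noteq> 0 \<and> ?q (butlast u @ [last u]) = 0 then G2 u else 0)
      - (if (?q (butlast u) = 0 \<and> flip_coeff ?q (butlast u) \<noteq> 0) \<and>
           (?q (butlast u @ [last u]) = 0 \<and> flip_coeff ?q (butlast u @ [last u]) \<noteq> 0) then G3 u else 0) = g_term ?q u"
      unfolding butlast_last_word[OF uw] using z
      by (auto simp: g_term_def[OF W] G1_def G2_def G3_def Let_def)
  qed
  finally show ?thesis .
qed

section \<open>The noisy constrained capacity\<close>

lemma card_words: "(\<Sum>u\<in>words N. 1) = (2 :: real) ^ N"
proof (induction N)
  case (Suc N)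
  have "(\<Sum>u\<in>words (Suc N). 1 :: real) = (\<Sum>u\<in>words N. 1) + (\<Sum>u\<in>words N. 1)"
    by (simp only: sum_words_Cons sum.distrib)
  then show ?case using Suc by (simp only: power_Suc mult_2)
qed simp

lemma block_entropy_cong: "(\<And>u. length u = N \<Longrightarrow> P u = R u) \<Longrightarrow> block_entropy P N = block_entropy R N"
  unfolding block_entropy_def by simp

lemma noisy_cong: "(\<And>x. length x = length z \<Longrightarrow> F x = G x) \<Longrightarrow> noisy e F z = noisy e G z"
  unfolding noisy_def by simp

lemma block_entropy_le_ln_2:
  assumes "\<And>u. 0 \<le> P u" "(\<Sum>u\<in>words N. P u) = 1"
  shows "block_entropy P N \<le> real N * ln 2"
proof -
  have "(\<Sum>u\<in>words N. P u * ln ((1 / 2) ^ N)) \<le> (\<Sum>u\<in>words N. P u * ln (P u))"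
  proof (rule gibbs)
    have "(\<Sum>u\<in>words N. (1 / 2 :: real) ^ N) = (\<Sum>u\<in>words N. 1) * (1 / 2) ^ N"
      by (simp only: sum_distrib_right mult_1)
    then show "(\<Sum>u\<in>words N. (1 / 2 :: real) ^ N) \<le> sum P (words N)"
      using assms(2) by (simp only: card_words) (simp add: power_divide)
  qed (use assms(1) in auto)
  moreover have "(\<Sum>u\<in>words N. P u * ln ((1 / 2) ^ N)) = - (real N * ln 2)"
    using assms(2) by (simp only: sum_distrib_right[symmetric]) (simp add: ln_realpow ln_div)
  ultimately show ?thesis by (simp add: block_entropy_def)
qed

section \<open>Window laws of a block distribution and their averages\<close>

definition slice :: "nat \<Rightarrow> nat \<Rightarrow> bool list \<Rightarrow> bool list" where
  "slice k t z = take k (drop t z)"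

definition slice_law :: "nat \<Rightarrow> nat \<Rightarrow> nat \<Rightarrow> (bool list \<Rightarrow> real) \<Rightarrow> bool list \<Rightarrow> real" where
  "slice_law N k t P u = (\<Sum>x\<in>words t. \<Sum>y\<in>words (N - t - k). P (x @ u @ y))"

lemma sum_slice:
  assumes "t + k \<le> N"
  shows "(\<Sum>z\<in>words N. P z * G (slice k t z)) = (\<Sum>u\<in>words k. slice_law N k t P u * G u)"
proof -
  have N: "N = t + (k + (N - t - k))" using assms by simp
  have "(\<Sum>z\<in>words N. P z * G (slice k t z))
      = (\<Sum>x\<in>words t. \<Sum>u\<in>words k. \<Sum>y\<in>words (N - t - k). P (x @ u @ y) * G u)"
    by (subst N, subst sum_words_append, subst sum_words_append) (simp add: slice_def)
  also have "\<dots> = (\<Sum>u\<in>words k. slice_law N k t P u * G u)"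
    by (subst sum.swap) (simp add: slice_law_def sum_distrib_right)
  finally show ?thesis .
qed

lemma slice_law_nonneg: "(\<And>u. 0 \<le> P u) \<Longrightarrow> 0 \<le> slice_law N k t P u"
  unfolding slice_law_def by (intro sum_nonneg)

lemma slice_law_noisy: "slice_law N k t (noisy e P) u = noisy e (slice_law N k t P) u"
proof -
  have "slice_law N k t (noisy e P) u
      = (\<Sum>x\<in>words t. noisy e (\<lambda>w. \<Sum>y\<in>words (N - t - k). P (w @ y)) (x @ u))"
    unfolding slice_law_def using sum_noisy_right[of e P "_ @ u" "N - t - k"] by simp
  also have "\<dots> = noisy e (\<lambda>v. \<Sum>x\<in>words t. \<Sum>y\<in>words (N - t - k). P ((x @ v) @ y)) u"
    by (rule sum_noisy_left)
  finally show ?thesis by (simp add: slice_law_def[abs_def])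
qed

lemma sum_slice_law:
  assumes "t + k \<le> N" "(\<Sum>z\<in>words N. P z) = 1"
  shows "(\<Sum>u\<in>words k. slice_law N k t P u) = 1"
  using sum_slice[OF assms(1), of P "\<lambda>_. 1"] assms(2) by simp

lemma slice_law_right:
  assumes "t + Suc n \<le> N"
  shows "right_marginal (slice_law N (Suc n) t P) w = slice_law N n t P w"
proof -
  have "N - t - n = Suc (N - t - Suc n)" using assms by simp
  then show ?thesis
    by (simp add: right_marginal_def slice_law_def sum_words_Cons sum.distrib)
qed

lemma slice_law_left:
  assumes "t + Suc n \<le> N"
  shows "left_marginal (slice_law N (Suc n) t P) w = slice_law N n (Suc t) P w"
  using assms by (simp add: left_marginal_def slice_law_def sum_words_snoc sum.distrib)

text \<open>A block of length \<open>n + T\<close> has exactly \<open>T\<close> windows of length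
  \<open>n + 1\<close>. Their average satisfies the stationarity condition up to boundary terms of
  order \<open>1 / T\<close>.\<close>

definition mean_slice_law :: "nat \<Rightarrow> nat \<Rightarrow> (bool list \<Rightarrow> real) \<Rightarrow> bool list \<Rightarrow> real" where
  "mean_slice_law n T P u = (\<Sum>t<T. slice_law (n + T) (Suc n) t P u) / real T"

lemma mean_slice_law_noisy: "mean_slice_law n T (noisy e P) u = noisy e (mean_slice_law n T P) u"
proof -
  have "(\<Sum>t<T. noisy e (slice_law (n + T) (Suc n) t P) u) = noisy e (\<lambda>u. \<Sum>t<T. slice_law (n + T) (Suc n) t P u) u"
    unfolding noisy_def by (subst sum.swap) (simp add: sum_distrib_right)
  moreover have "noisy e (\<lambda>u. G u / c) u = noisy e G u / c" for G and c :: real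
    by (simp add: noisy_def sum_divide_distrib)
  ultimately show ?thesis
    by (simp add: mean_slice_law_def[abs_def] slice_law_noisy)
qed

text \<open>Gibbs' inequality against the Markov measure of order \<open>n\<close> whose transition probabilities
  are those of the averaged block law.\<close>

lemma block_entropy_le_cond_entropy:
  assumes P: "\<And>u. 0 \<le> P u" and s: "(\<Sum>u\<in>words (n + T). P u) = 1" and T: "0 < T"
  shows "block_entropy P (n + T) \<le> real n * ln 2 + real T * cond_entropy n (mean_slice_law n T P)"
proof -
  define B where "B = mean_slice_law n T P"
  define \<rho> where "\<rho> u = B u / right_marginal B (butlast u)" for u
  have B0: "0 \<le> B u" for u
    unfolding B_def mean_slice_law_def using P by (intro divide_nonneg_nonneg sum_nonneg slice_law_nonneg) auto
  have rm0: "0 \<le> right_marginal B w" for w using B0 by (simp add: right_marginal_def)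
  have \<rho>0: "0 \<le> \<rho> u" for u using B0 rm0 by (simp add: \<rho>_def)
  \<comment> \<open>The sum can fall below 1: a context of mass 0 gives both letters the value
    \<open>0 / 0 = 0\<close>.\<close>
  have \<rho>1: "\<rho> (w @ [True]) + \<rho> (w @ [False]) \<le> 1" for w
    by (simp add: \<rho>_def add_divide_distrib[symmetric]) (simp add: right_marginal_def)
  \<comment> \<open>Summing out the last letter removes one factor at a time; the first
    \<open>n\<close> letters remain unweighted, whence \<open>2 ^ n\<close>.\<close>
  have prod_le: "(\<Sum>z\<in>words (n + k). \<Prod>t<k. \<rho> (slice (Suc n) t z)) \<le> 2 ^ n" for k
  proof (induction k)
    case 0
    then show ?case using card_words[of n] by simp
  next
    case (Suc k)
    let ?p = "\<lambda>z. \<Prod>t<k. \<rho> (slice (Suc n) t z)"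
    have "(\<Sum>z\<in>words (n + Suc k). \<Prod>t<Suc k. \<rho> (slice (Suc n) t z))
        = (\<Sum>z\<in>words (n + k). ?p z * \<rho> (drop k z @ [True]) + ?p z * \<rho> (drop k z @ [False]))"
    proof -
      have "(\<Prod>t<Suc k. \<rho> (slice (Suc n) t (z @ [v]))) = ?p z * \<rho> (drop k z @ [v])" if "length z = n + k" for z v
      proof -
        have "(\<Prod>t<k. \<rho> (slice (Suc n) t (z @ [v]))) = ?p z"
          using that by (intro prod.cong) (auto simp: slice_def)
        moreover have "slice (Suc n) k (z @ [v]) = drop k z @ [v]"
          using that by (simp add: slice_def)
        ultimately show ?thesis by simp
      qed
      then show ?thesis unfolding add_Suc_right sum_words_snoc by (intro sum.cong) auto
    qed
    also have "\<dots> \<le> (\<Sum>z\<in>words (n + k). ?p z * 1)"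
      unfolding distrib_left[symmetric] using \<rho>0 \<rho>1
      by (intro sum_mono mult_left_mono prod_nonneg) auto
    also have "\<dots> \<le> 2 ^ n" using Suc by simp
    finally show ?case .
  qed
  \<comment> \<open>The comparison measure is uniform on the first \<open>n\<close> letters, which
    costs the \<open>n * ln 2\<close> of the statement and is negligible after division by the block
    length.\<close>
  let ?R = "\<lambda>z. (1 / 2) ^ n * (\<Prod>t<T. \<rho> (slice (Suc n) t z))"
  have \<rho>pos: "0 < \<rho> (slice (Suc n) t z)" if z: "length z = n + T" "0 < P z" and t: "t < T" for z t
  proof -
    let ?u = "slice (Suc n) t z"
    have "P z = P z * (if slice (Suc n) t z = ?u then 1 else 0)" by simp
    also have "\<dots> \<le> (\<Sum>y\<in>words (n + T). P y * (if slice (Suc n) t y = ?u then 1 else 0))"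
      using z P by (intro member_le_sum) auto
    also have "\<dots> = (\<Sum>u\<in>words (Suc n). slice_law (n + T) (Suc n) t P u * (if u = ?u then 1 else 0))"
      by (rule sum_slice) (use t in auto)
    also have "\<dots> = slice_law (n + T) (Suc n) t P ?u"
      using z t by (simp add: if_distrib[of "(*) _"] slice_def cong: if_cong)
    finally have "0 < slice_law (n + T) (Suc n) t P ?u" using z by simp
    also have "\<dots> \<le> (\<Sum>t<T. slice_law (n + T) (Suc n) t P ?u)"
      using t P by (intro member_le_sum slice_law_nonneg) auto
    finally have "0 < B ?u" using T by (simp add: B_def mean_slice_law_def)
    moreover have "B ?u \<le> right_marginal B (butlast ?u)"
    proof -
      have "length ?u = Suc n" using z t by (simp add: slice_def)
      then obtain w v where "?u = w @ [v]" by (cases ?u rule: rev_cases) auto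
      then show ?thesis using B0 by (cases v) (auto simp: right_marginal_def)
    qed
    ultimately show ?thesis by (simp add: \<rho>_def)
  qed
  have "(\<Sum>z\<in>words (n + T). P z * ln (?R z)) \<le> (\<Sum>z\<in>words (n + T). P z * ln (P z))"
  proof (rule gibbs)
    have "(\<Sum>z\<in>words (n + T). ?R z) = (1 / 2) ^ n * (\<Sum>z\<in>words (n + T). \<Prod>t<T. \<rho> (slice (Suc n) t z))"
      by (simp add: sum_distrib_left)
    also have "\<dots> \<le> (1 / 2) ^ n * 2 ^ n" using prod_le[of T] by (intro mult_left_mono) auto
    finally show "(\<Sum>z\<in>words (n + T). ?R z) \<le> sum P (words (n + T))"
      using s by (simp add: power_mult_distrib[symmetric])
    show "0 \<le> ?R z" for z using \<rho>0 by (intro mult_nonneg_nonneg prod_nonneg) auto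
    show "0 < ?R z" if "z \<in> words (n + T)" "0 < P z" for z
      using \<rho>pos that by (intro mult_pos_pos prod_pos) auto
  qed (rule P)
  moreover have "(\<Sum>z\<in>words (n + T). P z * ln (?R z)) = - (real n * ln 2) - real T * cond_entropy n B"
  proof -
    have "P z * ln (?R z) = P z * (- (real n * ln 2)) + (\<Sum>t<T. P z * ln (\<rho> (slice (Suc n) t z)))"
      if z: "z \<in> words (n + T)" for z
    proof (cases "P z = 0")
      case False
      then have "0 < P z" using P[of z] by simp
      then have p: "0 < \<rho> (slice (Suc n) t z)" if "t < T" for t using \<rho>pos z that by auto
      then have A: "0 < (\<Prod>t<T. \<rho> (slice (Suc n) t z))" by (intro prod_pos) auto
      have "ln ((1 / 2) ^ n * a) = - (real n * ln 2) + ln a" if "0 < a" for a :: real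
        using that by (simp add: ln_mult ln_realpow ln_div)
      note this[OF A]
      moreover have "ln (\<Prod>t<T. \<rho> (slice (Suc n) t z)) = (\<Sum>t<T. ln (\<rho> (slice (Suc n) t z)))"
        by (intro ln_prod) (auto dest: p)
      ultimately show ?thesis
        by (simp only: distrib_left sum_distrib_left)
    qed simp
    then have "(\<Sum>z\<in>words (n + T). P z * ln (?R z))
        = (\<Sum>z\<in>words (n + T). P z * (- (real n * ln 2)) + (\<Sum>t<T. P z * ln (\<rho> (slice (Suc n) t z))))"
      by (intro sum.cong refl)
    also have "\<dots> = - (real n * ln 2) + (\<Sum>t<T. \<Sum>z\<in>words (n + T). P z * ln (\<rho> (slice (Suc n) t z)))"
      unfolding sum.distrib sum_distrib_right[symmetric] s by (subst sum.swap) simp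
    also have "(\<Sum>t<T. \<Sum>z\<in>words (n + T). P z * ln (\<rho> (slice (Suc n) t z)))
        = (\<Sum>t<T. \<Sum>u\<in>words (Suc n). slice_law (n + T) (Suc n) t P u * ln (\<rho> u))"
      by (intro sum.cong refl sum_slice[of _ _ _ P "\<lambda>u. ln (\<rho> u)"]) auto
    also have "\<dots> = (\<Sum>u\<in>words (Suc n). real T * B u * ln (\<rho> u))"
      using T by (subst sum.swap) (simp add: B_def mean_slice_law_def sum_distrib_right)
    also have "\<dots> = - real T * cond_entropy n B"
      by (simp add: cond_entropy_def \<rho>_def sum_distrib_left sum_negf mult.assoc)
    finally show ?thesis by simp
  qed
  ultimately show ?thesis by (simp add: block_entropy_def B_def)
qed

section \<open>Compactness of block laws and continuity of the conditional entropy\<close>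

lemma bounded_subsequence_finite:
  fixes f :: "nat \<Rightarrow> 'a \<Rightarrow> real"
  assumes "finite A" "\<And>k a. \<bar>f k a\<bar> \<le> 1"
  shows "\<exists>r g. strict_mono (r :: nat \<Rightarrow> nat) \<and> (\<forall>a\<in>A. (\<lambda>k. f (r k) a) \<longlonglongrightarrow> g a)"
  using assms(1)
proof induction
  case empty
  show ?case by (intro exI[of _ id]) (auto simp: strict_mono_def)
next
  case (insert a A)
  then obtain r g where r: "strict_mono r" and g: "\<forall>a\<in>A. (\<lambda>k. f (r k) a) \<longlonglongrightarrow> g a" by blast
  have "bounded (range (\<lambda>k. f (r k) a))"
    using assms(2) by (intro boundedI[of _ 1]) auto
  then obtain l s where s: "strict_mono (s :: nat \<Rightarrow> nat)" "((\<lambda>k. f (r k) a) \<circ> s) \<longlonglongrightarrow> l"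
    using bounded_imp_convergent_subsequence by blast
  show ?case
  proof (intro exI conjI ballI)
    show "strict_mono (r \<circ> s)" using r s by (simp add: strict_mono_o)
    show "(\<lambda>k. f ((r \<circ> s) k) b) \<longlonglongrightarrow> (if b = a then l else g b)" if "b \<in> insert a A" for b
      using that s g LIMSEQ_subseq_LIMSEQ[of "\<lambda>k. f (r k) b" "g b" s] by (auto simp: o_def)
  qed
qed

lemma tendsto_mult_ln:
  fixes f :: "nat \<Rightarrow> real"
  assumes f: "f \<longlonglongrightarrow> a" and pos: "\<And>k. 0 \<le> f k"
  shows "(\<lambda>k. f k * ln (f k)) \<longlonglongrightarrow> a * ln a"
proof (cases "a = 0")
  case True
  have "((\<lambda>x::real. x * ln x) \<longlongrightarrow> 0) (at_right 0)" by real_asymp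
  then have "((\<lambda>x::real. x * ln x) \<longlongrightarrow> 0 * ln 0) (at 0 within {0..})"
    by (simp add: at_within_Ici_at_right)
  then have c: "continuous (at 0 within {0..}) (\<lambda>x::real. x * ln x)"
    by (simp add: continuous_within)
  show ?thesis
    using continuous_within_tendsto_compose[OF c _ f[unfolded True]] pos True by (simp add: o_def)
next
  case False
  then have "0 < a" using LIMSEQ_le_const[OF f, of 0] pos by (simp add: less_le)
  then show ?thesis using f by (intro tendsto_intros) auto
qed

text \<open>The quotient under the logarithm need not converge where the context weight tends to 0.
  The conditional entropy is therefore rewritten with terms \<open>x * ln x\<close>, which are
  continuous at 0.\<close>

lemma cond_entropy_tendsto:
  assumes P: "\<And>u. length u = Suc n \<Longrightarrow> (\<lambda>k. P k u) \<longlonglongrightarrow> R u" and pos: "\<And>k u. 0 \<le> P k u"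
    and posR: "\<And>u. 0 \<le> R u"
  shows "(\<lambda>k. cond_entropy n (P k)) \<longlonglongrightarrow> cond_entropy n R"
proof -
  have eq: "cond_entropy n F = (\<Sum>w\<in>words n. right_marginal F w * ln (right_marginal F w))
      - (\<Sum>u\<in>words (Suc n). F u * ln (F u))" if F: "\<And>u. 0 \<le> F u" for F
  proof -
    have le: "F u \<le> right_marginal F (butlast u)" if "u \<in> words (Suc n)" for u
    proof -
      have "length u = Suc n" using that by simp
      then obtain w v where "u = w @ [v]" by (cases u rule: rev_cases) auto
      then show ?thesis using F by (cases v) (auto simp: right_marginal_def)
    qed
    have "cond_entropy n F = - (\<Sum>u\<in>words (Suc n). F u * ln (F u) - F u * ln (right_marginal F (butlast u)))"
      unfolding cond_entropy_def
      by (intro arg_cong[where f = uminus] sum.cong refl mult_ln_divide F le)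
    moreover have "(\<Sum>u\<in>words (Suc n). F u * ln (right_marginal F (butlast u)))
        = (\<Sum>w\<in>words n. right_marginal F w * ln (right_marginal F w))"
      by (simp add: sum_words_snoc distrib_right[symmetric]) (simp add: right_marginal_def)
    ultimately show ?thesis by (simp add: sum_subtractf)
  qed
  show ?thesis
    unfolding eq[OF pos] eq[OF posR]
    using pos by (intro tendsto_diff tendsto_sum tendsto_mult_ln P)
      (auto simp: right_marginal_def intro!: tendsto_add P)
qed

section \<open>Admissible inputs and the limit defining the capacity\<close>

locale factorial_language =
  fixes S :: "bool list set"
  assumes factor: "\<And>x y z. x @ y @ z \<in> S \<Longrightarrow> y \<in> S" and all_lengths: "\<And>N. \<exists>u\<in>S. length u = N"
begin

definition input_laws :: "nat \<Rightarrow> bool list pmf set" where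
  "input_laws N = {p. set_pmf p \<subseteq> S \<and> (\<forall>u\<in>set_pmf p. length u = N)}"

lemma constrained_inputs_eq: "constrained_inputs S n = input_laws (Suc n)"
  by (simp add: constrained_inputs_def input_laws_def)

lemma input_laws_nonempty: "input_laws N \<noteq> {}"
proof -
  obtain u where "u \<in> S" "length u = N" using all_lengths by blast
  then have "return_pmf u \<in> input_laws N" by (simp add: input_laws_def)
  then show ?thesis by blast
qed

lemma input_laws_sum: "p \<in> input_laws N \<Longrightarrow> (\<Sum>u\<in>words N. pmf p u) = 1"
  by (rule sum_pmf_eq_1) (auto simp: input_laws_def)

lemma input_laws_support: "p \<in> input_laws N \<Longrightarrow> u \<notin> S \<Longrightarrow> pmf p u = 0"
  by (auto simp: input_laws_def pmf_eq_0_set_pmf)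

text \<open>By \<open>bsc_information_eq\<close> this is the maximal information of a block of
  length \<open>N\<close>, before division by \<open>N\<close>.\<close>

definition gain :: "real \<Rightarrow> nat \<Rightarrow> real" where
  "gain e N = (SUP p\<in>input_laws N. block_entropy (noisy e (pmf p)) N - real N * binary_entropy e)"

context
  fixes e :: real
  assumes e: "0 \<le> e" "e < 1"
begin

lemma noisy_input:
  assumes "p \<in> input_laws N"
  shows "0 \<le> noisy e (pmf p) u" "(\<Sum>u\<in>words N. noisy e (pmf p) u) = 1"
  using e input_laws_sum[OF assms] by (auto simp: sum_noisy intro!: noisy_nonneg)

lemma gain_bdd: "bdd_above ((\<lambda>p. block_entropy (noisy e (pmf p)) N - real N * binary_entropy e) ` input_laws N)"
proof (rule bdd_aboveI2)
  fix p assume "p \<in> input_laws N"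
  then show "block_entropy (noisy e (pmf p)) N - real N * binary_entropy e
      \<le> real N * ln 2 - real N * binary_entropy e"
    using block_entropy_le_ln_2[of "noisy e (pmf p)" N] noisy_input[of p N] by simp
qed

lemma gain_upper:
  "p \<in> input_laws N \<Longrightarrow> block_entropy (noisy e (pmf p)) N - real N * binary_entropy e \<le> gain e N"
  unfolding gain_def by (rule cSUP_upper[OF _ gain_bdd])

lemma input_marginals:
  assumes p: "p \<in> input_laws (i + j)"
  shows "map_pmf (take i) p \<in> input_laws i" "map_pmf (drop i) p \<in> input_laws j"
    "length x = i \<Longrightarrow> pmf (map_pmf (take i) p) x = (\<Sum>y\<in>words j. pmf p (x @ y))"
    "length y = j \<Longrightarrow> pmf (map_pmf (drop i) p) y = (\<Sum>x\<in>words i. pmf p (x @ y))"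
proof -
  have len: "length u = i + j" "u \<in> S" if "u \<in> set_pmf p" for u
    using p that by (auto simp: input_laws_def)
  have t: "take i u \<in> S" "drop i u \<in> S" if "u \<in> S" for u
    using factor[of "[]" "take i u" "drop i u"] factor[of "take i u" "drop i u" "[]"] that by auto
  show "map_pmf (take i) p \<in> input_laws i" "map_pmf (drop i) p \<in> input_laws j"
    using len t by (auto simp: input_laws_def)
  show "pmf (map_pmf (take i) p) x = (\<Sum>y\<in>words j. pmf p (x @ y))" if "length x = i"
  proof -
    have "pmf (map_pmf (take i) p) x = measure p ((\<lambda>y. x @ y) ` words j)"
      unfolding pmf_map
    proof (rule measure_pmf.finite_measure_eq_AE)
      have "u \<in> (\<lambda>y. x @ y) ` words j" if "length u = i + j" "take i u = x" for u
        using that by (intro image_eqI[of _ _ "drop i u"]) auto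
      then show "AE u in p. (u \<in> take i -` {x}) = (u \<in> (\<lambda>y. x @ y) ` words j)"
        using that by (auto simp: AE_measure_pmf_iff dest!: len(1))
    qed auto
    then show ?thesis by (simp add: measure_measure_pmf_finite sum.reindex inj_on_def)
  qed
  show "pmf (map_pmf (drop i) p) y = (\<Sum>x\<in>words i. pmf p (x @ y))" if "length y = j"
  proof -
    have "pmf (map_pmf (drop i) p) y = measure p ((\<lambda>x. x @ y) ` words i)"
      unfolding pmf_map
    proof (rule measure_pmf.finite_measure_eq_AE)
      have "u \<in> (\<lambda>x. x @ y) ` words i" if "length u = i + j" "drop i u = y" for u
        using that by (intro image_eqI[of _ _ "take i u"]) auto
      then show "AE u in p. (u \<in> drop i -` {y}) = (u \<in> (\<lambda>x. x @ y) ` words i)"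
        using that by (auto simp: AE_measure_pmf_iff dest!: len(1))
    qed auto
    then show ?thesis by (simp add: measure_measure_pmf_finite sum.reindex inj_on_def)
  qed
qed

text \<open>Since \<open>S\<close> is closed under factors, both marginals of an admissible input
  are admissible, and the noise acts on the two parts separately.\<close>

lemma gain_subadditive: "gain e (i + j) \<le> gain e i + gain e j"
  unfolding gain_def[of e "i + j"]
proof (rule cSUP_least[OF input_laws_nonempty])
  fix p assume p: "p \<in> input_laws (i + j)"
  note marg = input_marginals[OF p]
  have "block_entropy (noisy e (pmf p)) (i + j)
      \<le> block_entropy (\<lambda>x. \<Sum>y\<in>words j. noisy e (pmf p) (x @ y)) i
        + block_entropy (\<lambda>y. \<Sum>x\<in>words i. noisy e (pmf p) (x @ y)) j"
    using noisy_input[OF p] by (intro entropy_subadditive) auto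
  also have "block_entropy (\<lambda>x. \<Sum>y\<in>words j. noisy e (pmf p) (x @ y)) i
      = block_entropy (noisy e (pmf (map_pmf (take i) p))) i"
    unfolding sum_noisy_right by (intro block_entropy_cong noisy_cong) (simp add: marg(3))
  also have "block_entropy (\<lambda>y. \<Sum>x\<in>words i. noisy e (pmf p) (x @ y)) j
      = block_entropy (noisy e (pmf (map_pmf (drop i) p))) j"
    unfolding sum_noisy_left by (intro block_entropy_cong noisy_cong) (simp add: marg(4))
  finally show "block_entropy (noisy e (pmf p)) (i + j) - real (i + j) * binary_entropy e \<le> gain e i + gain e j"
    using gain_upper[OF marg(1)] gain_upper[OF marg(2)] by (simp add: algebra_simps)
qed

lemma gain_lower: "- binary_entropy e * real N \<le> gain e N"
proof -
  obtain p where p: "p \<in> input_laws N" using input_laws_nonempty by blast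
  have "0 \<le> block_entropy (noisy e (pmf p)) N"
  proof -
    have "noisy e (pmf p) u * ln (noisy e (pmf p) u) \<le> 0" if "u \<in> words N" for u
    proof -
      have "noisy e (pmf p) u \<le> (\<Sum>u\<in>words N. noisy e (pmf p) u)"
        using that noisy_input(1)[OF p] by (intro member_le_sum) auto
      then have "noisy e (pmf p) u \<le> 1" using noisy_input(2)[OF p] by simp
      then show ?thesis using noisy_input(1)[OF p, of u]
        by (cases "noisy e (pmf p) u = 0") (auto intro: mult_nonneg_nonpos)
    qed
    then have "(\<Sum>u\<in>words N. noisy e (pmf p) u * ln (noisy e (pmf p) u)) \<le> 0"
      by (rule sum_nonpos)
    then show ?thesis by (simp add: block_entropy_def)
  qed
  then show ?thesis using gain_upper[OF p] by (simp add: algebra_simps)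
qed

text \<open>The capacity is defined by \<open>lim\<close>, so convergence has to be established; it
  follows from subadditivity of \<open>gain\<close>.\<close>

lemma noisy_capacity_LIMSEQ: "(\<lambda>n. gain e (Suc n) / real (Suc n)) \<longlonglongrightarrow> noisy_capacity S e"
proof -
  have sup: "(SUP p\<in>constrained_inputs S n. bsc_information e n p / real (n + 1)) = gain e (Suc n) / real (Suc n)" for n
  proof -
    let ?f = "\<lambda>p. block_entropy (noisy e (pmf p)) (Suc n) - real (Suc n) * binary_entropy e"
    have "(SUP p\<in>constrained_inputs S n. bsc_information e n p / real (n + 1))
        = (SUP p\<in>input_laws (Suc n). ?f p / real (Suc n))"
      unfolding constrained_inputs_eq
    proof (rule SUP_cong[OF refl])
      fix p assume "p \<in> input_laws (Suc n)"
      then have "\<forall>u\<in>set_pmf p. length u = n + 1" by (auto simp: input_laws_def)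
      from bsc_information_eq[OF this e] show "bsc_information e n p / real (n + 1) = ?f p / real (Suc n)"
        by simp
    qed
    also have "\<dots> = gain e (Suc n) / real (Suc n)"
    proof (rule antisym)
      show "(SUP p\<in>input_laws (Suc n). ?f p / real (Suc n)) \<le> gain e (Suc n) / real (Suc n)"
        by (intro cSUP_least[OF input_laws_nonempty] divide_right_mono gain_upper) simp_all
      have bdd: "bdd_above ((\<lambda>p. ?f p / real (Suc n)) ` input_laws (Suc n))"
        by (intro bdd_aboveI2[of _ _ "gain e (Suc n) / real (Suc n)"] divide_right_mono gain_upper) simp_all
      have "gain e (Suc n) \<le> (SUP p\<in>input_laws (Suc n). ?f p / real (Suc n)) * real (Suc n)"
        unfolding gain_def
      proof (rule cSUP_least[OF input_laws_nonempty])
        fix p assume p: "p \<in> input_laws (Suc n)"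
        have "?f p / real (Suc n) \<le> (SUP p\<in>input_laws (Suc n). ?f p / real (Suc n))"
          by (rule cSUP_upper[OF p bdd])
        then show "?f p \<le> (SUP p\<in>input_laws (Suc n). ?f p / real (Suc n)) * real (Suc n)"
          by (simp only: pos_divide_le_eq[OF of_nat_0_less_iff[THEN iffD2, OF zero_less_Suc]])
      qed
      then show "gain e (Suc n) / real (Suc n) \<le> (SUP p\<in>input_laws (Suc n). ?f p / real (Suc n))"
        by (simp only: pos_divide_le_eq[OF of_nat_0_less_iff[THEN iffD2, OF zero_less_Suc]])
    qed
    finally show ?thesis .
  qed
  have "convergent (\<lambda>n. gain e (Suc n) / real (Suc n))"
    by (rule fekete[of "gain e"]) (rule gain_subadditive, rule gain_lower)
  then show ?thesis
    unfolding noisy_capacity_def sup by (simp add: convergent_LIMSEQ_iff)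
qed

text \<open>Finite blocks of a stationary process with words in \<open>S\<close> are admissible
  inputs, so each of their output entropies is bounded by \<open>gain\<close>.\<close>

lemma entropy_rate_le_capacity:
  assumes X: "path_measure X" "word_law (word_prob X)" and supp: "\<And>u. word_prob X u \<noteq> 0 \<Longrightarrow> u \<in> S"
  shows "entropy_rate (bsc_output e X) \<le> noisy_capacity S e + binary_entropy e"
proof (rule LIMSEQ_le)
  let ?q = "word_prob X"
  have Z: "path_measure (bsc_output e X)" "word_prob (bsc_output e X) = noisy e ?q"
    using word_prob_bsc_output[OF X(1)] e by auto
  have "word_law (noisy e ?q)" using e by (intro word_law_noisy X(2)) auto
  then show "(\<lambda>n. block_entropy (noisy e ?q) (Suc n) / real (Suc n)) \<longlonglongrightarrow> entropy_rate (bsc_output e X)"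
    using entropy_rate_LIMSEQ[OF Z(1)] by (simp add: Z(2))
  show "(\<lambda>n. gain e (Suc n) / real (Suc n) + binary_entropy e) \<longlonglongrightarrow> noisy_capacity S e + binary_entropy e"
    by (intro tendsto_add noisy_capacity_LIMSEQ tendsto_const)
  have "block_entropy (noisy e ?q) (Suc n) / real (Suc n) \<le> gain e (Suc n) / real (Suc n) + binary_entropy e" for n
  proof -
    let ?p = "block_pmf ?q (Suc n)"
    have p: "?p \<in> input_laws (Suc n)"
    proof -
      have "length u = Suc n \<and> u \<in> S" if u: "u \<in> set_pmf ?p" for u
      proof -
        have "pmf ?p u \<noteq> 0" using u by (simp add: set_pmf_iff)
        then have "length u = Suc n" "?q u \<noteq> 0"
          unfolding pmf_block_pmf[OF X(2)] by (simp_all split: if_split_asm)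
        then show ?thesis using supp by blast
      qed
      then show ?thesis unfolding input_laws_def by blast
    qed
    have "block_entropy (noisy e (pmf ?p)) (Suc n) = block_entropy (noisy e ?q) (Suc n)"
      by (intro block_entropy_cong noisy_cong) (simp add: pmf_block_pmf[OF X(2)])
    then have "block_entropy (noisy e ?q) (Suc n) \<le> gain e (Suc n) + real (Suc n) * binary_entropy e"
      using gain_upper[OF p] by simp
    then have "block_entropy (noisy e ?q) (Suc n) / real (Suc n)
        \<le> (gain e (Suc n) + real (Suc n) * binary_entropy e) / real (Suc n)"
      by (rule divide_right_mono) simp
    then show ?thesis by (simp add: add_divide_distrib del: of_nat_Suc)
  qed
  then show "\<exists>N. \<forall>n\<ge>N. block_entropy (noisy e ?q) (Suc n) / real (Suc n)
      \<le> gain e (Suc n) / real (Suc n) + binary_entropy e" by blast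
qed

text \<open>A limit point of the averaged block laws of nearly optimal inputs is stationary.\<close>

lemma capacity_le_cond_entropy:
  "\<exists>p. stationary_block n p \<and> (\<forall>u. u \<notin> S \<longrightarrow> p u = 0) \<and>
     noisy_capacity S e + binary_entropy e \<le> cond_entropy n (noisy e p)"
proof -
  \<comment> \<open>A fixed slack of 1 suffices, since it vanishes after division by the block
    length.\<close>
  have "\<exists>p\<in>input_laws N. gain e N - 1 < block_entropy (noisy e (pmf p)) N - real N * binary_entropy e" for N
    using less_cSUP_iff[OF input_laws_nonempty gain_bdd, of "gain e N - 1" N] by (simp add: gain_def)
  then obtain P where P: "\<And>N. P N \<in> input_laws N"
    and gP: "\<And>N. gain e N - 1 < block_entropy (noisy e (pmf (P N))) N - real N * binary_entropy e" by metis
  define F where "F k = pmf (P (n + Suc k))" for k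
  have sF: "(\<Sum>u\<in>words (n + Suc k). F k u) = 1" for k
    unfolding F_def by (rule input_laws_sum[OF P])
  have F0: "0 \<le> F k u" for k u by (simp add: F_def)
  \<comment> \<open>Values at other lengths are set to 0, which makes \<open>B\<close> bounded by 1
    on all words.\<close>
  define B where "B k u = (if length u = Suc n then mean_slice_law n (Suc k) (F k) u else 0)" for k u
  have sl1: "(\<Sum>u\<in>words j. slice_law (n + Suc k) j t (F k) u) = 1" if "t + j \<le> n + Suc k" for k j t
    by (rule sum_slice_law[OF that sF])
  have sl0: "0 \<le> slice_law (n + Suc k) j t (F k) u" for k j t u
    by (intro slice_law_nonneg F0)
  have B0: "0 \<le> B k u" for k u
  proof -
    have "0 \<le> mean_slice_law n (Suc k) (F k) u"
      unfolding mean_slice_law_def by (intro divide_nonneg_nonneg sum_nonneg sl0) simp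
    then show ?thesis by (simp add: B_def)
  qed
  have sB: "(\<Sum>u\<in>words (Suc n). B k u) = 1" for k
  proof -
    have "(\<Sum>u\<in>words (Suc n). B k u) = (\<Sum>t<Suc k. \<Sum>u\<in>words (Suc n). slice_law (n + Suc k) (Suc n) t (F k) u) / real (Suc k)"
      by (subst sum.swap) (simp add: B_def mean_slice_law_def sum_divide_distrib del: sum.lessThan_Suc of_nat_Suc)
    also have "\<dots> = (\<Sum>t<Suc k. 1) / real (Suc k)"
      by (intro arg_cong2[where f = "(/)"] sum.cong refl sl1) auto
    finally show ?thesis by simp
  qed
  have B1: "\<bar>B k u\<bar> \<le> 1" for k u
  proof (cases "length u = Suc n")
    case True
    then have "B k u \<le> (\<Sum>u\<in>words (Suc n). B k u)" using B0 by (intro member_le_sum) auto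
    then show ?thesis using B0 sB by simp
  qed (simp add: B_def)
  obtain r g where r: "strict_mono (r :: nat \<Rightarrow> nat)" and g: "\<forall>u\<in>words (Suc n). (\<lambda>k. B (r k) u) \<longlonglongrightarrow> g u"
    using bounded_subsequence_finite[of "words (Suc n)" B] B1 by auto
  define p where "p u = (if length u = Suc n then g u else 0)" for u
  have lim: "(\<lambda>k. B (r k) u) \<longlonglongrightarrow> p u" for u
    using g by (cases "length u = Suc n") (auto simp: p_def B_def)
  have p0: "0 \<le> p u" for u
    using LIMSEQ_le_const[OF lim, of 0 u] B0 by auto
  have sp: "(\<Sum>u\<in>words (Suc n). p u) = 1"
  proof -
    have "(\<lambda>k. \<Sum>u\<in>words (Suc n). B (r k) u) \<longlonglongrightarrow> (\<Sum>u\<in>words (Suc n). p u)"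
      by (intro tendsto_sum lim)
    then show ?thesis unfolding sB using LIMSEQ_unique tendsto_const by blast
  qed
  \<comment> \<open>Both marginals average laws of windows of length \<open>n\<close>, over
    positions shifted by one. The difference telescopes to the first and the last position.\<close>
  have marg: "\<bar>right_marginal (B k) w - left_marginal (B k) w\<bar> \<le> 1 / real (Suc k)" if w: "length w = n" for k w
  proof -
    let ?s = "\<lambda>t. slice_law (n + Suc k) n t (F k) w"
    have R: "right_marginal (B k) w = (\<Sum>t<Suc k. ?s t) / real (Suc k)"
    proof -
      have "right_marginal (B k) w
          = (\<Sum>t<Suc k. right_marginal (slice_law (n + Suc k) (Suc n) t (F k)) w) / real (Suc k)"
        using w by (simp add: right_marginal_def B_def mean_slice_law_def sum.distrib add_divide_distrib
            del: sum.lessThan_Suc of_nat_Suc)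
      also have "(\<Sum>t<Suc k. right_marginal (slice_law (n + Suc k) (Suc n) t (F k)) w) = (\<Sum>t<Suc k. ?s t)"
        by (intro sum.cong refl slice_law_right) auto
      finally show ?thesis .
    qed
    have L: "left_marginal (B k) w = (\<Sum>t<Suc k. ?s (Suc t)) / real (Suc k)"
    proof -
      have "left_marginal (B k) w
          = (\<Sum>t<Suc k. left_marginal (slice_law (n + Suc k) (Suc n) t (F k)) w) / real (Suc k)"
        using w by (simp add: left_marginal_def B_def mean_slice_law_def sum.distrib add_divide_distrib
            del: sum.lessThan_Suc of_nat_Suc)
      also have "(\<Sum>t<Suc k. left_marginal (slice_law (n + Suc k) (Suc n) t (F k)) w) = (\<Sum>t<Suc k. ?s (Suc t))"
        by (intro sum.cong refl slice_law_left) auto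
      finally show ?thesis .
    qed
    have "right_marginal (B k) w - left_marginal (B k) w = (?s 0 - ?s (Suc k)) / real (Suc k)"
      unfolding R L diff_divide_distrib[symmetric] sum_subtractf[symmetric]
      using sum_lessThan_telescope'[of ?s "Suc k"] by (simp only:)
    moreover have "0 \<le> ?s t" "?s t \<le> 1" if "t \<le> Suc k" for t
      using sl0 sl1[of t n k] that w member_le_sum[of w "words n" "\<lambda>w. slice_law (n + Suc k) n t (F k) w"]
      by auto
    from this[of 0] this[of "Suc k"] have "\<bar>?s 0 - ?s (Suc k)\<bar> \<le> 1" by auto
    ultimately show ?thesis by (simp add: divide_right_mono del: of_nat_Suc)
  qed
  have stat: "stationary_block n p"
    unfolding stationary_block_def
  proof (intro conjI allI ballI p0 sp)
    fix w assume w: "w \<in> words n"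
    have "(\<lambda>k. right_marginal (B (r k)) w - left_marginal (B (r k)) w) \<longlonglongrightarrow> right_marginal p w - left_marginal p w"
      unfolding right_marginal_def left_marginal_def by (intro tendsto_intros lim)
    moreover have "(\<lambda>k. right_marginal (B (r k)) w - left_marginal (B (r k)) w) \<longlonglongrightarrow> 0"
    proof (rule Lim_null_comparison)
      show "\<forall>\<^sub>F k in sequentially. norm (right_marginal (B (r k)) w - left_marginal (B (r k)) w) \<le> 1 / real (Suc (r k))"
        using marg w by (intro always_eventually) auto
      have "(\<lambda>k. 1 / real (Suc k)) \<longlonglongrightarrow> 0" by real_asymp
      then show "(\<lambda>k. 1 / real (Suc (r k))) \<longlonglongrightarrow> 0"
        using LIMSEQ_subseq_LIMSEQ[OF _ r] by (simp add: o_def)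
    qed
    ultimately have "right_marginal p w - left_marginal p w = 0" by (rule LIMSEQ_unique)
    then show "right_marginal p w = left_marginal p w" by simp
  qed
  have supp: "p u = 0" if "u \<notin> S" for u
  proof -
    have "F k (x @ u @ y) = 0" for k x y
      unfolding F_def using that factor by (intro input_laws_support[OF P]) blast
    then have "B k u = 0" for k by (simp add: B_def mean_slice_law_def slice_law_def)
    then show ?thesis using lim[of u] LIMSEQ_unique[OF _ tendsto_const] by auto
  qed
  have ce: "(\<lambda>k. cond_entropy n (noisy e (B (r k)))) \<longlonglongrightarrow> cond_entropy n (noisy e p)"
  proof (rule cond_entropy_tendsto)
    show "(\<lambda>k. noisy e (B (r k)) u) \<longlonglongrightarrow> noisy e p u" for u
      unfolding noisy_def by (intro tendsto_intros lim)
    show "0 \<le> noisy e (B (r k)) u" "0 \<le> noisy e p u" for k u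
      using e B0 p0 by (auto intro!: noisy_nonneg)
  qed
  have bound: "gain e (n + Suc k) / real (n + Suc k)
      \<le> (1 + real n * ln 2 + (real (n + Suc k) - real n) * cond_entropy n (noisy e (B k))) / real (n + Suc k) - binary_entropy e" for k
  proof -
    have "block_entropy (noisy e (F k)) (n + Suc k)
        \<le> real n * ln 2 + real (Suc k) * cond_entropy n (mean_slice_law n (Suc k) (noisy e (F k)))"
      unfolding F_def using noisy_input[OF P] by (intro block_entropy_le_cond_entropy) auto
    also have "cond_entropy n (mean_slice_law n (Suc k) (noisy e (F k))) = cond_entropy n (noisy e (B k))"
    proof -
      have "mean_slice_law n (Suc k) (noisy e (F k)) u = noisy e (B k) u" if "length u = Suc n" for u
        unfolding mean_slice_law_noisy using that by (intro noisy_cong) (simp add: B_def)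
      then show ?thesis by (simp add: cond_entropy_def right_marginal_def)
    qed
    finally have "gain e (n + Suc k) \<le> (1 + real n * ln 2 + real (Suc k) * cond_entropy n (noisy e (B k)))
        - real (n + Suc k) * binary_entropy e"
      using gP[of "n + Suc k"] by (simp add: F_def)
    then have "gain e (n + Suc k) / real (n + Suc k) \<le> ((1 + real n * ln 2 + real (Suc k) * cond_entropy n (noisy e (B k)))
        - real (n + Suc k) * binary_entropy e) / real (n + Suc k)"
      by (rule divide_right_mono) simp
    also have "\<dots> = (1 + real n * ln 2 + (real (n + Suc k) - real n) * cond_entropy n (noisy e (B k))) / real (n + Suc k)
        - binary_entropy e"
      by (simp add: diff_divide_distrib)
    finally show ?thesis .
  qed
  have "noisy_capacity S e \<le> cond_entropy n (noisy e p) - binary_entropy e"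
  proof (rule LIMSEQ_le)
    have "(\<lambda>k. gain e (Suc (n + r k)) / real (Suc (n + r k))) \<longlonglongrightarrow> noisy_capacity S e"
      using LIMSEQ_subseq_LIMSEQ[OF noisy_capacity_LIMSEQ, of "\<lambda>k. n + r k"] r
      by (simp add: o_def strict_mono_def)
    then show "(\<lambda>k. gain e (n + Suc (r k)) / real (n + Suc (r k))) \<longlonglongrightarrow> noisy_capacity S e" by simp
    have "(\<lambda>k. (1 + real n * ln 2) / real (n + Suc k)) \<longlonglongrightarrow> 0" "(\<lambda>k. (real (n + Suc k) - real n) / real (n + Suc k)) \<longlonglongrightarrow> 1"
      by real_asymp+
    then have "(\<lambda>k. (1 + real n * ln 2) / real (n + Suc (r k))) \<longlonglongrightarrow> 0"
      "(\<lambda>k. (real (n + Suc (r k)) - real n) / real (n + Suc (r k))) \<longlonglongrightarrow> 1"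
      using LIMSEQ_subseq_LIMSEQ[OF _ r] by (force simp: o_def)+
    then have "(\<lambda>k. (1 + real n * ln 2) / real (n + Suc (r k))
        + (real (n + Suc (r k)) - real n) / real (n + Suc (r k)) * cond_entropy n (noisy e (B (r k))) - binary_entropy e)
        \<longlonglongrightarrow> 0 + 1 * cond_entropy n (noisy e p) - binary_entropy e"
      by (intro tendsto_intros ce)
    note limit = this
    show "(\<lambda>k. (1 + real n * ln 2 + (real (n + Suc (r k)) - real n) * cond_entropy n (noisy e (B (r k)))) / real (n + Suc (r k))
        - binary_entropy e) \<longlonglongrightarrow> cond_entropy n (noisy e p) - binary_entropy e"
    proof -
      have "(c + b * x) / d = c / d + b / d * x" for b c d x :: real
        by (simp add: add_divide_distrib)
      then show ?thesis using limit by (simp only: add_0 mult_1)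
    qed
  qed (use bound in auto)
  then show ?thesis using stat supp by (intro exI[of _ p]) auto
qed

end

end

text \<open>Gibbs' inequality against the contexts of \<open>p\<close> with the transition
  probabilities of \<open>q\<close>. It is the noiseless half of the upper bound and identifies the
  capacity at \<open>e = 0\<close>.\<close>

lemma cond_entropy_le_cross_entropy:
  assumes W: "word_law q" and p: "stationary_block n p" and supp: "\<forall>u\<in>words (Suc n). q u = 0 \<longrightarrow> p u = 0"
  shows "cond_entropy n p \<le> - (\<Sum>u\<in>words (Suc n). p u * ln (q u / q (butlast u)))"
proof -
  let ?R = "\<lambda>u. right_marginal p (butlast u) * q u / q (butlast u)"
  have pos: "0 < right_marginal p (butlast u) \<and> 0 < q u \<and> 0 < q (butlast u)"
    if "length u = Suc n" "p u \<noteq> 0" for u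
  proof -
    have "u \<noteq> []" using that by auto
    then have "q u \<le> q (butlast u)" by (rule word_law_butlast[OF W])
    moreover have "0 < q u" using supp that word_lawD(1)[OF W, of u] by (auto simp: less_le)
    moreover have "p u \<le> right_marginal p (butlast u)"
      using stationary_blockD(5)[OF p, of "butlast u" "last u"] \<open>u \<noteq> []\<close> by simp
    moreover have "0 < p u" using stationary_blockD(1)[OF p, of u] that by simp
    ultimately show ?thesis by linarith
  qed
  have "(\<Sum>u\<in>words (Suc n). p u * ln (?R u)) \<le> (\<Sum>u\<in>words (Suc n). p u * ln (p u))"
  proof (rule gibbs)
    have "(\<Sum>u\<in>words (Suc n). ?R u) \<le> (\<Sum>w\<in>words n. right_marginal p w)"
      unfolding sum_words_snoc
    proof (rule sum_mono)
      fix w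
      have "?R (w @ [True]) + ?R (w @ [False]) = right_marginal p w * (q w / q w)"
        using word_lawD(3)[OF W, of w] by (simp add: add_divide_distrib[symmetric] distrib_left[symmetric])
      then show "?R (w @ [True]) + ?R (w @ [False]) \<le> right_marginal p w"
        using stationary_blockD(4)[OF p, of w] by (cases "q w = 0") auto
    qed
    also have "\<dots> = sum p (words (Suc n))" by (simp add: sum_words_snoc right_marginal_def)
    finally show "sum ?R (words (Suc n)) \<le> sum p (words (Suc n))" .
    show "0 \<le> ?R u" for u
      using stationary_blockD(4)[OF p] word_lawD(1)[OF W] by simp
    show "0 < ?R u" if "u \<in> words (Suc n)" "0 < p u" for u
      using pos[of u] that by simp
  qed (rule stationary_blockD(1)[OF p])
  moreover have "p u * ln (p u / right_marginal p (butlast u)) = p u * ln (p u) - p u * ln (right_marginal p (butlast u))"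
    "p u * ln (?R u) = p u * ln (right_marginal p (butlast u)) + p u * ln (q u / q (butlast u))"
    if "u \<in> words (Suc n)" for u
    using pos[of u] that stationary_blockD(1)[OF p, of u]
    by (cases "p u = 0"; simp add: ln_div ln_mult algebra_simps)+
  ultimately show ?thesis
    by (simp add: cond_entropy_def sum.distrib sum_subtractf)
qed


section \<open>The asymptotic expansion of the capacity\<close>

lemma markov_law_mono: "markov_law m q \<Longrightarrow> m \<le> m' \<Longrightarrow> markov_law m' q"
  by (simp add: markov_law_def)

text \<open>For a chain of order \<open>m\<close> the conditional probability of the last letter
  depends on the last \<open>m + 1\<close> letters only, so the extra leading letters of
  \<open>p\<close> can be summed out and the bound at order \<open>m\<close> applies.\<close>

lemma cross_entropy_le_max_longer:
  assumes X: "max_entropy_chain S X" and n: "topological_order S \<le> n"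
    and p: "stationary_block n p" and supp: "\<And>u. length u = Suc n \<Longrightarrow> word_prob X u = 0 \<Longrightarrow> p u = 0"
  shows "- (\<Sum>u\<in>words (Suc n). p u * ln (word_prob X u / word_prob X (butlast u))) \<le> entropy_rate X"
proof -
  define m where "m = topological_order S"
  define d where "d = n - m"
  let ?q = "word_prob X"
  have MX: "markov_order m X" and S: "allowed_words X = S"
    using X by (auto simp: max_entropy_chain_def m_def)
  note M = markov_law_word_prob[OF MX]
  note W = markov_law_word_law[OF M]
  have nd: "n = d + m" using n by (simp add: d_def m_def)
  define r where "r u = (\<Sum>x\<in>words d. p (x @ u))" for u
  have r: "stationary_block m r"
    unfolding stationary_block_def
  proof (intro conjI allI ballI)
    show "0 \<le> r u" for u unfolding r_def by (intro sum_nonneg stationary_blockD(1)[OF p])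
    show "(\<Sum>u\<in>words (Suc m). r u) = 1"
      using stationary_blockD(2)[OF p] sum_words_append[of p d "Suc m"]
      by (simp add: r_def nd sum.swap[of _ "words (Suc m)"])
    fix w assume w: "w \<in> words m"
    have "right_marginal r w = (\<Sum>x\<in>words d. right_marginal p (x @ w))"
      by (simp add: r_def right_marginal_def sum.distrib)
    also have "\<dots> = (\<Sum>x\<in>words d. left_marginal p (x @ w))"
      using w by (intro sum.cong refl stationary_blockD(3)[OF p]) (simp add: nd)
    \<comment> \<open>The letter added on the left of \<open>x\<close> is regrouped: splitting
      \<open>y\<close> at its other end puts a letter in front of \<open>w\<close>.\<close>
    also have "\<dots> = (\<Sum>y\<in>words (Suc d). p (y @ w))"
      by (simp add: sum_words_Cons left_marginal_def)
    also have "\<dots> = left_marginal r w"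
      by (simp add: sum_words_snoc left_marginal_def r_def sum.distrib)
    finally show "right_marginal r w = left_marginal r w" .
  qed
  have "- (\<Sum>u\<in>words (Suc m). r u * ln (?q u / ?q (butlast u))) \<le> entropy_rate X"
  proof (rule cross_entropy_le_max[OF X m_def r])
    fix u assume u: "length u = Suc m" "u \<notin> S"
    then have "?q u = 0"
      using S word_lawD(1)[OF W, of u] by (auto simp: allowed_words_def less_le)
    then have "?q (x @ u) = 0" for x by (rule markov_zero_right[OF M])
    then show "r u = 0" using u unfolding r_def by (intro sum.neutral ballI supp) (auto simp: nd)
  qed
  also have "(\<Sum>u\<in>words (Suc m). r u * ln (?q u / ?q (butlast u)))
      = (\<Sum>x\<in>words d. \<Sum>u\<in>words (Suc m). p (x @ u) * ln (?q u / ?q (butlast u)))"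
    by (subst sum.swap) (simp add: r_def sum_distrib_right)
  also have "\<dots> = (\<Sum>x\<in>words d. \<Sum>u\<in>words (Suc m). p (x @ u) * ln (?q (x @ u) / ?q (butlast (x @ u))))"
  proof (intro sum.cong refl)
    fix x u assume xu: "x \<in> words d" "u \<in> words (Suc m)"
    show "p (x @ u) * ln (?q u / ?q (butlast u)) = p (x @ u) * ln (?q (x @ u) / ?q (butlast (x @ u)))"
    proof (cases "?q (x @ u) = 0")
      case True
      then show ?thesis using supp[of "x @ u"] xu by (simp add: nd)
    next
      case False
      then show ?thesis using markov_ratio[OF M _ False] xu by simp
    qed
  qed
  also have "\<dots> = (\<Sum>u\<in>words (Suc n). p u * ln (?q u / ?q (butlast u)))"
    using sum_words_append[of "\<lambda>u. p u * ln (?q u / ?q (butlast u))" d "Suc m"] by (simp add: nd)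
  finally show ?thesis .
qed

theorem corollary3p3:
  fixes S :: "bool list set" and X :: "(int \<Rightarrow> bool) measure"
  assumes "finite_type_constraint S"
    and "irreducible_constraint S"
    and "max_entropy_chain S X"
  shows "(\<lambda>\<epsilon>. noisy_capacity S \<epsilon>
            - (noisy_capacity S 0
               + (f_coef (2 * topological_order S) X - 1) * \<epsilon> * ln (1 / \<epsilon>)
               + (g_coef (3 * topological_order S) X - 1) * \<epsilon>))
           \<in> O[at_right 0](\<lambda>\<epsilon>. \<epsilon>\<^sup>2 * (ln \<epsilon>)\<^sup>2)
         \<and> (\<forall>m \<ge> topological_order S.
              (\<lambda>\<epsilon>. markov_output_entropy m S \<epsilon> - binary_entropy \<epsilon>
                 - (noisy_capacity S 0
                    + (f_coef (2 * topological_order S) X - 1) * \<epsilon> * ln (1 / \<epsilon>)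
                    + (g_coef (3 * topological_order S) X - 1) * \<epsilon>))
                \<in> O[at_right 0](\<lambda>\<epsilon>. \<epsilon>\<^sup>2 * (ln \<epsilon>)\<^sup>2))"
proof -
  define m where "m = topological_order S"
  define n where "n = 3 * m"
  define q where "q = word_prob X"
  have MX: "markov_order m X" and S: "allowed_words X = S"
    using assms(3) by (auto simp: max_entropy_chain_def m_def)
  then have stX: "stationary_process X" by (simp add: markov_order_def)
  note PX = stationary_processD(1)[OF stX]
  have M: "markov_law m q" unfolding q_def by (rule markov_law_word_prob[OF MX])
  note W = markov_law_word_law[OF M]
  have S_iff: "u \<in> S \<longleftrightarrow> q u \<noteq> 0" for u
    using S word_lawD(1)[OF W, of u] by (auto simp: q_def allowed_words_def less_le)
  have irr: "\<exists>w. q (u @ w @ v) \<noteq> 0" if "q u \<noteq> 0" "q v \<noteq> 0" for u v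
    using assms(2) that unfolding irreducible_constraint_def S_iff[symmetric] by blast
  interpret factorial_language S
  proof
    show "y \<in> S" if "x @ y @ z \<in> S" for x y z
      using that markov_zero_mid[OF M, of y x z] by (auto simp: S_iff)
    show "\<exists>u\<in>S. length u = N" for N
    proof (rule ccontr)
      assume "\<not> (\<exists>u\<in>S. length u = N)"
      then have "(\<Sum>u\<in>words N. q u) = 0" by (intro sum.neutral) (auto simp: S_iff)
      then show False using word_law_sum[OF W, of N] by simp
    qed
  qed
  define C0 where "C0 = cond_entropy n q"
  define \<Phi> where "\<Phi> e = cond_entropy n (noisy e q)" for e
  have rateX: "entropy_rate X = C0"
    unfolding C0_def q_def
    by (rule entropy_rate_markov) (rule markov_order_of_law[OF stX markov_law_mono[OF M[unfolded q_def]]], simp add: n_def)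
  have opt: "- (\<Sum>u\<in>words (Suc n). p u * ln (q u / q (butlast u))) \<le> C0"
    if "stationary_block n p" "\<And>u. length u = Suc n \<Longrightarrow> q u = 0 \<Longrightarrow> p u = 0" for p
    using cross_entropy_le_max_longer[OF assms(3), of n p] that
    by (auto simp: rateX[symmetric] q_def n_def m_def)
  \<comment> \<open>Without noise both halves of the argument are exact: Gibbs' inequality and
    optimality from above, the chain itself from below.\<close>
  have cap0: "noisy_capacity S 0 = C0"
  proof (rule antisym)
    obtain p where p: "stationary_block n p" "\<forall>u. u \<notin> S \<longrightarrow> p u = 0"
      "noisy_capacity S 0 + binary_entropy 0 \<le> cond_entropy n (noisy 0 p)"
      using capacity_le_cond_entropy[of 0 n] by auto
    have "noisy 0 p = p" by (simp add: noisy_0 fun_eq_iff)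
    then have "noisy_capacity S 0 \<le> cond_entropy n p"
      using p(3) by (simp add: binary_entropy_def)
    also have "\<dots> \<le> - (\<Sum>u\<in>words (Suc n). p u * ln (q u / q (butlast u)))"
      using p by (intro cond_entropy_le_cross_entropy W) (auto simp: S_iff)
    also have "\<dots> \<le> C0" using p by (intro opt) (auto simp: S_iff)
    finally show "noisy_capacity S 0 \<le> C0" .
    have "word_prob (bsc_output 0 X) = word_prob X"
      using word_prob_bsc_output(2)[OF PX, of 0] by (simp add: noisy_0 fun_eq_iff)
    then have "entropy_rate (bsc_output 0 X) = entropy_rate X"
      using entropy_rate_eq_lim[OF PX] entropy_rate_eq_lim[OF word_prob_bsc_output(1)[OF PX, of 0]] by simp
    then show "C0 \<le> noisy_capacity S 0"
      using entropy_rate_le_capacity[of 0 X] PX W rateX S_iff by (simp add: q_def binary_entropy_def)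
  qed
  obtain K1 where K1: "\<forall>\<^sub>F e in at_right 0. \<forall>p. stationary_block n p \<longrightarrow> (\<forall>u\<in>words (Suc n). q u = 0 \<longrightarrow> p u = 0) \<longrightarrow>
     cond_entropy n (noisy e p) \<le> \<Phi> e + K1 * (e\<^sup>2 * (ln e)\<^sup>2)"
    using noisy_cond_entropy_upper[OF W irr, of n] opt unfolding \<Phi>_def C0_def by blast
  have upper: "\<forall>\<^sub>F e in at_right 0. noisy_capacity S e + binary_entropy e \<le> \<Phi> e + K1 * (e\<^sup>2 * (ln e)\<^sup>2)"
    using K1 eventually_small
  proof eventually_elim
    case (elim e)
    obtain p where p: "stationary_block n p" "\<forall>u. u \<notin> S \<longrightarrow> p u = 0"
      "noisy_capacity S e + binary_entropy e \<le> cond_entropy n (noisy e p)"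
      using capacity_le_cond_entropy[of e n] elim by auto
    have "cond_entropy n (noisy e p) \<le> \<Phi> e + K1 * (e\<^sup>2 * (ln e)\<^sup>2)"
      using elim p by (auto simp: S_iff)
    with p(3) show ?case by linarith
  qed
  obtain K2 where K2: "\<forall>\<^sub>F e in at_right 0. \<Phi> e - state_cond_entropy m n q e \<le> K2 * (e\<^sup>2 * ln (1 / e))"
    using state_cond_entropy_bound[OF M, of n] unfolding \<Phi>_def n_def by auto
  have lower: "\<forall>\<^sub>F e in at_right 0. \<Phi> e - K2 * (e\<^sup>2 * ln (1 / e)) \<le> entropy_rate (bsc_output e X)"
    using K2 eventually_small
  proof eventually_elim
    case (elim e)
    have Z: "path_measure (bsc_output e X)" "word_prob (bsc_output e X) = noisy e q"
      using word_prob_bsc_output[OF PX, of e] elim by (auto simp: q_def)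
    have WZ: "word_law (noisy e q)" using elim by (intro word_law_noisy W) auto
    have "state_cond_entropy m n q e \<le> entropy_rate (bsc_output e X)"
      using cond_entropy_noisy_ge_state[OF M, of e n] elim WZ
      by (intro entropy_rate_ge[OF Z(1), of "n + m"]) (auto simp: Z(2))
    then show ?case using elim by linarith
  qed
  have rate_le: "entropy_rate (bsc_output e Y) \<le> noisy_capacity S e + binary_entropy e"
    if Y: "stationary_process Y" "allowed_words Y \<subseteq> S" and e: "0 \<le> e" "e < 1" for Y e
  proof -
    have WY: "word_law (word_prob Y)" by (rule word_law_word_prob[OF Y(1)])
    show ?thesis
      using e stationary_processD(1)[OF Y(1)] WY Y(2) word_lawD(1)[OF WY]
      by (intro entropy_rate_le_capacity) (auto simp: allowed_words_def less_le)
  qed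
  \<comment> \<open>The expansion gives this coefficient for windows of length \<open>3 * m\<close>;
    it is already stable from \<open>2 * m\<close> on.\<close>
  have f: "f_coef (2 * m) X = (\<Sum>u\<in>words (Suc n). f_term q u)"
  proof -
    have "f_coef (2 * m) X = (\<Sum>u\<in>words (Suc (2 * m)). f_term q u)"
      using f_coef_eq_sum[of X "2 * m"] W by (simp add: q_def)
    also have "\<dots> = f_sum q (2 * m)"
      by (simp add: f_sum_def[OF M] f_term_def[OF W])
    also have "\<dots> = f_sum q n" by (rule f_sum_stable[OF M, symmetric]) (simp add: n_def)
    finally show ?thesis by (simp add: f_sum_def[OF M] f_term_def[OF W])
  qed
  have g: "g_coef n X = (\<Sum>u\<in>words (Suc n). g_term q u)"
    using g_coef_eq_sum[OF PX] W by (simp add: q_def)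
  have ln2: "(\<lambda>e::real. e\<^sup>2 * ln (1 / e)) \<in> O[at_right 0](\<lambda>e. e\<^sup>2 * (ln e)\<^sup>2)" by real_asymp
  have exp1: "(\<lambda>e. \<Phi> e - (C0 + f_coef (2 * m) X * e * ln (1 / e) + g_coef n X * e))
      \<in> O[at_right 0](\<lambda>e. e\<^sup>2 * (ln e)\<^sup>2)"
    unfolding f g \<Phi>_def C0_def by (rule landau_o.big_trans[OF cond_entropy_expansion[OF W] ln2])
  \<comment> \<open>Subtracting this expansion of the noise entropy is the source of the
    \<open>- 1\<close> in both coefficients.\<close>
  have exp2: "(\<lambda>e. binary_entropy e - (e * ln (1 / e) + e)) \<in> O[at_right 0](\<lambda>e. e\<^sup>2 * (ln e)\<^sup>2)"
    unfolding binary_entropy_def by real_asymp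
  \<comment> \<open>Any quantity squeezed between the output rate of the chain, reduced by the noise
    entropy, and the capacity inherits the expansion. It is used for the capacity and for every
    order \<open>k\<close>.\<close>
  have key: "(\<lambda>e. G e - (noisy_capacity S 0 + (f_coef (2 * m) X - 1) * e * ln (1 / e) + (g_coef n X - 1) * e))
      \<in> O[at_right 0](\<lambda>e. e\<^sup>2 * (ln e)\<^sup>2)"
    if G: "\<forall>\<^sub>F e in at_right 0. entropy_rate (bsc_output e X) - binary_entropy e \<le> G e \<and> G e \<le> noisy_capacity S e" for G
  proof -
    have "(\<lambda>e. G e - (\<Phi> e - binary_entropy e)) \<in> O[at_right 0](\<lambda>e. e\<^sup>2 * (ln e)\<^sup>2)"
    proof (rule landau_o.bigI[of "\<bar>K1\<bar> + \<bar>K2\<bar> + 1"])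
      show "\<forall>\<^sub>F e in at_right 0. norm (G e - (\<Phi> e - binary_entropy e)) \<le> (\<bar>K1\<bar> + \<bar>K2\<bar> + 1) * norm (e\<^sup>2 * (ln e)\<^sup>2)"
        using G upper lower eventually_small
      proof eventually_elim
        case (elim e)
        define l where "l = ln (1 / e)"
        have l1: "1 \<le> l"
          using elim ln_less_cancel_iff[of e "exp (- 1)"] by (simp add: l_def ln_div)
        have ll: "(ln e)\<^sup>2 = l\<^sup>2" using elim by (simp add: l_def ln_div)
        have y: "0 \<le> e\<^sup>2 * l\<^sup>2" by simp
        have "e\<^sup>2 * l \<le> e\<^sup>2 * l\<^sup>2" using l1 by (intro mult_left_mono) (auto simp: power2_eq_square)
        then have "\<bar>K2\<bar> * (e\<^sup>2 * l) \<le> \<bar>K2\<bar> * (e\<^sup>2 * l\<^sup>2)"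
          by (rule mult_left_mono) simp
        moreover have "K2 * (e\<^sup>2 * l) \<le> \<bar>K2\<bar> * (e\<^sup>2 * l)"
          using l1 by (intro mult_right_mono) auto
        moreover have "K1 * (e\<^sup>2 * l\<^sup>2) \<le> \<bar>K1\<bar> * (e\<^sup>2 * l\<^sup>2)" by (intro mult_right_mono y) auto
        moreover have "0 \<le> \<bar>K1\<bar> * (e\<^sup>2 * l\<^sup>2)" "0 \<le> \<bar>K2\<bar> * (e\<^sup>2 * l\<^sup>2)" using y by auto
        moreover have "G e - (\<Phi> e - binary_entropy e) \<le> K1 * (e\<^sup>2 * l\<^sup>2)"
          "- (G e - (\<Phi> e - binary_entropy e)) \<le> K2 * (e\<^sup>2 * l)"
          using elim unfolding ll l_def by linarith+
        ultimately have "\<bar>G e - (\<Phi> e - binary_entropy e)\<bar> \<le> \<bar>K1\<bar> * (e\<^sup>2 * l\<^sup>2) + \<bar>K2\<bar> * (e\<^sup>2 * l\<^sup>2) + e\<^sup>2 * l\<^sup>2"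
          using y by linarith
        then show ?case unfolding ll by (simp add: algebra_simps)
      qed
    qed simp
    from sum_in_bigo(2)[OF sum_in_bigo(1)[OF this exp1] exp2]
    show ?thesis by (simp add: cap0 algebra_simps)
  qed
  have XS: "allowed_words X \<subseteq> S" using S by simp
  have "(\<lambda>e. noisy_capacity S e - (noisy_capacity S 0 + (f_coef (2 * m) X - 1) * e * ln (1 / e) + (g_coef n X - 1) * e))
      \<in> O[at_right 0](\<lambda>e. e\<^sup>2 * (ln e)\<^sup>2)"
  proof (rule key)
    show "\<forall>\<^sub>F e in at_right 0. entropy_rate (bsc_output e X) - binary_entropy e \<le> noisy_capacity S e
        \<and> noisy_capacity S e \<le> noisy_capacity S e"
      using eventually_small
    proof eventually_elim
      case (elim e)
      then show ?case using rate_le[OF stX XS, of e] by simp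
    qed
  qed
  moreover have "(\<lambda>e. markov_output_entropy k S e - binary_entropy e
      - (noisy_capacity S 0 + (f_coef (2 * m) X - 1) * e * ln (1 / e) + (g_coef n X - 1) * e))
      \<in> O[at_right 0](\<lambda>e. e\<^sup>2 * (ln e)\<^sup>2)" if k: "m \<le> k" for k
  proof (rule key)
    let ?A = "{Y. irreducible_markov k Y \<and> allowed_words Y \<subseteq> S}"
    have "irreducible_markov k X"
      unfolding irreducible_markov_def
    proof (intro conjI ballI impI)
      show "markov_order k X"
        by (rule markov_order_of_law[OF stX markov_law_mono[OF M[unfolded q_def] k]])
      fix a b assume "a \<in> allowed_words X" "b \<in> allowed_words X"
      then obtain w where "a @ w @ b \<in> S" using irr[of a b] unfolding S S_iff by blast
      then show "\<exists>u\<in>allowed_words X. prefix a u \<and> suffix b u"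
        unfolding S by (intro bexI[of _ "a @ w @ b"]) (auto simp: suffix_def intro: exI[of _ "a @ w"])
    qed
    then have XA: "X \<in> ?A" using XS by simp
    \<comment> \<open>The maximal entropy chain is itself a competitor in the supremum, and every
      competitor is a stationary process with words in \<open>S\<close>, hence bounded by the
      capacity.\<close>
    show "\<forall>\<^sub>F e in at_right 0. entropy_rate (bsc_output e X) - binary_entropy e
        \<le> markov_output_entropy k S e - binary_entropy e
        \<and> markov_output_entropy k S e - binary_entropy e \<le> noisy_capacity S e"
      using eventually_small
    proof eventually_elim
      case (elim e)
      have le: "entropy_rate (bsc_output e Y) \<le> noisy_capacity S e + binary_entropy e" if "Y \<in> ?A" for Y
        using that elim by (intro rate_le) (auto simp: irreducible_markov_def markov_order_def)
      have "markov_output_entropy k S e \<le> noisy_capacity S e + binary_entropy e"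
        unfolding markov_output_entropy_def using XA le by (intro cSUP_least) auto
      moreover have "entropy_rate (bsc_output e X) \<le> markov_output_entropy k S e"
        unfolding markov_output_entropy_def
        by (rule cSUP_upper[OF XA]) (rule bdd_aboveI2[of _ _ "noisy_capacity S e + binary_entropy e"], rule le)
      ultimately show ?case by simp
    qed
  qed
  ultimately show ?thesis
    unfolding n_def m_def by blast
qed

end
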